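(* Let $G$ be a finite group of square-free order, and let $S_1$ and $S_2$ be symmetric subsets of $G$ such that the Cayley graphs $\mathrm{Cay}(G;S_1)$ and $\mathrm{Cay}(G;S_2)$ are connected. Then every chromatic isomorphism $\varphi$ from $\mathrm{Cay}(G;S_1)$ to $\mathrm{Cay}(G;S_2)$ is the composition of a colour-preserving automorphism of $\mathrm{Cay}(G;S_1)$ and an automorphism of the group $G$; that is, $\varphi = \alpha \circ \psi$ for some colour-preserving automorphism $\psi$ of $\mathrm{Cay}(G;S_1)$ and some group automorphism $\alpha$ of $G$.
   Context: A subset $S$ of a group $G$ is symmetric if $s^{-1} \in S$ for all $s \in S$. For a symmetric subset $S$ of $G$, the Cayley graph $\mathrm{Cay}(G;S)$ is the undirected graph whose vertices are the elements of $G$, with an edge joining $g$ and $gs$ for all $g \in G$ and $s \in S$. The edge joining $g$ and $gs$ is coloured with the set $\{s^{\pm 1}\} = \{s, s^{-1}\}$. A graph automorphism $\varphi$ of $\mathrm{Cay}(G;S)$ is colour-preserving if it preserves the colours of edges, i.e., $\varphi(gs) \in \{\varphi(g)\,s^{\pm 1}\}$ for all $g \in G$ and $s \in S$. A graph isomorphism $\varphi$ from $\mathrm{Cay}(G_1;S_1)$ to $\mathrm{Cay}(G_2;S_2)$ is chromatic if there is a bijection $\pi \colon S_1 \to S_2$ such that $\varphi(gs) \in \{\varphi(g)\,\pi(s)^{\pm 1}\}$ for all $g \in G_1$ and $s \in S_1$. *)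

theory Defs
  imports "HOL-Algebra.Algebra" "HOL-Computational_Algebra.Squarefree"
begin

text \<open>An undirected graph is a set of vertices with a set of edges; an edge is the set of its
  endpoints, so a loop at \<open>v\<close> is the singleton \<open>{v}\<close>.\<close>

type_synonym 'v ugraph = "'v set \<times> 'v set set"

definition graph_connected :: "'v ugraph \<Rightarrow> bool" where
  "graph_connected \<Gamma> \<longleftrightarrow>
     (\<forall>u\<in>fst \<Gamma>. \<forall>v\<in>fst \<Gamma>. (u, v) \<in> {(x, y). {x, y} \<in> snd \<Gamma>}\<^sup>*)"

definition graph_isomorphism :: "'v ugraph \<Rightarrow> 'w ugraph \<Rightarrow> ('v \<Rightarrow> 'w) \<Rightarrow> bool" where
  "graph_isomorphism \<Gamma>1 \<Gamma>2 \<phi> \<longleftrightarrow>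
     bij_betw \<phi> (fst \<Gamma>1) (fst \<Gamma>2) \<and>
     (\<forall>u\<in>fst \<Gamma>1. \<forall>v\<in>fst \<Gamma>1. {u, v} \<in> snd \<Gamma>1 \<longleftrightarrow> {\<phi> u, \<phi> v} \<in> snd \<Gamma>2)"

definition symmetric_subset :: "('a, 'm) monoid_scheme \<Rightarrow> 'a set \<Rightarrow> bool" where
  "symmetric_subset G S \<longleftrightarrow> S \<subseteq> carrier G \<and> (\<forall>s\<in>S. inv\<^bsub>G\<^esub> s \<in> S)"

text \<open>The identity is not excluded from \<open>S\<close>; if it belongs to \<open>S\<close>, there is a loop at every
  vertex.\<close>

definition Cay :: "('a, 'm) monoid_scheme \<Rightarrow> 'a set \<Rightarrow> 'a ugraph" where
  "Cay G S = (carrier G, {{g, g \<otimes>\<^bsub>G\<^esub> s} | g s. g \<in> carrier G \<and> s \<in> S})"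

definition colour_preserving_automorphism ::
  "('a, 'm) monoid_scheme \<Rightarrow> 'a set \<Rightarrow> ('a \<Rightarrow> 'a) \<Rightarrow> bool" where
  "colour_preserving_automorphism G S \<phi> \<longleftrightarrow>
     graph_isomorphism (Cay G S) (Cay G S) \<phi> \<and>
     (\<forall>g\<in>carrier G. \<forall>s\<in>S.
        \<phi> (g \<otimes>\<^bsub>G\<^esub> s) \<in> {\<phi> g \<otimes>\<^bsub>G\<^esub> s, \<phi> g \<otimes>\<^bsub>G\<^esub> inv\<^bsub>G\<^esub> s})"

definition chromatic_isomorphism ::
  "('a, 'm) monoid_scheme \<Rightarrow> 'a set \<Rightarrow> ('b, 'n) monoid_scheme \<Rightarrow> 'b set \<Rightarrow> ('a \<Rightarrow> 'b) \<Rightarrow> bool" where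
  "chromatic_isomorphism G1 S1 G2 S2 \<phi> \<longleftrightarrow>
     graph_isomorphism (Cay G1 S1) (Cay G2 S2) \<phi> \<and>
     (\<exists>\<pi>. bij_betw \<pi> S1 S2 \<and>
        (\<forall>g\<in>carrier G1. \<forall>s\<in>S1.
           \<phi> (g \<otimes>\<^bsub>G1\<^esub> s) \<in> {\<phi> g \<otimes>\<^bsub>G2\<^esub> \<pi> s, \<phi> g \<otimes>\<^bsub>G2\<^esub> inv\<^bsub>G2\<^esub> (\<pi> s)}))"

end

theory Submission imports Defs "HOL-Number_Theory.Cong" begin

hide_const (open) Divisibility.prime

text \<open>Let \<open>L\<close> be the group of left translations and \<open>A\<close> the group of colour-preserving
  permutations of \<open>Cay(G; S1)\<close>. As in Babai's lemma, it suffices that \<open>L\<close> and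
  \<open>\<phi>\<inverse> L \<phi>\<close>, both contained in \<open>A\<close>, are conjugate in \<open>A\<close>. The point stabilizers of \<open>A\<close> have no
  nontrivial element of odd order, so an odd prime divides \<open>\<bar>A\<bar>\<close> at most once. A group of
  square-free order has a tower of characteristic subgroups with factors of prime order, the largest
  prime at the bottom; Sylow's theorem, applied along this tower in successive normalizers, conjugates
  the odd parts of the two groups into each other. For even order the remaining involutions are
  compared through their action on the factors of the tower.\<close>

text \<open>Why conjugacy suffices: if \<open>a\<close> in \<open>A\<close> carries
  \<open>\<phi>^-1 L \<phi>\<close> to \<open>L\<close>, then \<open>\<phi> a^-1\<close> normalizes
  \<open>L\<close>, hence is a group automorphism followed by a left translation, and since
  \<open>L\<close> lies in \<open>A\<close> the translation can be moved into the colour-preserving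
  factor. Three obstacles shape the work. That \<open>\<phi>^-1 L \<phi>\<close> lies in
  \<open>A\<close> is not automatic: \<pi> is an arbitrary bijection, so an involution might receive
  the colour of an element that is not one. Finally, the levels of the tower are the solution sets
  of \<open>x^d = 1\<close>, which conjugation carries along without any choice; that they are
  subgroups rests on counting them, and there the descending order of the primes enters: no prime
  larger than \<open>p\<close> divides \<open>p - 1\<close>.\<close>

section \<open>Square-free numbers and their largest prime factors\<close>

text \<open>For square-free \<open>n\<close> these are the products of the largest prime factors of \<open>n\<close>; they index
  the levels of the Sylow tower.\<close>

definition upper_divisor :: "nat \<Rightarrow> nat \<Rightarrow> bool" where
  "upper_divisor n d \<longleftrightarrow> d dvd n \<and> (\<forall>p q. prime p \<longrightarrow> prime q \<longrightarrow> p dvd n div d \<longrightarrow> q dvd d \<longrightarrow> p < q)"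

lemma upper_divisor_dvd: "upper_divisor n d \<Longrightarrow> d dvd n"
  by (simp add: upper_divisor_def)

lemma squarefree_dvd_square: "squarefree (n::nat) \<Longrightarrow> prime p \<Longrightarrow> \<not> p * p dvd n"
  by (metis not_prime_unit power2_eq_square squarefree_def)

lemma squarefree_mult_imp_coprime:
  fixes a b :: nat
  assumes "squarefree (a * b)"
  shows "coprime a b"
proof (rule coprimeI)
  fix c assume "c dvd a" "c dvd b"
  hence "c ^ 2 dvd a * b" by (simp add: mult_dvd_mono power2_eq_square)
  thus "is_unit c" using assms squarefreeD by blast
qed

lemma upper_divisor_coprime_prime:
  assumes "squarefree n" "upper_divisor n (p * d)" "prime p"
  shows "coprime p d"
proof -
  have "p * d dvd n" using assms(2) by (simp add: upper_divisor_def)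
  hence "squarefree (p * d)" using assms(1) squarefree_mono by blast
  thus ?thesis using squarefree_mult_imp_coprime by blast
qed

text \<open>Used to see that \<open>p - 1\<close> shares no prime factor with \<open>d\<close>, on
  which the count of torsion elements depends.\<close>

lemma upper_divisor_prime_less:
  assumes "upper_divisor n (p * d)" "upper_divisor n d" "n > 0" "prime p" "prime q" "q dvd d"
  shows "p < q"
proof -
  obtain c where "n = p * d * c" using upper_divisor_dvd[OF assms(1)] by (elim dvdE)
  hence "n div d = p * c" using assms(3) by auto
  thus ?thesis using assms by (auto simp: upper_divisor_def)
qed

text \<open>The new prime is the largest one of \<open>n div d\<close>: it is below the primes of
  \<open>d\<close>, and square-freeness puts all that is left strictly below it.\<close>

lemma upper_divisor_raise:
  assumes n: "squarefree n" and d: "upper_divisor n d" "d \<noteq> n"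
  obtains p where "prime p" "upper_divisor n (p * d)"
proof -
  define c where "c = n div d"
  have nc: "n = d * c" using d(1) by (simp add: upper_divisor_def c_def)
  have c1: "c \<noteq> 1" using nc d(2) by auto
  have n0: "n > 0" using n by (auto intro: gr0I)
  hence c0: "c > 0" "d > 0" using nc by auto
  have fin: "finite {p. prime p \<and> p dvd c}" using c0 by (auto intro: finite_subset[OF _ finite_divisors_nat[of c]])
  define p where "p = Max {p. prime p \<and> p dvd c}"
  have ne: "{p. prime p \<and> p dvd c} \<noteq> {}" using c1 prime_factor_nat[of c] by blast
  have p: "prime p" "p dvd c" using Max_in[OF fin ne] by (auto simp: p_def)
  have mx: "q \<le> p" if "prime q" "q dvd c" for q using Max_ge[OF fin] that by (auto simp: p_def)
  obtain b where b: "c = p * b" using p by auto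
  have nb: "n = p * d * b" using nc b by simp
  have cop: "coprime p b"
    using n nc b squarefree_mult_imp_coprime squarefree_mono by (metis dvd_triv_right)
  have p0: "p > 0" using p prime_gt_0_nat by blast
  have "upper_divisor n (p * d)" unfolding upper_divisor_def
  proof (intro conjI allI impI)
    show "p * d dvd n" using nb by simp
    fix r q assume r: "prime r" and q: "prime q" and rd: "r dvd n div (p * d)" and qd: "q dvd p * d"
    have rb: "r dvd b" using rd nb p0 c0 by simp
    have rp: "r \<noteq> p" using rb cop p(1) by (metis coprime_absorb_left not_prime_unit)
    have rc: "r dvd c" using rb b by simp
    have rl: "r < p" using mx[OF r rc] rp by simp
    show "r < q"
    proof (cases "q dvd d")
      case True
      thus ?thesis using d(1) r q rc by (auto simp: upper_divisor_def c_def)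
    next
      case False
      hence "q dvd p" using qd q by (simp add: prime_dvd_mult_iff)
      hence "q = p" using p(1) q primes_dvd_imp_eq by blast
      thus ?thesis using rl by simp
    qed
  qed
  thus ?thesis using that p(1) by blast
qed

lemma upper_divisor_lower:
  assumes n: "squarefree n" and d: "upper_divisor n d" "d \<noteq> 1"
  obtains p e where "prime p" "d = p * e" "upper_divisor n e"
proof -
  have n0: "n > 0" using n by (auto intro: gr0I)
  have dn: "d dvd n" using d(1) by (simp add: upper_divisor_def)
  have d0: "d > 0" using n0 dn by (auto intro: gr0I)
  define p where "p = (LEAST p. prime p \<and> p dvd d)"
  have "\<exists>p. prime p \<and> p dvd d" using d(2) prime_factor_nat by blast
  hence p: "prime p" "p dvd d" using LeastI_ex[of "\<lambda>p. prime p \<and> p dvd d"] by (auto simp: p_def)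
  have mn: "p \<le> q" if "prime q" "q dvd d" for q using that by (auto simp: p_def intro: Least_le)
  obtain e where e: "d = p * e" using p by auto
  obtain c where c: "n = d * c" using dn by auto
  have cop: "coprime p e" using n dn e squarefree_mult_imp_coprime squarefree_mono by metis
  have e0: "e > 0" using e d0 by auto
  have "upper_divisor n e" unfolding upper_divisor_def
  proof (intro conjI allI impI)
    show "e dvd n" using c e by simp
    fix r q assume r: "prime r" and q: "prime q" and rd: "r dvd n div e" and qd: "q dvd e"
    have "n div e = p * c" using c e e0 by simp
    hence rr: "r dvd p \<or> r dvd c" using rd r by (simp add: prime_dvd_mult_iff)
    have qp: "q \<noteq> p" using qd cop p(1) by (metis coprime_absorb_left not_prime_unit)
    have pq: "p < q" using mn[of q] qp q qd e by force
    have ndc: "n div d = c" using c d0 by simp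
    show "r < q"
    proof (cases "r dvd c")
      case True
      thus ?thesis using d(1) r q qd ndc e by (auto simp: upper_divisor_def)
    next
      case False
      hence "r = p" using rr p(1) r primes_dvd_imp_eq by blast
      thus ?thesis using pq by simp
    qed
  qed
  thus ?thesis using that p(1) e by blast
qed

lemma upper_divisor_induct [consumes 2, case_names one step]:
  assumes n: "squarefree n" and d: "upper_divisor n d"
    and one: "P 1"
    and step: "\<And>p d. prime p \<Longrightarrow> upper_divisor n (p * d) \<Longrightarrow> upper_divisor n d \<Longrightarrow> P d \<Longrightarrow> P (p * d)"
  shows "P d"
  using d
proof (induction d rule: less_induct)
  case (less d)
  show ?case
  proof (cases "d = 1")
    case True thus ?thesis using one by simp
  next
    case False
    then obtain p e where e: "prime p" "d = p * e" "upper_divisor n e"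
      using upper_divisor_lower[OF n less.prems] by blast
    have "d > 0" using less.prems n by (auto intro!: gr0I simp: upper_divisor_def)
    hence "e < d" using e prime_gt_1_nat[of p] by auto
    thus ?thesis using step e less by blast
  qed
qed

lemma upper_divisor_self: "upper_divisor n n" if "n > 0"
  using that by (auto simp: upper_divisor_def)

text \<open>The torsion count is known at the top by Lagrange's theorem and is passed down from
  \<open>p * d\<close> to \<open>d\<close>, against the direction in which the subgroups are
  built.\<close>

lemma upper_divisor_downward_induct [consumes 2, case_names self step]:
  assumes n: "squarefree n" and d: "upper_divisor n d"
    and self: "P n"
    and step: "\<And>p d. prime p \<Longrightarrow> upper_divisor n (p * d) \<Longrightarrow> upper_divisor n d \<Longrightarrow> P (p * d) \<Longrightarrow> P d"
  shows "P d"
  using d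
proof (induction "n - d" arbitrary: d rule: less_induct)
  case less
  have n0: "n > 0" using n by (auto intro: gr0I)
  show ?case
  proof (cases "d = n")
    case True thus ?thesis using self by simp
  next
    case False
    then obtain p where p: "prime p" "upper_divisor n (p * d)"
      using upper_divisor_raise[OF n less.prems] by blast
    have "p * d \<le> n" using p(2) n0 by (auto simp: upper_divisor_def intro: dvd_imp_le)
    moreover have "d < p * d" using prime_gt_1_nat[OF p(1)] less.prems n0
      by (auto intro!: gr0I simp: upper_divisor_def)
    ultimately have "n - p * d < n - d" by linarith
    thus ?thesis using step p less by blast
  qed
qed

text \<open>Serves the passage to a centralizer of order \<open>k\<close>. The cofactor
  \<open>k div gcd d k\<close> is coprime to \<open>d div gcd d k\<close> and so divides
  \<open>n div d\<close>, which keeps its primes small.\<close>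

lemma upper_divisor_gcd:
  assumes n: "squarefree n" and d: "upper_divisor n d" and k: "k dvd n"
  shows "upper_divisor k (gcd d k)"
  unfolding upper_divisor_def
proof (intro conjI allI impI)
  show "gcd d k dvd k" by simp
  fix r q assume r: "prime r" and q: "prime q" and rd: "r dvd k div gcd d k" and qd: "q dvd gcd d k"
  have n0: "n > 0" using n by (auto intro: gr0I)
  obtain c where c: "n = d * c" using upper_divisor_dvd[OF d] by (elim dvdE)
  have "d \<noteq> 0" using n0 c by (intro notI) simp
  have "k \<noteq> 0" using n0 k by (intro notI) simp
  hence cop: "coprime (k div gcd d k) (d div gcd d k)"
    using \<open>d \<noteq> 0\<close> by (metis coprime_commute div_gcd_coprime)
  have "k dvd d * c" using k c by simp
  hence "k div gcd d k dvd d div gcd d k * c"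
    using \<open>k \<noteq> 0\<close> by (metis div_dvd_div div_mult_swap dvd_div_mult dvd_mult2 gcd_dvd1 gcd_dvd2)
  hence "k div gcd d k dvd c" using cop by (simp add: coprime_dvd_mult_right_iff)
  moreover have "n div d = c" using c \<open>d \<noteq> 0\<close> by simp
  ultimately have "r dvd n div d" using rd dvd_trans by blast
  moreover have "q dvd d" using qd by simp
  ultimately show "r < q" using d r q by (auto simp: upper_divisor_def)
qed

section \<open>Conjugation, torsion and cyclic subgroups\<close>

definition conj_by :: "('a, 'b) monoid_scheme \<Rightarrow> 'a \<Rightarrow> 'a \<Rightarrow> 'a" where
  "conj_by G g x = g \<otimes>\<^bsub>G\<^esub> x \<otimes>\<^bsub>G\<^esub> inv\<^bsub>G\<^esub> g"

text \<open>A solution set instead of a chosen subgroup: conjugation carries it to the corresponding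
  set of the conjugate group, so its invariance under \<open>C\<close> is automatic. That it is a
  subgroup at the levels of the tower follows later from a count.\<close>

definition torsion :: "('a, 'b) monoid_scheme \<Rightarrow> 'a set \<Rightarrow> nat \<Rightarrow> 'a set" where
  "torsion G C d = {x \<in> C. x [^]\<^bsub>G\<^esub> d = \<one>\<^bsub>G\<^esub>}"

definition powers :: "('a, 'b) monoid_scheme \<Rightarrow> 'a \<Rightarrow> 'a set" where
  "powers G y = range (\<lambda>i::nat. y [^]\<^bsub>G\<^esub> i)"

locale finite_group = group +
  assumes finite_carrier: "finite (carrier G)"

context group
begin

lemma conj_by_closed [simp]: "g \<in> carrier G \<Longrightarrow> x \<in> carrier G \<Longrightarrow> conj_by G g x \<in> carrier G"
  by (simp add: conj_by_def)

lemma conj_by_mult: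
  "g \<in> carrier G \<Longrightarrow> x \<in> carrier G \<Longrightarrow> y \<in> carrier G \<Longrightarrow>
    conj_by G g (x \<otimes> y) = conj_by G g x \<otimes> conj_by G g y"
  by (simp add: conj_by_def m_assoc) (simp flip: m_assoc)

lemma conj_by_comp:
  "g \<in> carrier G \<Longrightarrow> h \<in> carrier G \<Longrightarrow> x \<in> carrier G \<Longrightarrow>
    conj_by G (g \<otimes> h) x = conj_by G g (conj_by G h x)"
  by (simp add: conj_by_def m_assoc inv_mult_group)

lemma conj_by_one [simp]: "x \<in> carrier G \<Longrightarrow> conj_by G \<one> x = x"
  by (simp add: conj_by_def)

lemma conj_by_one_right [simp]: "g \<in> carrier G \<Longrightarrow> conj_by G g \<one> = \<one>"
  by (simp add: conj_by_def)

lemma conj_by_inv_cancel [simp]: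
  "g \<in> carrier G \<Longrightarrow> x \<in> carrier G \<Longrightarrow> conj_by G (inv g) (conj_by G g x) = x"
  "g \<in> carrier G \<Longrightarrow> x \<in> carrier G \<Longrightarrow> conj_by G g (conj_by G (inv g) x) = x"
  by (simp_all flip: conj_by_comp)

lemma conj_by_pow:
  "g \<in> carrier G \<Longrightarrow> x \<in> carrier G \<Longrightarrow> conj_by G g (x [^] (n::nat)) = conj_by G g x [^] n"
  by (induction n) (simp_all add: conj_by_mult)

lemma conj_by_inv:
  "g \<in> carrier G \<Longrightarrow> x \<in> carrier G \<Longrightarrow> conj_by G g (inv x) = inv (conj_by G g x)"
  by (simp add: conj_by_def m_assoc inv_mult_group)

lemma inj_on_conj_by: "g \<in> carrier G \<Longrightarrow> C \<subseteq> carrier G \<Longrightarrow> inj_on (conj_by G g) C"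
  by (rule inj_on_inverseI[where g = "conj_by G (inv g)"]) auto

lemma conj_by_image_comp:
  "g \<in> carrier G \<Longrightarrow> h \<in> carrier G \<Longrightarrow> C \<subseteq> carrier G \<Longrightarrow>
    conj_by G (g \<otimes> h) ` C = conj_by G g ` conj_by G h ` C"
  by (force simp: conj_by_comp image_image)

lemma conj_by_image_inv:
  assumes "g \<in> carrier G" "C \<subseteq> carrier G" "conj_by G g ` C = D"
  shows "conj_by G (inv g) ` D = C"
  using assms by (force simp: image_image subset_iff)

lemma conj_by_eq_self_iff:
  "g \<in> carrier G \<Longrightarrow> x \<in> carrier G \<Longrightarrow> conj_by G g x = x \<longleftrightarrow> g \<otimes> x = x \<otimes> g"
  by (simp add: conj_by_def inv_solve_right')

lemma subgroup_conj_by: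
  assumes "subgroup C G" "g \<in> C" "x \<in> C" shows "conj_by G g x \<in> C"
  using assms by (simp add: conj_by_def subgroup.m_closed subgroup.m_inv_closed)

lemma subgroup_pow_closed: "subgroup C G \<Longrightarrow> x \<in> C \<Longrightarrow> x [^] (n::nat) \<in> C"
  by (induction n) (simp_all add: subgroup.m_closed subgroup.one_closed)

lemma subgroup_conj_by_image:
  assumes C: "subgroup C G" and g: "g \<in> C" shows "conj_by G g ` C = C"
proof -
  have cg: "g \<in> carrier G" "C \<subseteq> carrier G" using assms subgroup.subset by blast+
  have "x \<in> conj_by G g ` C" if "x \<in> C" for x
  proof (rule image_eqI)
    show "x = conj_by G g (conj_by G (inv g) x)" using that cg by auto
    show "conj_by G (inv g) x \<in> C" using subgroup_conj_by[OF C subgroup.m_inv_closed[OF C g] that] .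
  qed
  thus ?thesis using subgroup_conj_by[OF C g] by blast
qed

lemma subgroup_conj_by_subgroup:
  assumes C: "subgroup C G" and g: "g \<in> carrier G" shows "subgroup (conj_by G g ` C) G"
proof (rule subgroupI)
  have cg: "C \<subseteq> carrier G" using assms subgroup.subset by blast+
  show "conj_by G g ` C \<subseteq> carrier G" using cg g by auto
  show "conj_by G g ` C \<noteq> {}" using subgroup.one_closed[OF C] by auto
  fix a assume "a \<in> conj_by G g ` C"
  then obtain x where x: "x \<in> C" "a = conj_by G g x" by blast
  hence "inv a = conj_by G g (inv x)" using cg g by (auto simp: conj_by_inv)
  thus "inv a \<in> conj_by G g ` C" using x C by (simp add: subgroup.m_inv_closed)
next
  have cg: "C \<subseteq> carrier G" using assms subgroup.subset by blast+
  fix a b assume "a \<in> conj_by G g ` C" "b \<in> conj_by G g ` C"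
  then obtain x y where x: "x \<in> C" "a = conj_by G g x" "y \<in> C" "b = conj_by G g y" by blast
  moreover have "x \<in> carrier G" "y \<in> carrier G" using x(1,3) cg by blast+
  ultimately have "a \<otimes> b = conj_by G g (x \<otimes> y)" using g conj_by_mult[of g x y] by simp
  thus "a \<otimes> b \<in> conj_by G g ` C" using x C by (simp add: subgroup.m_closed)
qed

text \<open>The set \<open>K\<close> is arbitrary: a singleton turns this normalizer into a
  centralizer, a level of the tower gives the group in which Sylow's theorem is applied.\<close>

lemma subgroup_normalizing:
  assumes A: "subgroup A G" and K: "K \<subseteq> carrier G"
  shows "subgroup {x \<in> A. conj_by G x ` K = K} G"
proof (rule subgroupI)
  have cg: "A \<subseteq> carrier G" using assms subgroup.subset by blast+
  show "{x \<in> A. conj_by G x ` K = K} \<subseteq> carrier G" using cg by auto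
  have "conj_by G \<one> ` K = K" using K by (force simp: subset_iff)
  thus "{x \<in> A. conj_by G x ` K = K} \<noteq> {}" using subgroup.one_closed[OF A] by auto
  fix a assume a: "a \<in> {x \<in> A. conj_by G x ` K = K}"
  hence "conj_by G (inv a) ` K = K" using conj_by_image_inv[of a K K] K cg by auto
  thus "inv a \<in> {x \<in> A. conj_by G x ` K = K}" using a A by (auto simp: subgroup.m_inv_closed)
next
  have cg: "A \<subseteq> carrier G" using assms subgroup.subset by blast+
  fix a b assume ab: "a \<in> {x \<in> A. conj_by G x ` K = K}" "b \<in> {x \<in> A. conj_by G x ` K = K}"
  hence "conj_by G (a \<otimes> b) ` K = K" using cg K conj_by_image_comp[of a b K] by auto
  thus "a \<otimes> b \<in> {x \<in> A. conj_by G x ` K = K}" using ab A by (simp add: subgroup.m_closed)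
qed

lemma conj_by_image_torsion:
  assumes "g \<in> carrier G" "C \<subseteq> carrier G"
  shows "conj_by G g ` torsion G C d = torsion G (conj_by G g ` C) d"
proof -
  have "conj_by G g x [^] d = \<one> \<longleftrightarrow> x [^] d = \<one>" if "x \<in> C" for x
  proof -
    have "conj_by G g x [^] d = conj_by G g (x [^] d)" using that assms by (auto simp: conj_by_pow)
    moreover have "x [^] d \<in> carrier G" using that assms by auto
    ultimately show ?thesis using assms(1) conj_by_inv_cancel(1)[of g "x [^] d"] by (metis conj_by_one_right inv_closed)
  qed
  thus ?thesis unfolding torsion_def by blast
qed

lemma torsion_subset: "torsion G C d \<subseteq> C"
  by (auto simp: torsion_def)

lemma pow_eq_one_dvd: "x \<in> carrier G \<Longrightarrow> x [^] (d::nat) = \<one> \<Longrightarrow> d dvd n \<Longrightarrow> x [^] n = \<one>"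
  by (metis dvd_def nat_pow_one nat_pow_pow)

lemma torsion_mono: "C \<subseteq> carrier G \<Longrightarrow> d dvd e \<Longrightarrow> torsion G C d \<subseteq> torsion G C e"
  using pow_eq_one_dvd unfolding torsion_def by blast

lemma torsion_torsion: "C \<subseteq> carrier G \<Longrightarrow> d dvd e \<Longrightarrow> torsion G (torsion G C e) d = torsion G C d"
  using torsion_mono[of C d e] unfolding torsion_def by blast

lemma torsion_1: "C \<subseteq> carrier G \<Longrightarrow> \<one> \<in> C \<Longrightarrow> torsion G C 1 = {\<one>}"
  by (auto simp: torsion_def)

lemma pow_eq_one_iff_ord_dvd: "x \<in> carrier G \<Longrightarrow> x [^] (n::nat) = \<one> \<longleftrightarrow> ord x dvd n"
  by (rule pow_eq_id)

lemma pow_gcd_eq_one: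
  assumes "x \<in> carrier G" "x [^] (m::nat) = \<one>" "x [^] (n::nat) = \<one>"
  shows "x [^] gcd m n = \<one>"
  using assms by (simp add: pow_eq_one_iff_ord_dvd)

lemma pow_coprime_eq_one:
  assumes "x \<in> carrier G" "x [^] (m::nat) = \<one>" "x [^] (n::nat) = \<one>" "coprime m n"
  shows "x = \<one>"
  using pow_gcd_eq_one[OF assms(1-3)] assms by (simp add: coprime_iff_gcd_eq_1)

lemma pow_cong:
  assumes "x \<in> carrier G" "x [^] (m::nat) = \<one>" "a mod m = b mod m"
  shows "x [^] a = x [^] (b::nat)"
proof -
  have "x [^] a = x [^] (a mod m)" for a :: nat
  proof -
    have "x [^] a = x [^] (m * (a div m) + a mod m)" by simp
    also have "\<dots> = x [^] (m * (a div m)) \<otimes> x [^] (a mod m)" using assms by (simp only: nat_pow_mult)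
    also have "x [^] (m * (a div m)) = \<one>" using assms(1,2) by (rule pow_eq_one_dvd) simp
    finally show ?thesis using assms by simp
  qed
  thus ?thesis using assms(3) by metis
qed

lemma ord_eq_prime:
  assumes "x \<in> carrier G" "x [^] (p::nat) = \<one>" "x \<noteq> \<one>" "prime p"
  shows "ord x = p"
  using assms by (metis ord_eq_1 pow_eq_id prime_nat_iff)

lemma subgroup_pow_card_eq_one:
  assumes C: "subgroup C G" and x: "x \<in> C" shows "x [^] card C = \<one>"
  using group.pow_order_eq_1[OF subgroup_imp_group[OF C], of x] x
  by (simp add: order_def flip: nat_pow_consistent)

lemma card_subgroup_dvd:
  assumes C: "subgroup C G" and D: "subgroup D G" "D \<subseteq> C"
  shows "card D dvd card C"
proof -
  have "subgroup D (G\<lparr>carrier := C\<rparr>)" using subgroup_incl[OF D(1) C D(2)] .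
  hence "card (rcosets\<^bsub>G\<lparr>carrier := C\<rparr>\<^esub> D) * card D = card C"
    using group.lagrange[OF subgroup_imp_group[OF C], of D] by (simp add: order_def)
  thus ?thesis by (metis dvd_triv_right)
qed

lemma one_in_powers: "\<one> \<in> powers G y"
  unfolding powers_def by (metis nat_pow_0 rangeI)

lemma self_in_powers: "y \<in> carrier G \<Longrightarrow> y \<in> powers G y"
  unfolding powers_def by (metis nat_pow_eone rangeI)

end

context finite_group
begin

lemma finite_subgroup: "subgroup C G \<Longrightarrow> finite C"
  using finite_carrier finite_subset subgroup.subset by blast

lemma subgroup_card_pos: "subgroup C G \<Longrightarrow> card C > 0"
  using finite_subgroup subgroup.one_closed card_gt_0_iff by blast

lemma powers_eq_generate: "y \<in> carrier G \<Longrightarrow> powers G y = generate G {y}"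
  using generate_pow_on_finite_carrier[OF finite_carrier, of y] by (auto simp: powers_def)

lemma subgroup_powers: "y \<in> carrier G \<Longrightarrow> subgroup (powers G y) G"
  by (simp add: powers_eq_generate generate_is_subgroup)

lemma card_powers: "y \<in> carrier G \<Longrightarrow> card (powers G y) = ord y"
  by (simp add: powers_eq_generate generate_pow_card)

lemma powers_subset: "subgroup C G \<Longrightarrow> y \<in> C \<Longrightarrow> powers G y \<subseteq> C"
  unfolding powers_def using subgroup_pow_closed by blast

lemma cauchy_subgroup:
  assumes C: "subgroup C G" and p: "prime p" "p dvd card C"
  obtains y where "y \<in> C" "y \<noteq> \<one>" "y [^] p = \<one>"
proof -
  \<comment> \<open>Sylow's theorem with exponent 1: \<open>m\<close> may still be divisible by
    \<open>p\<close>, yet the subgroup has order exactly \<open>p\<close>, and any non-identity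
    element of it will do.\<close>
  obtain m where "card C = p ^ 1 * m" using p(2) unfolding dvd_def by auto
  then obtain D where D: "subgroup D (G\<lparr>carrier := C\<rparr>)" "card D = p"
    using sylow_thm[OF p(1) subgroup_imp_group[OF C], of 1 m] finite_subgroup[OF C] by (auto simp: order_def)
  have DG: "subgroup D G" "D \<subseteq> C" using D(1) C incl_subgroup subgroup.subset by force+
  obtain y where y: "y \<in> D" "y \<noteq> \<one>"
  proof -
    have "D \<noteq> {\<one>}" using D(2) p(1) by auto
    thus ?thesis using that subgroup.one_closed[OF DG(1)] by blast
  qed
  thus ?thesis using that subgroup_pow_card_eq_one[OF DG(1), of y] D(2) DG(2) by auto
qed

lemma powers_of_prime_order:
  assumes "y \<in> carrier G" "y [^] (p::nat) = \<one>" "prime p" "z \<in> powers G y" "z \<noteq> \<one>"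
  shows "powers G z = powers G y"
proof -
  have y1: "y \<noteq> \<one>" using assms(4,5) by (auto simp: powers_def)
  have zc: "z \<in> carrier G" using assms(1,4) by (auto simp: powers_def)
  have sub: "powers G z \<subseteq> powers G y" using powers_subset[OF subgroup_powers] assms by blast
  obtain i :: nat where i: "z = y [^] i" using assms(4) by (auto simp: powers_def)
  have "z [^] p = (y [^] p) [^] i" using assms(1) by (simp add: i nat_pow_pow mult.commute)
  hence "z [^] p = \<one>" using assms(2) by simp
  hence "card (powers G z) = card (powers G y)"
    using ord_eq_prime assms y1 zc by (simp add: card_powers)
  thus ?thesis using card_subset_eq[OF finite_subgroup[OF subgroup_powers[OF assms(1)]] sub] by simp
qed

end

section \<open>Sylow conjugacy for a prime dividing the order once\<close>

text \<open>Bezout gives \<open>k * u = p * v + 1\<close>: both \<open>k * u\<close> and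
  \<open>p * v\<close> steps return to \<open>x\<close>, and the difference is a single application
  of \<open>f\<close>.\<close>

lemma funpow_coprime_fixed:
  assumes k: "(f ^^ k) x = x" and p: "(f ^^ p) x = x" and "coprime k p" "k \<noteq> 0"
  shows "f x = x"
proof -
  obtain u v where uv: "k * u = p * v + 1"
    using bezout_nat[OF assms(4), of p] assms(3) by (auto simp: coprime_iff_gcd_eq_1)
  have "(f ^^ (m * i)) x = x" if "(f ^^ m) x = x" for m i
    using that by (induction i) (simp_all add: funpow_add)
  hence "(f ^^ (k * u)) x = x" "(f ^^ (p * v)) x = x" using k p by blast+
  thus ?thesis using uv by (simp del: funpow_mult)
qed

text \<open>Without a fixed point every orbit has exactly \<open>p\<close> elements, and the orbits
  partition \<Omega>, so \<open>p\<close> would divide its size.\<close>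

lemma prime_order_permutation_fixed_point:
  assumes fin: "finite \<Omega>" and f: "\<And>x. x \<in> \<Omega> \<Longrightarrow> f x \<in> \<Omega>"
    and fp: "\<And>x. x \<in> \<Omega> \<Longrightarrow> (f ^^ p) x = x" and p: "prime p" and ndvd: "\<not> p dvd card \<Omega>"
  shows "\<exists>x\<in>\<Omega>. f x = x"
proof (rule ccontr)
  assume no: "\<not> ?thesis"
  have p0: "p > 0" using p prime_gt_0_nat by blast
  define orb where "orb = (\<lambda>x. range (\<lambda>i. (f ^^ i) x))"
  have \<Omega>: "(f ^^ i) x \<in> \<Omega>" if "x \<in> \<Omega>" for i x using f that by (induction i) auto
  have orb_eq: "orb x = (\<lambda>i. (f ^^ i) x) ` {..<p}" if "x \<in> \<Omega>" for x
  proof -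
    have "(f ^^ i) x \<in> (\<lambda>i. (f ^^ i) x) ` {..<p}" for i
      by (rule image_eqI[where x = "i mod p"]) (simp_all add: funpow_mod_eq[OF fp[OF that]] p0)
    thus ?thesis by (auto simp: orb_def)
  qed
  have card_orb: "card (orb x) = p" if x: "x \<in> \<Omega>" for x
  proof -
    have ne: "(f ^^ i) x \<noteq> (f ^^ j) x" if ij: "i < j" "j < p" for i j
    proof
      assume eq: "(f ^^ i) x = (f ^^ j) x"
      have "x = (f ^^ (p - i)) ((f ^^ i) x)" using fp[OF x] ij funpow_add[of "p - i" i f] by (simp add: fun_eq_iff)
      also have "\<dots> = (f ^^ (p - i + j)) x" by (simp add: eq funpow_add)
      also have "p - i + j = (j - i) + p" using ij by simp
      also have "(f ^^ (j - i + p)) x = (f ^^ (j - i)) x" by (simp add: funpow_add fp[OF x])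
      finally have "(f ^^ (j - i)) x = x" by simp
      moreover have "coprime (j - i) p"
        using prime_imp_coprime[OF p, of "j - i"] nat_dvd_not_less[of "j - i" p] ij
        by (simp add: coprime_commute)
      ultimately have "f x = x" using funpow_coprime_fixed[OF _ fp[OF x]] ij by simp
      thus False using no x by blast
    qed
    have "inj_on (\<lambda>i. (f ^^ i) x) {..<p}"
      by (rule inj_onI) (metis ne lessThan_iff nat_neq_iff)
    thus ?thesis by (simp add: orb_eq[OF x] card_image)
  qed
  have orb_mem: "orb y = orb x" if x: "x \<in> \<Omega>" and y: "y \<in> orb x" for x y
  proof -
    obtain j where j: "y = (f ^^ j) x" using y by (auto simp: orb_def)
    have "orb y \<subseteq> orb x" 
      unfolding orb_def j using funpow_add[of _ j f] by (auto simp: fun_eq_iff) (metis rangeI)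
    moreover have "finite (orb x)" by (simp add: orb_eq[OF x])
    moreover have "y \<in> \<Omega>" using j \<Omega> x by blast
    ultimately show ?thesis using card_subset_eq card_orb x by metis
  qed
  have "p dvd card (\<Union>(orb ` \<Omega>))"
  proof (rule dvd_partition)
    show "finite (\<Union> (orb ` \<Omega>))" using fin by (simp add: orb_eq)
    show "\<forall>c\<in>orb ` \<Omega>. p dvd card c" using card_orb by auto
    show "\<forall>c1\<in>orb ` \<Omega>. \<forall>c2\<in>orb ` \<Omega>. c1 \<noteq> c2 \<longrightarrow> c1 \<inter> c2 = {}" using orb_mem by blast
  qed
  also have "\<Union>(orb ` \<Omega>) = \<Omega>"
  proof
    show "\<Union>(orb ` \<Omega>) \<subseteq> \<Omega>" using \<Omega> by (auto simp: orb_def)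
    have "x \<in> orb x" for x unfolding orb_def by (metis funpow_0 rangeI)
    thus "\<Omega> \<subseteq> \<Union>(orb ` \<Omega>)" by blast
  qed
  finally show False using ndvd by contradiction
qed

definition centralizer_in :: "('a, 'b) monoid_scheme \<Rightarrow> 'a set \<Rightarrow> 'a \<Rightarrow> 'a set" where
  "centralizer_in G C y = {x \<in> C. x \<otimes>\<^bsub>G\<^esub> y = y \<otimes>\<^bsub>G\<^esub> x}"

context group
begin

lemma subgroup_centralizer_in:
  assumes C: "subgroup C G" and y: "y \<in> carrier G"
  shows "subgroup (centralizer_in G C y) G"
proof -
  have "C \<subseteq> carrier G" using C subgroup.subset by blast
  hence "centralizer_in G C y = {x \<in> C. conj_by G x ` {y} = {y}}"
    using y conj_by_eq_self_iff by (auto simp: centralizer_in_def)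
  thus ?thesis using subgroup_normalizing[OF C, of "{y}"] y by simp
qed

lemma centralizer_in_powers:
  assumes C: "C \<subseteq> carrier G" and y: "y \<in> carrier G" "z \<in> powers G y"
  shows "centralizer_in G C y \<subseteq> centralizer_in G C z"
proof
  fix x assume x: "x \<in> centralizer_in G C y"
  obtain i :: nat where i: "z = y [^] i" using y(2) by (auto simp: powers_def)
  have xc: "x \<in> carrier G" "conj_by G x y = y" using x C y conj_by_eq_self_iff[of x y] by (auto simp: centralizer_in_def)
  have "conj_by G x z = z" using i xc y by (simp add: conj_by_pow)
  thus "x \<in> centralizer_in G C z"
    using x xc y i conj_by_eq_self_iff[of x z] by (auto simp: centralizer_in_def)
qed

lemma conj_by_conj_by:
  "g \<in> carrier G \<Longrightarrow> x \<in> carrier G \<Longrightarrow> y \<in> carrier G \<Longrightarrow>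
    conj_by G (conj_by G g x) (conj_by G g y) = conj_by G g (conj_by G x y)"
  by (simp add: conj_by_def inv_mult_group m_assoc) (simp flip: m_assoc)

lemma card_centralizer_conj:
  assumes C: "subgroup C G" and g: "g \<in> C" and y: "y \<in> C"
  shows "card (centralizer_in G C (conj_by G g y)) = card (centralizer_in G C y)"
proof -
  have cc: "C \<subseteq> carrier G" using C subgroup.subset by blast
  have gy: "g \<in> carrier G" "y \<in> carrier G" using g y cc by auto
  have sub: "conj_by G h ` centralizer_in G C z \<subseteq> centralizer_in G C (conj_by G h z)"
    if h: "h \<in> C" and z: "z \<in> C" for h z
  proof
    fix w assume "w \<in> conj_by G h ` centralizer_in G C z"
    then obtain x where x: "x \<in> C" "x \<otimes> z = z \<otimes> x" "w = conj_by G h x" by (auto simp: centralizer_in_def)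
    have "x \<in> carrier G" "h \<in> carrier G" "z \<in> carrier G" using x h z cc by auto
    moreover have "w \<in> C" using subgroup_conj_by[OF C h x(1)] x by simp
    ultimately show "w \<in> centralizer_in G C (conj_by G h z)"
      using x conj_by_mult[of h x z] conj_by_mult[of h z x] by (simp add: centralizer_in_def)
  qed
  have ig: "inv g \<in> C" "conj_by G g y \<in> C" using C g y by (simp_all add: subgroup.m_inv_closed subgroup_conj_by)
  have "conj_by G (inv g) ` centralizer_in G C (conj_by G g y) \<subseteq> centralizer_in G C y"
    using sub[OF ig] gy by simp
  hence "conj_by G g ` conj_by G (inv g) ` centralizer_in G C (conj_by G g y) \<subseteq> conj_by G g ` centralizer_in G C y"
    by blast
  moreover have "centralizer_in G C z \<subseteq> carrier G" for z using cc by (auto simp: centralizer_in_def)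
  hence "conj_by G g ` conj_by G (inv g) ` centralizer_in G C (conj_by G g y) = centralizer_in G C (conj_by G g y)"
    using gy by (force simp: image_image)
  ultimately have "centralizer_in G C (conj_by G g y) = conj_by G g ` centralizer_in G C y"
    using sub[OF g y] by blast
  moreover have "inj_on (conj_by G g) (centralizer_in G C y)"
    by (rule inj_on_conj_by) (use gy cc in \<open>auto simp: centralizer_in_def\<close>)
  ultimately show ?thesis by (simp add: card_image)
qed

end

context finite_group
begin

text \<open>Right multiplication by \<open>x\<close> permutes the right cosets of
  \<open>Q = powers G y\<close>, whose number is prime to \<open>p\<close>. A fixed coset
  \<open>Q n = Q n x\<close> says that \<open>n x n^-1\<close> lies in \<open>Q\<close>.\<close>

lemma prime_order_conj_into_powers:
  assumes N: "subgroup N G" and p: "prime p" "\<not> p * p dvd card N"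
    and x: "x \<in> N" "x [^] p = \<one>" and y: "y \<in> N" "y \<noteq> \<one>" "y [^] p = \<one>"
  obtains n where "n \<in> N" "conj_by G n x \<in> powers G y"
proof -
  have NC: "N \<subseteq> carrier G" using N subgroup.subset by blast
  let ?Q = "powers G y"
  have Q: "subgroup ?Q G" "?Q \<subseteq> N" "card ?Q = p"
    using subgroup_powers powers_subset[OF N y(1)] y NC ord_eq_prime[of y p] p card_powers by auto
  define \<Omega> where "\<Omega> = (\<lambda>n. ?Q #> n) ` N"
  have "\<Omega> = rcosets\<^bsub>G\<lparr>carrier := N\<rparr>\<^esub> ?Q" by (auto simp: \<Omega>_def RCOSETS_def r_coset_def)
  moreover have "subgroup ?Q (G\<lparr>carrier := N\<rparr>)" using subgroup_incl[OF Q(1) N Q(2)] .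
  ultimately have "card \<Omega> * card ?Q = card N"
    using group.lagrange[OF subgroup_imp_group[OF N], of ?Q] by (simp add: order_def)
  hence ndvd: "\<not> p dvd card \<Omega>" using Q(3) p(2) by (metis dvd_refl mult_dvd_mono)
  have QC: "?Q \<subseteq> carrier G" using Q(2) NC by blast
  have step: "(?Q #> n) #> x = ?Q #> (n \<otimes> x)" if "n \<in> N" for n
    using coset_mult_assoc[OF QC, of n x] that x NC by auto
  have iter: "((\<lambda>S. S #> x) ^^ i) (?Q #> n) = ?Q #> (n \<otimes> x [^] i)" if n: "n \<in> N" for n i
  proof (induction i)
    case 0 thus ?case using n NC by auto
  next
    case (Suc i)
    have "n \<otimes> x [^] i \<in> N" using n N x subgroup_pow_closed by (simp add: subgroup.m_closed)
    thus ?case using Suc step n NC x by (simp add: m_assoc subsetD)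
  qed
  have "\<exists>S\<in>\<Omega>. S #> x = S"
  proof (rule prime_order_permutation_fixed_point[OF _ _ _ p(1) ndvd])
    show "finite \<Omega>" using finite_subgroup[OF N] by (simp add: \<Omega>_def)
    show "S #> x \<in> \<Omega>" if "S \<in> \<Omega>" for S
      using that step N x by (auto simp: \<Omega>_def subgroup.m_closed)
    show "((\<lambda>S. S #> x) ^^ p) S = S" if "S \<in> \<Omega>" for S
      using that iter x(2) NC by (auto simp: \<Omega>_def)
  qed
  then obtain n where n: "n \<in> N" "?Q #> n = ?Q #> (n \<otimes> x)" using step by (auto simp: \<Omega>_def)
  have nx: "n \<in> carrier G" "x \<in> carrier G" "n \<otimes> x \<in> carrier G" using n x NC by auto
  have "n \<otimes> x \<in> ?Q #> n" using rcos_self[OF nx(3) Q(1)] n(2) by simp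
  then obtain q where q: "q \<in> ?Q" "n \<otimes> x = q \<otimes> n" by (auto simp: r_coset_def)
  moreover have "q \<in> carrier G" using q QC by blast
  ultimately have "conj_by G n x = q" using nx by (simp add: conj_by_def inv_solve_right')
  thus ?thesis using that n q by blast
qed

text \<open>\<open>x\<close> and \<open>y\<close> may fail to be conjugate, but \<open>x\<close> is
  conjugate to a generator of \<open>powers G y\<close>, and all generators of a cyclic group have
  the same centralizer.\<close>

lemma card_centralizer_prime_order:
  assumes C: "subgroup C G" and p: "prime p" "\<not> p * p dvd card C"
    and x: "x \<in> torsion G C p - {\<one>}" and y: "y \<in> torsion G C p - {\<one>}"
  shows "card (centralizer_in G C x) = card (centralizer_in G C y)"
proof -
  have CC: "C \<subseteq> carrier G" using C subgroup.subset by blast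
  have xy: "x \<in> C" "x [^] p = \<one>" "x \<noteq> \<one>" "y \<in> C" "y [^] p = \<one>" "y \<noteq> \<one>" 
    using x y by (auto simp: torsion_def)
  have xyc: "x \<in> carrier G" "y \<in> carrier G" using xy CC by auto
  obtain n where n: "n \<in> C" "conj_by G n x \<in> powers G y"
    using prime_order_conj_into_powers[OF C p xy(1,2,4,6,5)] by blast
  let ?z = "conj_by G n x"
  have z1: "?z \<noteq> \<one>"
  proof
    assume "?z = \<one>"
    hence "conj_by G (inv n) ?z = \<one>" using n CC by auto
    thus False using xy(3) n CC xyc by auto
  qed
  have zC: "?z \<in> carrier G" using n CC xyc by auto
  have "powers G ?z = powers G y" using powers_of_prime_order[OF xyc(2) xy(5) p(1) n(2) z1] .
  hence "y \<in> powers G ?z" using self_in_powers xyc by blast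
  hence "centralizer_in G C ?z = centralizer_in G C y"
    using centralizer_in_powers[OF CC zC] centralizer_in_powers[OF CC xyc(2) n(2)] by blast
  thus ?thesis using card_centralizer_conj[OF C n(1) xy(1)] by simp
qed

text \<open>Orbit and stabilizer: the fibre over \<open>h y h^-1\<close> is the left coset by
  \<open>h\<close> of the centralizer.\<close>

lemma card_conj_class:
  assumes C: "subgroup C G" and y: "y \<in> C"
  shows "card ((\<lambda>g. conj_by G g y) ` C) * card (centralizer_in G C y) = card C"
proof -
  let ?f = "\<lambda>g. conj_by G g y"
  have CC: "C \<subseteq> carrier G" using C subgroup.subset by blast
  have yc: "y \<in> carrier G" using y CC by blast
  have fibre: "card {g \<in> C. ?f g = w} = card (centralizer_in G C y)" if w: "w \<in> ?f ` C" for w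
  proof -
    obtain h where h: "h \<in> C" "w = ?f h" using w by blast
    have hc: "h \<in> carrier G" using h CC by blast
    have "?f g = w \<longleftrightarrow> inv h \<otimes> g \<in> centralizer_in G C y" if g: "g \<in> C" for g
    proof -
      have gc: "g \<in> carrier G" using g CC by blast
      have "?f g = w \<longleftrightarrow> conj_by G (inv h) (?f g) = y"
      proof
        assume "?f g = w"
        thus "conj_by G (inv h) (?f g) = y" using hc yc h(2) by simp
      next
        assume "conj_by G (inv h) (?f g) = y"
        hence "conj_by G h (conj_by G (inv h) (?f g)) = w" using h(2) by simp
        thus "?f g = w" using hc gc yc by simp
      qed
      also have "\<dots> \<longleftrightarrow> conj_by G (inv h \<otimes> g) y = y" using hc gc yc by (simp add: conj_by_comp)
      also have "\<dots> \<longleftrightarrow> inv h \<otimes> g \<in> centralizer_in G C y"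
        using conj_by_eq_self_iff[of "inv h \<otimes> g" y] hc gc yc h(1) g C
        by (auto simp: centralizer_in_def subgroup.m_closed subgroup.m_inv_closed)
      finally show ?thesis .
    qed
    hence "bij_betw (\<lambda>g. inv h \<otimes> g) {g \<in> C. ?f g = w} (centralizer_in G C y)"
    proof (intro bij_betw_byWitness[where f' = "\<lambda>g. h \<otimes> g"], goal_cases)
      case 1 thus ?case using hc CC by (auto simp flip: m_assoc)
    next
      case 2 thus ?case using hc CC by (auto simp: centralizer_in_def simp flip: m_assoc)
    next
      case 3 thus ?case by auto
    next
      case 4
      have "inv h \<otimes> (h \<otimes> g) = g" if "g \<in> C" for g using that CC hc by (auto simp flip: m_assoc)
      moreover have "h \<otimes> g \<in> C" if "g \<in> C" for g using that h C by (simp add: subgroup.m_closed)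
      ultimately show ?case using 4 by (auto simp: centralizer_in_def)
    qed
    thus ?thesis by (rule bij_betw_same_card)
  qed
  have "card C = (\<Sum>w\<in>?f ` C. card {g \<in> C. ?f g = w})"
    using sum.image_gen[OF finite_subgroup[OF C], of "\<lambda>_. 1::nat" ?f] by simp
  thus ?thesis using fibre by simp
qed

end

section \<open>The tower of a group of square-free order\<close>

context finite_group
begin

text \<open>Distinct subgroups of order \<open>p\<close> meet only in the identity, so the elements
  of order \<open>p\<close> fall into disjoint blocks of size \<open>p - 1\<close>.\<close>

lemma prime_pred_dvd_card_torsion:
  assumes C: "subgroup C G" and p: "prime p"
  shows "p - 1 dvd card (torsion G C p - {\<one>})"
proof -
  let ?E = "torsion G C p - {\<one>}"
  let ?f = "\<lambda>y. powers G y - {\<one>}"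
  have CC: "C \<subseteq> carrier G" using C subgroup.subset by blast
  have E: "y \<in> carrier G" "y \<in> C" "y \<noteq> \<one>" "y [^] p = \<one>" if "y \<in> ?E" for y
    using that CC by (auto simp: torsion_def)
  have sub: "?f y \<subseteq> ?E" if y: "y \<in> ?E" for y
  proof
    fix z assume z: "z \<in> ?f y"
    then obtain i :: nat where i: "z = y [^] i" by (auto simp: powers_def)
    have "z [^] p = (y [^] p) [^] i" using E(1)[OF y] by (simp add: i nat_pow_pow mult.commute)
    hence "z [^] p = \<one>" using E(4)[OF y] by simp
    thus "z \<in> ?E" using z powers_subset[OF C E(2)[OF y]] by (auto simp: torsion_def)
  qed
  have "p - 1 dvd card (\<Union>(?f ` ?E))"
  proof (rule dvd_partition)
    show "finite (\<Union> (?f ` ?E))" using sub finite_subgroup[OF C]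
      by (meson UN_least finite_Diff finite_subset torsion_subset)
    have "card (?f y) = p - 1" if y: "y \<in> ?E" for y
      using card_powers[OF E(1)[OF y]] ord_eq_prime[OF E(1)[OF y] E(4)[OF y] E(3)[OF y] p] one_in_powers
      by (simp add: card_Diff_singleton)
    thus "\<forall>c\<in>?f ` ?E. p - 1 dvd card c" by auto
    have "powers G y = powers G y'" if y: "y \<in> ?E" "y' \<in> ?E" "z \<in> ?f y" "z \<in> ?f y'" for y y' z
      using powers_of_prime_order[OF E(1)[OF y(1)] E(4)[OF y(1)] p, of z]
        powers_of_prime_order[OF E(1)[OF y(2)] E(4)[OF y(2)] p, of z] y by blast
    thus "\<forall>c1\<in>?f ` ?E. \<forall>c2\<in>?f ` ?E. c1 \<noteq> c2 \<longrightarrow> c1 \<inter> c2 = {}" by blast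
  qed
  also have "\<Union>(?f ` ?E) = ?E" using sub self_in_powers E(1,3) by blast
  finally show ?thesis .
qed

text \<open>The elements of order \<open>p\<close> form a union of conjugacy classes, all of the
  same size because the centralizers have equal order.\<close>

lemma class_size_dvd_card_torsion:
  assumes C: "subgroup C G" and p: "prime p" "\<not> p * p dvd card C"
    and y: "y \<in> torsion G C p - {\<one>}"
  shows "card C div card (centralizer_in G C y) dvd card (torsion G C p - {\<one>})"
proof -
  let ?E = "torsion G C p - {\<one>}"
  let ?f = "\<lambda>y. (\<lambda>g. conj_by G g y) ` C"
  have CC: "C \<subseteq> carrier G" using C subgroup.subset by blast
  have E: "y \<in> carrier G" "y \<in> C" "y \<noteq> \<one>" "y [^] p = \<one>" if "y \<in> ?E" for y
    using that CC by (auto simp: torsion_def)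
  have sub: "conj_by G g x \<in> ?E" if x: "x \<in> ?E" and g: "g \<in> C" for x g
  proof -
    have gx: "g \<in> carrier G" "x \<in> carrier G" using g E[OF x] CC by auto
    have "conj_by G g x [^] p = \<one>" using gx E(4)[OF x] by (simp flip: conj_by_pow)
    moreover have "conj_by G g x \<noteq> \<one>"
    proof
      assume "conj_by G g x = \<one>"
      hence "conj_by G (inv g) (conj_by G g x) = \<one>" using gx by simp
      thus False using gx E(3)[OF x] by simp
    qed
    ultimately show ?thesis using subgroup_conj_by[OF C g E(2)[OF x]] by (simp add: torsion_def)
  qed
  have class_eq: "?f w \<subseteq> ?f x" if x: "x \<in> C" "w \<in> ?f x" for w x
  proof -
    obtain h where h: "h \<in> C" "w = conj_by G h x" using x by blast
    have "conj_by G g w = conj_by G (g \<otimes> h) x" if "g \<in> C" for g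
      using that h x CC by (simp add: conj_by_comp subsetD)
    thus ?thesis using h C by (auto simp: subgroup.m_closed)
  qed
  have class_sym: "x \<in> ?f w" if x: "x \<in> C" "w \<in> ?f x" for w x
  proof -
    obtain h where h: "h \<in> C" "w = conj_by G h x" using x by blast
    have "x = conj_by G (inv h) w" using h x CC by (simp add: subsetD)
    thus ?thesis using h C by (auto simp: subgroup.m_inv_closed)
  qed
  have "card C div card (centralizer_in G C y) dvd card (\<Union>(?f ` ?E))"
  proof (rule dvd_partition)
    show "finite (\<Union> (?f ` ?E))" using finite_subgroup[OF C]
      by (auto simp: torsion_def)
    have "card (?f x) = card C div card (centralizer_in G C y)" if x: "x \<in> ?E" for x
    proof -
      have "card (centralizer_in G C y) > 0"
        using subgroup_card_pos[OF subgroup_centralizer_in[OF C E(1)[OF y]]] .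
      moreover have "card (?f x) * card (centralizer_in G C y) = card C"
        using card_conj_class[OF C E(2)[OF x]] card_centralizer_prime_order[OF C p x y] by simp
      ultimately show ?thesis by (metis nonzero_mult_div_cancel_right less_not_refl)
    qed
    thus "\<forall>c\<in>?f ` ?E. card C div card (centralizer_in G C y) dvd card c" by auto
    have "?f x = ?f x'" if x: "x \<in> ?E" "x' \<in> ?E" "z \<in> ?f x" "z \<in> ?f x'" for x x' z
    proof -
      have "z \<in> C" using x(1,3) E(2) subgroup_conj_by[OF C] by blast
      have eq: "?f z = ?f w" if w: "w \<in> C" "z \<in> ?f w" for w
        using class_eq[OF w] class_eq[OF \<open>z \<in> C\<close> class_sym[OF w]] by (rule subset_antisym)
      show ?thesis using eq[OF E(2)[OF x(1)] x(3)] eq[OF E(2)[OF x(2)] x(4)] by (rule trans[OF sym])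
    qed
    thus "\<forall>c1\<in>?f ` ?E. \<forall>c2\<in>?f ` ?E. c1 \<noteq> c2 \<longrightarrow> c1 \<inter> c2 = {}" by blast
  qed
  also have "\<Union>(?f ` ?E) = ?E"
  proof
    show "\<Union>(?f ` ?E) \<subseteq> ?E" by (intro UN_least image_subsetI sub)
    have "x \<in> ?f x" if "x \<in> ?E" for x
      using E(1)[OF that] subgroup.one_closed[OF C] by (intro image_eqI[where x = \<one>]) auto
    thus "?E \<subseteq> \<Union>(?f ` ?E)" by (intro subsetI UN_I)
  qed
  finally show ?thesis .
qed

text \<open>A solution of \<open>x^(p d) = 1\<close> splits uniquely into commuting factors
  \<open>y\<close> and \<open>z\<close> with \<open>y^p = 1\<close> and \<open>z^d = 1\<close>; for
  given \<open>y\<close>, the factor \<open>z\<close> ranges over the \<open>d\<close>-torsion of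
  the centralizer of \<open>y\<close>.\<close>

lemma card_torsion_mult:
  assumes C: "subgroup C G" and pd: "coprime p d" "p > 0" "d > 0"
  shows "card (torsion G C (p * d)) =
    (\<Sum>y\<in>torsion G C p. card (torsion G (centralizer_in G C y) d))"
proof -
  have CC: "C \<subseteq> carrier G" using C subgroup.subset by blast
  \<comment> \<open>Chinese remainders: \<open>d * a\<close> is 1 modulo \<open>p\<close> and 0
    modulo \<open>d\<close>, and \<open>p * b\<close> the other way round. Raising to these
    exponents extracts the two factors.\<close>
  obtain a where a: "[d * a = 1] (mod p)" using pd cong_solve_coprime_nat[of d p] by (auto simp: coprime_commute)
  obtain b where b: "[p * b = 1] (mod d)" using pd cong_solve_coprime_nat[of p d] by auto
  have ab: "[d * a + p * b = 1] (mod p * d)"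
  proof (rule coprime_cong_mult_nat)
    show "[d * a + p * b = 1] (mod p)" using a by (simp add: cong_def)
    show "[d * a + p * b = 1] (mod d)" using b by (simp add: cong_def)
  qed (use pd in simp)
  let ?P = "SIGMA y:torsion G C p. torsion G (centralizer_in G C y) d"
  let ?f = "\<lambda>(y, z). y \<otimes> z"
  have P: "y \<in> C" "z \<in> C" "y \<in> carrier G" "z \<in> carrier G" "y [^] p = \<one>" "z [^] d = \<one>" "y \<otimes> z = z \<otimes> y"
    if "(y, z) \<in> ?P" for y z
    using that CC by (auto simp: torsion_def centralizer_in_def)
  have proj: "(y \<otimes> z) [^] (d * a) = y" if yz: "(y, z) \<in> ?P" for y z
  proof -
    note P = P[OF yz]
    have "(y \<otimes> z) [^] (d * a) = y [^] (d * a) \<otimes> z [^] (d * a)" using P pow_mult_distrib by blast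
    also have "z [^] (d * a) = \<one>" using P by (simp flip: nat_pow_pow)
    also have "y [^] (d * a) = y [^] (1::nat)"
      by (rule pow_cong[OF P(3,5)]) (use a in \<open>simp add: cong_def\<close>)
    finally show ?thesis using P by simp
  qed
  have "bij_betw ?f ?P (torsion G C (p * d))"
  proof (rule bij_betw_imageI)
    show "inj_on ?f ?P"
    proof (rule inj_onI)
      fix v w assume vw: "v \<in> ?P" "w \<in> ?P" "?f v = ?f w"
      obtain y z y' z' where v: "v = (y, z)" "w = (y', z')" by (cases v, cases w)
      have yz: "(y, z) \<in> ?P" "(y', z') \<in> ?P" "y \<otimes> z = y' \<otimes> z'" using vw v by simp_all
      have "y = y'" using proj[OF yz(1)] proj[OF yz(2)] yz(3) by simp
      thus "v = w" unfolding v using yz(3) P[OF yz(1)] P[OF yz(2)] by simp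
    qed
    show "?f ` ?P = torsion G C (p * d)"
    proof
      show "?f ` ?P \<subseteq> torsion G C (p * d)"
      proof (rule image_subsetI)
        fix w assume w: "w \<in> ?P"
        obtain y z where v: "w = (y, z)" by (cases w)
        have yz: "(y, z) \<in> ?P" using w v by simp
        note P = P[OF yz]
        have "(y \<otimes> z) [^] (p * d) = y [^] (p * d) \<otimes> z [^] (p * d)" using P pow_mult_distrib by blast
        also have "\<dots> = \<one>" using P pow_eq_one_dvd[of y p "p * d"] pow_eq_one_dvd[of z d "p * d"] by simp
        finally show "?f w \<in> torsion G C (p * d)" using P C v by (simp add: torsion_def subgroup.m_closed)
      qed
      show "torsion G C (p * d) \<subseteq> ?f ` ?P"
      proof
        fix x assume x: "x \<in> torsion G C (p * d)"
        have xc: "x \<in> C" "x \<in> carrier G" "x [^] (p * d) = \<one>" using x CC by (auto simp: torsion_def)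
        let ?y = "x [^] (d * a)" and ?z = "x [^] (p * b)"
        have "x [^] (d * a + p * b) = x [^] (1::nat)"
          by (rule pow_cong[OF xc(2,3)]) (use ab in \<open>simp add: cong_def\<close>)
        hence "x = ?f (?y, ?z)" using xc by (simp flip: nat_pow_mult)
        moreover have "?y [^] p = \<one>" "?z [^] d = \<one>"
          using xc by (auto simp: nat_pow_pow intro!: pow_eq_one_dvd[OF xc(2,3)])
        moreover have "?z \<otimes> ?y = ?y \<otimes> ?z" using xc by (simp add: nat_pow_mult add.commute)
        ultimately show "x \<in> ?f ` ?P" using subgroup_pow_closed[OF C xc(1)]
          by (intro image_eqI[where x = "(?y, ?z)"]) (auto simp: torsion_def centralizer_in_def)
      qed
    qed
  qed
  hence "card (torsion G C (p * d)) = card ?P" using bij_betw_same_card by metis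
  also have "\<dots> = (\<Sum>y\<in>torsion G C p. card (torsion G (centralizer_in G C y) d))"
  proof (rule card_SigmaI)
    have "finite C" using finite_subgroup[OF C] .
    thus "finite (torsion G C p)" "\<forall>y\<in>torsion G C p. finite (torsion G (centralizer_in G C y) d)"
      by (auto simp: torsion_def centralizer_in_def)
  qed
  finally show ?thesis .
qed

text \<open>Replaces an exponent by a divisor of the order of a centralizer, to which the induction
  hypothesis of the count applies.\<close>

lemma torsion_gcd_card:
  assumes C: "subgroup C G"
  shows "torsion G C (gcd d (card C)) = torsion G C d"
proof -
  have "x [^] gcd d (card C) = \<one> \<longleftrightarrow> x [^] d = \<one>" if x: "x \<in> C" for x
  proof -
    have "x \<in> carrier G" using x C subgroup.subset by blast
    thus ?thesis using subgroup_pow_card_eq_one[OF C x] pow_gcd_eq_one pow_eq_one_dvd gcd_dvd1 by metis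
  qed
  thus ?thesis by (auto simp: torsion_def)
qed

text \<open>Frobenius' counting argument: splitting the solutions of \<open>x\<^sup>p\<^sup>d = 1\<close> by their \<open>p\<close>-part
  shows that the number of solutions of \<open>x\<^sup>d = 1\<close> is \<open>d\<mu>\<close> with \<open>\<mu> \<equiv> 1\<close> modulo \<open>p - 1\<close>
  and \<open>0 < \<mu> < p\<close>.\<close>

theorem card_torsion_upper_divisor:
  assumes "subgroup C G" "squarefree (card C)" "upper_divisor (card C) d"
  shows "card (torsion G C d) = d"
  using assms
proof (induction "card C" arbitrary: C d rule: less_induct)
  case less
  note C = less.prems(1) and sf = less.prems(2)
  have CC: "C \<subseteq> carrier G" using C subgroup.subset by blast
  have n0: "card C > 0" using subgroup_card_pos[OF C] .
  show ?case using sf less.prems(3)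
  proof (induction d rule: upper_divisor_downward_induct)
    case self
    have "torsion G C (card C) = C" using subgroup_pow_card_eq_one[OF C] by (auto simp: torsion_def)
    thus ?case by simp
  next
    case (step p d)
    note p = step(1)
    let ?E = "torsion G C p - {\<one>}"
    have p1: "p > 1" using p prime_gt_1_nat by blast
    have d0: "d > 0" using step(3) n0 by (auto simp: upper_divisor_def intro!: gr0I)
    have cop: "coprime p d" using upper_divisor_coprime_prime[OF sf step(2) p] .
    have np: "\<not> p * p dvd card C" using squarefree_dvd_square[OF sf p] .
    have "p dvd card C" using step(2) by (metis dvd_mult_left upper_divisor_def)
    then obtain y where y: "y \<in> C" "y \<noteq> \<one>" "y [^] p = \<one>" using cauchy_subgroup[OF C p] by blast
    have yE: "y \<in> ?E" using y by (simp add: torsion_def)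
    have yc: "y \<in> carrier G" using y CC by auto
    let ?Z = "centralizer_in G C y"
    have Z: "subgroup ?Z G" using subgroup_centralizer_in[OF C yc] .
    have cent: "card (centralizer_in G C x) = card ?Z" if "x \<in> ?E" for x
      using card_centralizer_prime_order[OF C p np that yE] .
    have finC: "finite C" using finite_subgroup[OF C] .
    have finE: "finite ?E" using finC torsion_subset finite_subset by blast
    have oneE: "\<one> \<in> torsion G C p" using subgroup.one_closed[OF C] by (simp add: torsion_def)
    have c1: "centralizer_in G C \<one> = C" using CC by (auto simp: centralizer_in_def)
    have total: "p * d = card (torsion G C d) + (\<Sum>x\<in>?E. card (torsion G (centralizer_in G C x) d))"
    proof -
      have "p * d = (\<Sum>x\<in>torsion G C p. card (torsion G (centralizer_in G C x) d))"
        using step(4) card_torsion_mult[OF C cop] p1 d0 by simp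
      also have "\<dots> = card (torsion G C d) + (\<Sum>x\<in>?E. card (torsion G (centralizer_in G C x) d))"
        using sum.remove[OF _ oneE, of "\<lambda>x. card (torsion G (centralizer_in G C x) d)"] finE c1 by simp
      finally show ?thesis .
    qed
    show ?case
    proof (cases "card ?Z = card C")
      case True
      \<comment> \<open>The centralizers of elements of order \<open>p\<close> have equal order, so
        if one is all of \<open>C\<close>, all are. Conjugation then moves no such element, and
        Sylow conjugacy forces them all into \<open>powers G y\<close>.\<close>
      have central: "centralizer_in G C x = C" if "x \<in> ?E" for x
        using card_subset_eq[OF finC, of "centralizer_in G C x"] cent[OF that] True
        by (auto simp: centralizer_in_def)
      have "torsion G C p = powers G y"
      proof
        show "powers G y \<subseteq> torsion G C p"
        proof
          fix z assume z: "z \<in> powers G y"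
          then obtain i :: nat where i: "z = y [^] i" by (auto simp: powers_def)
          have "z [^] p = (y [^] p) [^] i" using yc by (simp add: i nat_pow_pow mult.commute)
          thus "z \<in> torsion G C p" using z powers_subset[OF C y(1)] y by (auto simp: torsion_def)
        qed
        show "torsion G C p \<subseteq> powers G y"
        proof
          fix x assume x: "x \<in> torsion G C p"
          show "x \<in> powers G y"
          proof (cases "x = \<one>")
            case True thus ?thesis using one_in_powers by simp
          next
            case False
            have xC: "x \<in> C" "x [^] p = \<one>" using x by (auto simp: torsion_def)
            obtain n where n: "n \<in> C" "conj_by G n x \<in> powers G y"
              using prime_order_conj_into_powers[OF C p np xC y] by blast
            have "n \<in> centralizer_in G C x" using central[of x] x False n by blast
            hence "conj_by G n x = x"
              using conj_by_eq_self_iff[of n x] n(1) xC(1) CC by (auto simp: centralizer_in_def)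
            thus ?thesis using n by simp
          qed
        qed
      qed
      hence "card (torsion G C p) = p" using card_powers[OF yc] ord_eq_prime[OF yc y(3,2) p] by simp
      hence "card ?E = p - 1" using oneE finE by simp
      hence "p * d = card (torsion G C d) + (p - 1) * card (torsion G C d)" using total central by simp
      also have "\<dots> = p * card (torsion G C d)" using p1 by (simp add: diff_mult_distrib)
      finally show ?thesis using p1 by simp
    next
      case False
      let ?k = "card ?Z" and ?n = "card C"
      have kn: "?k dvd ?n" using card_subgroup_dvd[OF C Z] by (auto simp: centralizer_in_def)
      hence kl: "?k < ?n" using False n0 by (metis dvd_imp_le le_neq_implies_less)
      let ?e = "gcd d ?k"
      have f: "card (torsion G (centralizer_in G C x) d) = ?e" if x: "x \<in> ?E" for x
      proof -
        let ?W = "centralizer_in G C x"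
        have W: "subgroup ?W G" using subgroup_centralizer_in[OF C] x CC by (auto simp: torsion_def)
        have cw: "card ?W = ?k" using cent[OF x] .
        have "card (torsion G ?W (gcd d ?k)) = gcd d ?k"
          using less.hyps[of ?W "gcd d ?k"] W cw kl kn squarefree_mono[OF kn sf] upper_divisor_gcd[OF sf step(3) kn]
          by simp
        thus ?thesis using torsion_gcd_card[OF W, of d] cw by simp
      qed
      have tot: "p * d = card (torsion G C d) + card ?E * ?e" using total f by simp
      \<comment> \<open>\<open>?n div ?k\<close> divides \<open>card ?E\<close>, while
        \<open>d\<close> divides both \<open>?n div ?k * d\<close> and \<open>?n\<close>, hence
        their gcd \<open>?n div ?k * ?e\<close>. So the wanted count is a multiple of
        \<open>d\<close>.\<close>
      have "d dvd card ?E * ?e"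
      proof -
        have "?n div ?k dvd card ?E" using class_size_dvd_card_torsion[OF C p np yE] .
        hence "?n div ?k * ?e dvd card ?E * ?e" by (simp add: mult_dvd_mono)
        moreover have "d dvd ?n div ?k * ?e"
        proof -
          have "d dvd ?n" using step(3) by (simp add: upper_divisor_def)
          hence "d dvd gcd (?n div ?k * d) (?n div ?k * ?k)" using kn by simp
          thus ?thesis by (simp add: gcd_mult_distrib_nat)
        qed
        ultimately show ?thesis using dvd_trans by blast
      qed
      hence "d dvd card (torsion G C d)" using tot by (metis dvd_add_left_iff dvd_triv_right)
      then obtain m where m: "card (torsion G C d) = d * m" unfolding dvd_def by blast
      have "\<one> \<in> torsion G C d" "finite (torsion G C d)"
        using subgroup.one_closed[OF C] finC by (auto simp: torsion_def)
      hence "card (torsion G C d) > 0" using card_gt_0_iff by blast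
      hence m0: "m > 0" using m by (auto intro!: gr0I)
      have Ee: "card ?E * ?e = d * (p - m)" using tot m by (simp add: diff_mult_distrib2 mult.commute)
      have "card ?E > 0" using yE finE card_gt_0_iff by blast
      hence "card ?E * ?e > 0" using d0 by simp
      hence mp: "p - m > 0" using Ee by (metis mult_0_right not_gr_zero)
      have "p - 1 dvd d * (p - m)"
        using prime_pred_dvd_card_torsion[OF C p] Ee by (metis dvd_mult2)
      \<comment> \<open>Here the order of the primes matters: a common prime \<open>q\<close> of
        \<open>p - 1\<close> and \<open>d\<close> would exceed \<open>p\<close>.\<close>
      moreover have "coprime (p - 1) d"
      proof (rule ccontr)
        assume "\<not> coprime (p - 1) d"
        then obtain q where q: "prime q" "q dvd p - 1" "q dvd d"
          using prime_factor_nat[of "gcd (p - 1) d"] by (auto simp: coprime_iff_gcd_eq_1)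
        have "p < q" using upper_divisor_prime_less[OF step(2,3) n0 p q(1,3)] .
        thus False using q(2) p1 dvd_imp_le[of q "p - 1"] by simp
      qed
      ultimately have "p - 1 dvd p - m" by (simp add: coprime_dvd_mult_right_iff)
      hence "p - 1 \<le> p - m" using mp dvd_imp_le by blast
      hence "m = 1" using m0 mp by linarith
      thus ?thesis using m by simp
    qed
  qed
qed

end

section \<open>Complements of prime order and conjugacy of the levels\<close>

context group
begin

lemma subgroup_set_mult:
  assumes K: "subgroup K G" and Q: "subgroup Q G" and norm: "\<And>q. q \<in> Q \<Longrightarrow> conj_by G q ` K = K"
  shows "subgroup (K <#> Q) G"
proof (rule subgroupI)
  have KC: "K \<subseteq> carrier G" and QC: "Q \<subseteq> carrier G" using K Q subgroup.subset by blast+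
  show "K <#> Q \<subseteq> carrier G" using KC QC by (auto simp: set_mult_def)
  show "K <#> Q \<noteq> {}" using subgroup.one_closed[OF K] subgroup.one_closed[OF Q] by (auto simp: set_mult_def)
  show "inv a \<in> K <#> Q" if a: "a \<in> K <#> Q" for a
  proof -
    obtain k q where kq: "k \<in> K" "q \<in> Q" "a = k \<otimes> q" using a by (auto simp: set_mult_def)
    have c: "k \<in> carrier G" "q \<in> carrier G" using kq KC QC by auto
    have iq: "inv q \<in> Q" using Q kq by (simp add: subgroup.m_inv_closed)
    have "conj_by G (inv q) (inv k) \<in> K" using norm[OF iq] K kq subgroup.m_inv_closed by fast
    moreover have "inv a = conj_by G (inv q) (inv k) \<otimes> inv q"
      using c kq(3) by (simp add: conj_by_def inv_mult_group m_assoc)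
    ultimately show ?thesis using iq by (auto simp: set_mult_def)
  qed
  show "a \<otimes> b \<in> K <#> Q" if ab: "a \<in> K <#> Q" "b \<in> K <#> Q" for a b
  proof -
    obtain k q where kq: "k \<in> K" "q \<in> Q" "a = k \<otimes> q" using ab(1) by (auto simp: set_mult_def)
    obtain l r where lr: "l \<in> K" "r \<in> Q" "b = l \<otimes> r" using ab(2) by (auto simp: set_mult_def)
    have c: "k \<in> carrier G" "q \<in> carrier G" "l \<in> carrier G" "r \<in> carrier G" using kq lr KC QC by auto
    have "a \<otimes> b = (k \<otimes> conj_by G q l) \<otimes> (q \<otimes> r)"
      using c kq(3) lr(3) by (simp add: conj_by_def m_assoc) (simp flip: m_assoc)
    moreover have "conj_by G q l \<in> K" using norm[OF kq(2)] lr(1) by blast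
    hence "k \<otimes> conj_by G q l \<in> K" using K kq by (simp add: subgroup.m_closed)
    moreover have "q \<otimes> r \<in> Q" using Q kq lr by (simp add: subgroup.m_closed)
    ultimately show ?thesis by (auto simp: set_mult_def)
  qed
qed

lemma card_set_mult_disjoint:
  assumes K: "subgroup K G" and Q: "subgroup Q G" and disj: "K \<inter> Q \<subseteq> {\<one>}"
  shows "card (K <#> Q) = card K * card Q"
proof -
  have KC: "K \<subseteq> carrier G" and QC: "Q \<subseteq> carrier G" using K Q subgroup.subset by blast+
  have "inj_on (\<lambda>(k, q). k \<otimes> q) (K \<times> Q)"
  proof (rule inj_onI)
    fix v w assume vw: "v \<in> K \<times> Q" "w \<in> K \<times> Q" "(\<lambda>(k, q). k \<otimes> q) v = (\<lambda>(k, q). k \<otimes> q) w"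
    obtain k q l r where v: "v = (k, q)" "w = (l, r)" by (cases v, cases w)
    have m: "k \<in> K" "l \<in> K" "q \<in> Q" "r \<in> Q" "k \<otimes> q = l \<otimes> r" using vw v by auto
    have c: "k \<in> carrier G" "q \<in> carrier G" "l \<in> carrier G" "r \<in> carrier G" using m KC QC by auto
    have "inv l \<otimes> k = inv l \<otimes> (k \<otimes> q) \<otimes> inv q" using c by (simp add: m_assoc)
    also have "\<dots> = r \<otimes> inv q" unfolding m(5) using c by (simp flip: m_assoc)
    finally have eq: "inv l \<otimes> k = r \<otimes> inv q" .
    have "inv l \<otimes> k \<in> K" using K m by (simp add: subgroup.m_closed subgroup.m_inv_closed)
    moreover have "r \<otimes> inv q \<in> Q" using Q m by (simp add: subgroup.m_closed subgroup.m_inv_closed)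
    ultimately have one: "inv l \<otimes> k = \<one>" "r \<otimes> inv q = \<one>" using eq disj by auto
    have "k = l" using one(1) c by (metis inv_closed inv_equality inv_inv)
    moreover have "r = q" using one(2) c by (metis inv_closed inv_equality inv_inv)
    ultimately show "v = w" by (simp add: v)
  qed
  moreover have "K <#> Q = (\<lambda>(k, q). k \<otimes> q) ` (K \<times> Q)" by (auto simp: set_mult_def)
  ultimately show ?thesis by (simp add: card_image card_cartesian_product)
qed

lemma conj_by_set_mult:
  assumes "K \<subseteq> carrier G" "Q \<subseteq> carrier G" "g \<in> carrier G"
  shows "conj_by G g ` (K <#> Q) = conj_by G g ` K <#> conj_by G g ` Q"
proof -
  have "conj_by G g (k \<otimes> q) = conj_by G g k \<otimes> conj_by G g q" if "k \<in> K" "q \<in> Q" for k q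
    using that assms by (simp add: conj_by_mult subsetD)
  thus ?thesis unfolding set_mult_def by force
qed

lemma conj_by_powers:
  assumes "y \<in> carrier G" "g \<in> carrier G"
  shows "conj_by G g ` powers G y = powers G (conj_by G g y)"
  using assms by (simp add: powers_def image_image conj_by_pow)

lemma subgroup_normalizes_torsion:
  assumes C: "subgroup C G" and g: "g \<in> C"
  shows "conj_by G g ` torsion G C d = torsion G C d"
  using conj_by_image_torsion[of g C d] subgroup_conj_by_image[OF C g] g subgroup.subset[OF C] by auto

end

context finite_group
begin

text \<open>The product of the lower level with a subgroup of order \<open>p\<close> is a subgroup
  of order \<open>p * d\<close>, so its elements solve \<open>x^(p d) = 1\<close>. By the count
  there are no other solutions.\<close>

lemma torsion_prime_step:
  assumes C: "subgroup C G" and sf: "squarefree (card C)"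
    and p: "prime p" and pd: "upper_divisor (card C) (p * d)" and d: "upper_divisor (card C) d"
    and K: "subgroup (torsion G C d) G" and y: "y \<in> C" "y \<noteq> \<one>" "y [^] p = \<one>"
  shows "torsion G C (p * d) = torsion G C d <#> powers G y"
    and "subgroup (torsion G C (p * d)) G"
proof -
  let ?K = "torsion G C d" and ?P = "powers G y"
  have CC: "C \<subseteq> carrier G" using C subgroup.subset by blast
  have yc: "y \<in> carrier G" using y CC by blast
  have P: "subgroup ?P G" "?P \<subseteq> C" "card ?P = p"
    using subgroup_powers[OF yc] powers_subset[OF C y(1)] card_powers[OF yc] ord_eq_prime[OF yc y(3,2) p] by auto
  have M: "subgroup (?K <#> ?P) G"
    by (rule subgroup_set_mult[OF K P(1)]) (use subgroup_normalizes_torsion[OF C] P(2) in blast)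
  have "?K \<inter> ?P \<subseteq> {\<one>}"
  proof
    fix z assume z: "z \<in> ?K \<inter> ?P"
    hence "z \<in> carrier G" "z [^] d = \<one>" using CC by (auto simp: torsion_def)
    moreover have "z [^] p = \<one>" using subgroup_pow_card_eq_one[OF P(1), of z] z P(3) by simp
    ultimately show "z \<in> {\<one>}"
      using pow_coprime_eq_one upper_divisor_coprime_prime[OF sf pd p] by blast
  qed
  hence card: "card (?K <#> ?P) = p * d"
    using card_set_mult_disjoint[OF K P(1)] P(3) card_torsion_upper_divisor[OF C sf d] by simp
  have "?K <#> ?P \<subseteq> C" using torsion_subset P(2) C by (fastforce simp: set_mult_def subgroup.m_closed)
  hence "?K <#> ?P \<subseteq> torsion G C (p * d)"
    using subgroup_pow_card_eq_one[OF M] card by (auto simp: torsion_def)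
  moreover have "finite (torsion G C (p * d))" using finite_subgroup[OF C] by (simp add: torsion_def)
  ultimately show eq: "torsion G C (p * d) = ?K <#> ?P"
    using card card_torsion_upper_divisor[OF C sf pd] card_subset_eq by metis
  show "subgroup (torsion G C (p * d)) G" using M by (simp add: eq)
qed

lemma subgroup_torsion_upper_divisor:
  assumes C: "subgroup C G" and sf: "squarefree (card C)" and d: "upper_divisor (card C) d"
  shows "subgroup (torsion G C d) G"
  using sf d
proof (induction d rule: upper_divisor_induct)
  case one
  have "torsion G C 1 = {\<one>}" using torsion_1 C subgroup.subset subgroup.one_closed by metis
  thus ?case using triv_subgroup by simp
next
  case (step p d)
  have "p dvd card C" using step(2) by (metis dvd_mult_left upper_divisor_def)
  then obtain y where "y \<in> C" "y \<noteq> \<one>" "y [^] p = \<one>" using cauchy_subgroup[OF C step(1)] by blast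
  thus ?case using torsion_prime_step(2)[OF C sf step] by blast
qed

text \<open>Hall's argument: once two copies of the subgroup of order \<open>d\<close> coincide, two copies of the
  next one lie in its normalizer, where Sylow's theorem applies to the new prime.\<close>

theorem torsion_conj_in_overgroup:
  assumes A: "subgroup A G" and C: "subgroup C G" "C \<subseteq> A" and sf: "squarefree (card C)"
    and b: "b \<in> carrier G" "conj_by G b ` C \<subseteq> A"
    and d: "upper_divisor (card C) d" and p: "\<And>p. prime p \<Longrightarrow> p dvd d \<Longrightarrow> \<not> p * p dvd card A"
  obtains a where "a \<in> A" "conj_by G (a \<otimes> b) ` torsion G C d = torsion G C d"
proof -
  have AC: "A \<subseteq> carrier G" and CC: "C \<subseteq> carrier G" using A C subgroup.subset by blast+
  have "(\<And>p. prime p \<Longrightarrow> p dvd d \<Longrightarrow> \<not> p * p dvd card A) \<Longrightarrow>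
      \<exists>a\<in>A. conj_by G (a \<otimes> b) ` torsion G C d = torsion G C d"
    using sf d
  proof (induction d rule: upper_divisor_induct)
    case one
    have "torsion G C 1 = {\<one>}" using torsion_1 C CC subgroup.one_closed by metis
    thus ?case using subgroup.one_closed[OF A] b(1) by auto
  next
    case (step p d)
    let ?K = "torsion G C d"
    have KC: "?K \<subseteq> carrier G" using CC by (auto simp: torsion_def)
    have "\<exists>a\<in>A. conj_by G (a \<otimes> b) ` ?K = ?K" using step(4,5) by (meson dvd_mult)
    then obtain a where a: "a \<in> A" "conj_by G (a \<otimes> b) ` ?K = ?K" by blast
    let ?g = "a \<otimes> b"
    have ac: "a \<in> carrier G" and gc: "?g \<in> carrier G" using a AC b by auto
    have np: "\<not> p * p dvd card A" using step(1,5) by simp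
    have "p dvd card C" using step(2) by (metis dvd_mult_left upper_divisor_def)
    then obtain y where y: "y \<in> C" "y \<noteq> \<one>" "y [^] p = \<one>" using cauchy_subgroup[OF C(1) step(1)] by blast
    have yc: "y \<in> carrier G" using y CC by auto
    have Kd: "subgroup ?K G" using subgroup_torsion_upper_divisor[OF C(1) sf step(3)] .
    have eq: "torsion G C (p * d) = ?K <#> powers G y" using torsion_prime_step(1)[OF C(1) sf step(1-3) Kd y] .
    \<comment> \<open>The normalizer of the lower level in \<open>A\<close> contains
      \<open>y\<close>, and also the conjugate of \<open>y\<close> by \<open>?g\<close>, since
      \<open>y\<close> and \<open>?g\<close> preserve \<open>?K\<close>. Correcting by an element of
      \<open>N\<close> therefore does not disturb the level already matched.\<close>
    define N where "N = {x \<in> A. conj_by G x ` ?K = ?K}"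
    have N: "subgroup N G" unfolding N_def by (rule subgroup_normalizing[OF A KC])
    have "card N dvd card A" using card_subgroup_dvd[OF A N] by (auto simp: N_def)
    hence npN: "\<not> p * p dvd card N" using np dvd_trans by blast
    have yN: "y \<in> N" using y C subgroup_normalizes_torsion by (auto simp: N_def)
    let ?y = "conj_by G ?g y"
    have "?y = conj_by G a (conj_by G b y)" using conj_by_comp[OF ac b(1) yc] .
    hence yA: "?y \<in> A" using subgroup_conj_by[OF A a(1)] b(2) y(1) by auto
    have "conj_by G ?y ` ?K = conj_by G ?y ` conj_by G ?g ` ?K" using a(2) by simp
    also have "\<dots> = conj_by G ?g ` conj_by G y ` ?K"
      using KC by (auto simp: image_image conj_by_conj_by[OF gc yc subsetD[OF KC]])
    also have "\<dots> = ?K" using subgroup_normalizes_torsion[OF C(1) y(1)] a(2) by simp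
    finally have yN': "?y \<in> N" using yA by (simp add: N_def)
    have yp: "?y [^] p = \<one>" using y(3) yc gc by (simp flip: conj_by_pow)
    obtain n where n: "n \<in> N" "conj_by G n ?y \<in> powers G y"
      using prime_order_conj_into_powers[OF N step(1) npN yN' yp yN y(2,3)] by blast
    have nc: "n \<in> carrier G" using n AC by (auto simp: N_def)
    have ngc: "n \<otimes> ?g \<in> carrier G" using nc gc by simp
    have ng: "conj_by G (n \<otimes> ?g) y \<in> powers G y" using n(2) conj_by_comp[OF nc gc yc] by simp
    have ng1: "conj_by G (n \<otimes> ?g) y \<noteq> \<one>"
    proof
      assume "conj_by G (n \<otimes> ?g) y = \<one>"
      hence "conj_by G (inv (n \<otimes> ?g)) (conj_by G (n \<otimes> ?g) y) = \<one>" using ngc by simp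
      thus False using conj_by_inv_cancel(1)[OF ngc yc] y(2) by simp
    qed
    have P: "conj_by G (n \<otimes> ?g) ` powers G y = powers G y"
      using conj_by_powers[OF yc ngc] powers_of_prime_order[OF yc y(3) step(1) ng ng1] by simp
    have "conj_by G (n \<otimes> ?g) ` ?K = conj_by G n ` conj_by G ?g ` ?K"
      using conj_by_image_comp[OF nc gc KC] .
    hence "conj_by G (n \<otimes> ?g) ` ?K = ?K" using a(2) n(1) by (simp add: N_def)
    hence "conj_by G (n \<otimes> ?g) ` torsion G C (p * d) = torsion G C (p * d)"
      unfolding eq using conj_by_set_mult[OF KC _ ngc, of "powers G y"] P yc by (auto simp: powers_def)
    moreover have "n \<otimes> ?g = (n \<otimes> a) \<otimes> b" using nc ac b by (simp add: m_assoc)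
    moreover have "n \<otimes> a \<in> A" using n(1) a(1) A by (simp add: N_def subgroup.m_closed)
    ultimately show ?case by auto
  qed
  thus ?thesis using that p by blast
qed

end

section \<open>Conjugation on the factors of the tower\<close>

text \<open>Stands in for equality in a quotient by \<open>K\<close>: the conjugating elements may
  lie outside the group whose tower is considered, so a relation on the ambient group is
  used.\<close>

definition cong_mod :: "('a, 'b) monoid_scheme \<Rightarrow> 'a set \<Rightarrow> 'a \<Rightarrow> 'a \<Rightarrow> bool" where
  "cong_mod G K x y \<longleftrightarrow> x \<otimes>\<^bsub>G\<^esub> inv\<^bsub>G\<^esub> y \<in> K"

context group
begin

lemma cong_mod_refl: "subgroup K G \<Longrightarrow> x \<in> carrier G \<Longrightarrow> cong_mod G K x x"
  by (simp add: cong_mod_def subgroup.one_closed)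

lemma cong_mod_sym:
  assumes K: "subgroup K G" and "x \<in> carrier G" "y \<in> carrier G" "cong_mod G K x y"
  shows "cong_mod G K y x"
proof -
  have "inv (x \<otimes> inv y) \<in> K" using assms by (simp add: cong_mod_def subgroup.m_inv_closed)
  thus ?thesis using assms by (simp add: cong_mod_def inv_mult_group)
qed

lemma cong_mod_trans:
  assumes K: "subgroup K G" and c: "x \<in> carrier G" "y \<in> carrier G" "z \<in> carrier G"
    and "cong_mod G K x y" "cong_mod G K y z"
  shows "cong_mod G K x z"
proof -
  have "(x \<otimes> inv y) \<otimes> (y \<otimes> inv z) \<in> K" using assms by (simp add: cong_mod_def subgroup.m_closed)
  moreover have "(x \<otimes> inv y) \<otimes> (y \<otimes> inv z) = x \<otimes> inv z"
    using c by (simp add: m_assoc) (simp flip: m_assoc)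
  ultimately show ?thesis by (simp add: cong_mod_def)
qed

text \<open>The quotient of the two products is \<open>x (y y'^-1) x^-1\<close> times
  \<open>x x'^-1\<close>, so it is the left factor that has to normalize \<open>K\<close>.\<close>

lemma cong_mod_mult:
  assumes K: "subgroup K G" and c: "x \<in> carrier G" "y \<in> carrier G" "x' \<in> carrier G" "y' \<in> carrier G"
    and norm: "conj_by G x ` K = K" and "cong_mod G K x x'" "cong_mod G K y y'"
  shows "cong_mod G K (x \<otimes> y) (x' \<otimes> y')"
proof -
  have "conj_by G x (y \<otimes> inv y') \<in> K" using assms by (auto simp: cong_mod_def)
  hence "conj_by G x (y \<otimes> inv y') \<otimes> (x \<otimes> inv x') \<in> K"
    using assms by (simp add: cong_mod_def subgroup.m_closed)
  moreover have "conj_by G x (y \<otimes> inv y') \<otimes> (x \<otimes> inv x') = (x \<otimes> y) \<otimes> inv (x' \<otimes> y')"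
    using c by (simp add: conj_by_def inv_mult_group m_assoc) (simp flip: m_assoc)
  ultimately show ?thesis by (simp add: cong_mod_def)
qed

lemma cong_mod_pow:
  assumes K: "subgroup K G" and c: "x \<in> carrier G" "y \<in> carrier G"
    and norm: "conj_by G x ` K = K" and xy: "cong_mod G K x y"
  shows "cong_mod G K (x [^] (n::nat)) (y [^] n)"
proof (induction n)
  case 0 show ?case using cong_mod_refl[OF K] by simp
next
  case (Suc n)
  have KC: "K \<subseteq> carrier G" using K subgroup.subset by blast
  have "x [^] n \<in> {g \<in> carrier G. conj_by G g ` K = K}"
    using subgroup_pow_closed[OF subgroup_normalizing[OF subgroup_self KC]] c(1) norm by blast
  thus ?case using cong_mod_mult[OF K _ c(1) _ c(2) _ Suc xy] c by simp
qed

lemma cong_mod_conj_by: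
  assumes c: "x \<in> carrier G" "y \<in> carrier G" "g \<in> carrier G"
    and norm: "conj_by G g ` K = K" and xy: "cong_mod G K x y"
  shows "cong_mod G K (conj_by G g x) (conj_by G g y)"
proof -
  have "conj_by G g (x \<otimes> inv y) \<in> K" using norm xy by (auto simp: cong_mod_def)
  thus ?thesis using c by (simp add: cong_mod_def conj_by_mult conj_by_inv)
qed

end

text \<open>For consecutive levels \<open>K\<close> and \<open>L\<close>, \<open>j\<close> is the
  multiplier of the automorphism that \<open>t\<close> induces on the cyclic factor
  \<open>L / K\<close>.\<close>

definition conj_power_mod :: "('a, 'b) monoid_scheme \<Rightarrow> 'a set \<Rightarrow> 'a set \<Rightarrow> 'a \<Rightarrow> nat \<Rightarrow> bool" where
  "conj_power_mod G K L t j \<longleftrightarrow> (\<forall>z\<in>L. cong_mod G K (conj_by G t z) (z [^]\<^bsub>G\<^esub> j))"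

text \<open>Taking \<open>j\<close>-th powers commutes with conjugation by \<open>h\<close>, so
  conjugates of \<open>t\<close> have the same multiplier. This is where commutativity of the
  automorphisms of a cyclic factor enters.\<close>

lemma (in group) conj_power_mod_conj_by:
  assumes KL: "K \<subseteq> carrier G" "L \<subseteq> carrier G" and t: "t \<in> carrier G" "conj_power_mod G K L t j"
    and h: "h \<in> carrier G" "conj_by G h ` K = K" "conj_by G h ` L = L"
  shows "conj_power_mod G K L (conj_by G h t) j"
  unfolding conj_power_mod_def
proof
  fix z assume "z \<in> L"
  then obtain w where w: "w \<in> L" "z = conj_by G h w" using h(3) by blast
  have wc: "w \<in> carrier G" using w KL by blast
  have "cong_mod G K (conj_by G h (conj_by G t w)) (conj_by G h (w [^] j))"
    using cong_mod_conj_by[OF _ _ h(1,2)] t wc w(1) by (simp add: conj_power_mod_def)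
  thus "cong_mod G K (conj_by G (conj_by G h t) z) (z [^] j)"
    using w(2) wc t(1) h(1) by (simp add: conj_by_conj_by conj_by_pow)
qed

context finite_group
begin

text \<open>Modulo the lower level everything is a power of an element \<open>y\<close> of order
  \<open>p\<close>, and an exponent that is right for \<open>y\<close> is right for its
  powers.\<close>

lemma conj_power_mod_exists:
  assumes C: "subgroup C G" and sf: "squarefree (card C)"
    and p: "prime p" and pd: "upper_divisor (card C) (p * d)" and d: "upper_divisor (card C) d"
    and t: "t \<in> carrier G" "conj_by G t ` torsion G C d = torsion G C d"
      "conj_by G t ` torsion G C (p * d) = torsion G C (p * d)"
  obtains j where "conj_power_mod G (torsion G C d) (torsion G C (p * d)) t j"
proof -
  let ?K = "torsion G C d" and ?L = "torsion G C (p * d)"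
  have CC: "C \<subseteq> carrier G" using C subgroup.subset by blast
  have "p dvd card C" using pd by (metis dvd_mult_left upper_divisor_def)
  then obtain y where y: "y \<in> C" "y \<noteq> \<one>" "y [^] p = \<one>" using cauchy_subgroup[OF C p] by blast
  have yc: "y \<in> carrier G" using y CC by auto
  have K: "subgroup ?K G" using subgroup_torsion_upper_divisor[OF C sf d] .
  have L: "subgroup ?L G" using subgroup_torsion_upper_divisor[OF C sf pd] .
  have eq: "?L = ?K <#> powers G y" using torsion_prime_step(1)[OF C sf p pd d K y] .
  have norm: "conj_by G x ` ?K = ?K" if "x \<in> C" for x using subgroup_normalizes_torsion[OF C that] .
  have rep: "\<exists>i. cong_mod G ?K z (y [^] (i::nat))" if "z \<in> ?L" for z
  proof -
    obtain k and i :: nat where k: "k \<in> ?K" "z = k \<otimes> y [^] i"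
      using \<open>z \<in> ?L\<close> unfolding eq by (auto simp: set_mult_def powers_def)
    have "k \<in> carrier G" using k CC by (auto simp: torsion_def)
    hence "z \<otimes> inv (y [^] i) = k" using k yc by (simp add: m_assoc)
    thus ?thesis using k(1) by (auto simp: cong_mod_def intro!: exI[of _ i])
  qed
  have LC: "z \<in> C" if "z \<in> ?L" for z using that by (simp add: torsion_def)
  have yL: "y \<in> ?L" using y CC pow_eq_one_dvd[OF yc y(3)] by (simp add: torsion_def)
  hence tyL: "conj_by G t y \<in> ?L" using t(3) by blast
  then obtain j where j: "cong_mod G ?K (conj_by G t y) (y [^] (j::nat))" using rep by blast
  have "cong_mod G ?K (conj_by G t z) (z [^] j)" if z: "z \<in> ?L" for z
  proof -
    obtain i :: nat where i: "cong_mod G ?K z (y [^] i)" using rep z by blast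
    have zc: "z \<in> carrier G" using z LC CC by blast
    have 1: "cong_mod G ?K (conj_by G t z) (conj_by G t y [^] i)"
      using cong_mod_conj_by[OF zc _ t(1,2) i] yc t(1) by (simp add: conj_by_pow)
    have 2: "cong_mod G ?K (conj_by G t y [^] i) ((y [^] j) [^] i)"
      by (rule cong_mod_pow[OF K _ _ norm j]) (use yc t tyL LC in auto)
    have "cong_mod G ?K (z [^] j) ((y [^] i) [^] j)"
      by (rule cong_mod_pow[OF K zc _ norm i]) (use yc z LC in auto)
    hence "cong_mod G ?K (z [^] j) ((y [^] j) [^] i)" using yc by (simp add: nat_pow_pow mult.commute)
    hence 3: "cong_mod G ?K ((y [^] j) [^] i) (z [^] j)" using cong_mod_sym[OF K] zc yc by simp
    have "cong_mod G ?K (conj_by G t z) ((y [^] j) [^] i)"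
      using cong_mod_trans[OF K _ _ _ 1 2] zc yc t(1) by simp
    thus ?thesis using cong_mod_trans[OF K _ _ _ _ 3] zc yc t(1) by simp
  qed
  thus ?thesis using that by (auto simp: conj_power_mod_def)
qed

text \<open>Climb the tower: if \<open>v\<close> centralizes \<open>K\<close> and conjugates
  \<open>z\<close> to \<open>k z\<close> with \<open>k\<close> in \<open>K\<close>, then
  \<open>v^i\<close> conjugates \<open>z\<close> to \<open>k^i z\<close>, and
  \<open>k^d = 1\<close>. Each level multiplies the exponent by a divisor of \<open>m\<close>, so it
  stays odd.\<close>

lemma odd_power_centralizes_torsion:
  assumes C: "subgroup C G" and sf: "squarefree (card C)" and m: "upper_divisor (card C) m" "odd m"
    and u: "u \<in> carrier G" "\<And>d. d dvd m \<Longrightarrow> conj_by G u ` torsion G C d = torsion G C d"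
    and triv: "\<And>p d. prime p \<Longrightarrow> upper_divisor (card C) (p * d) \<Longrightarrow> upper_divisor (card C) d \<Longrightarrow>
      p * d dvd m \<Longrightarrow> conj_power_mod G (torsion G C d) (torsion G C (p * d)) u 1"
  obtains M where "odd M" "\<And>z. z \<in> torsion G C m \<Longrightarrow> conj_by G (u [^] (M::nat)) z = z"
proof -
  have CC: "C \<subseteq> carrier G" using C subgroup.subset by blast
  have "d dvd m \<Longrightarrow> \<exists>M::nat. odd M \<and> (\<forall>z\<in>torsion G C d. conj_by G (u [^] M) z = z)"
    if d: "upper_divisor (card C) d" for d
    using sf d
  proof (induction d rule: upper_divisor_induct)
    case one
    have "torsion G C 1 = {\<one>}" using torsion_1[OF CC] C subgroup.one_closed by metis
    thus ?case using u(1) by (intro exI[of _ 1]) simp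
  next
    case (step p d)
    let ?K = "torsion G C d" and ?L = "torsion G C (p * d)"
    have dm: "d dvd m" using step(5) by (metis dvd_mult_right)
    obtain M :: nat where M: "odd M" "\<And>z. z \<in> ?K \<Longrightarrow> conj_by G (u [^] M) z = z" using step(4)[OF dm] by blast
    let ?v = "u [^] M"
    have vc: "?v \<in> carrier G" using u(1) by simp
    have K: "subgroup ?K G" using subgroup_torsion_upper_divisor[OF C sf step(3)] .
    have KC: "k \<in> carrier G" if "k \<in> ?K" for k using that CC by (auto simp: torsion_def)
    have LC: "z \<in> carrier G" if "z \<in> ?L" for z using that CC by (auto simp: torsion_def)
    have triv': "cong_mod G ?K (conj_by G u z) z" if "z \<in> ?L" for z
      using bspec[OF triv[OF step(1-3,5), unfolded conj_power_mod_def] that] LC[OF that] by simp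
    have pow: "cong_mod G ?K (conj_by G (u [^] (i::nat)) z) z" if z: "z \<in> ?L" for z i
    proof (induction i)
      case 0 thus ?case using cong_mod_refl[OF K] LC[OF z] by simp
    next
      case (Suc i)
      have "conj_by G (u [^] Suc i) z = conj_by G u (conj_by G (u [^] i) z)"
        unfolding nat_pow_Suc2[OF u(1)] using u(1) LC[OF z] by (intro conj_by_comp) auto
      moreover have "cong_mod G ?K (conj_by G u (conj_by G (u [^] i) z)) (conj_by G u z)"
        using cong_mod_conj_by[OF _ LC[OF z] u(1) u(2)[OF dm] Suc] u(1) LC[OF z] by simp
      ultimately show ?case using cong_mod_trans[OF K _ _ _ _ triv'[OF z]] u(1) LC[OF z] by simp
    qed
    have "conj_by G (u [^] (M * d)) z = z" if z: "z \<in> ?L" for z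
    proof -
      define k where "k = conj_by G ?v z \<otimes> inv z"
      have k: "k \<in> ?K" using pow[OF z, of M] by (simp add: cong_mod_def k_def)
      have c: "z \<in> carrier G" "k \<in> carrier G" using LC[OF z] KC[OF k] by auto
      have vz: "conj_by G ?v z = k \<otimes> z" using c vc by (simp add: k_def m_assoc)
      have "conj_by G (?v [^] (i::nat)) z = k [^] i \<otimes> z" for i
      proof (induction i)
        case 0 thus ?case using c by simp
      next
        case (Suc i)
        have "conj_by G (?v [^] Suc i) z = conj_by G ?v (conj_by G (?v [^] i) z)"
          unfolding nat_pow_Suc2[OF vc] using vc c by (intro conj_by_comp) auto
        also have "\<dots> = conj_by G ?v (k [^] i \<otimes> z)" by (simp only: Suc)
        also have "\<dots> = k [^] i \<otimes> (k \<otimes> z)"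
          using vc c M(2)[OF k] vz by (simp add: conj_by_mult conj_by_pow)
        finally show ?case using c by (simp add: m_assoc)
      qed
      hence "conj_by G (?v [^] d) z = k [^] d \<otimes> z" .
      moreover have "k [^] d = \<one>" using k by (simp add: torsion_def)
      ultimately show ?thesis using c u(1) by (simp add: nat_pow_pow)
    qed
    moreover have "odd (M * d)" using M(1) dm m(2) by (metis dvd_trans even_mult_iff)
    ultimately show ?case by blast
  qed
  from this[OF m(1) dvd_refl] show ?thesis using that by blast
qed

end

text \<open>The smallest prime 2 comes last in the tower, so the odd part is the level just below
  the top.\<close>

lemma upper_divisor_half:
  assumes "squarefree n" "even n"
  shows "upper_divisor n (n div 2)" "odd (n div 2)"
proof -
  have n0: "n > 0" using assms(1) by (auto intro: gr0I)
  have n: "n = 2 * (n div 2)" using assms(2) by simp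
  have "coprime 2 (n div 2)" using squarefree_mult_imp_coprime assms(1) n by metis
  thus o: "odd (n div 2)" by simp
  have q: "n div (n div 2) = 2" using n n0 by (metis gr0I mult_0_right nonzero_mult_div_cancel_right less_not_refl)
  show "upper_divisor n (n div 2)" unfolding upper_divisor_def q
  proof (intro conjI allI impI)
    show "n div 2 dvd n" using n by (metis dvd_triv_right)
    fix p r :: nat assume pr: "prime p" "prime r" "p dvd 2" "r dvd n div 2"
    have "p \<le> 2" using pr(3) by (simp add: dvd_imp_le)
    moreover have "r \<noteq> 2" using pr(4) o by auto
    hence "r > 2" using prime_ge_2_nat[OF pr(2)] by simp
    ultimately show "p < r" by simp
  qed
qed

context finite_group
begin

lemma subgroup_index_2_cases:
  assumes H: "subgroup H G" "2 * card H = order G" and t: "t \<in> carrier G" "t \<notin> H" and x: "x \<in> carrier G"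
  obtains "x \<in> H" | h where "h \<in> H" "x = h \<otimes> t"
proof -
  have HC: "H \<subseteq> carrier G" using H subgroup.subset by blast
  have fin: "finite H" using finite_subgroup H by blast
  have "h \<otimes> t \<notin> H" if h: "h \<in> H" for h
  proof
    assume "h \<otimes> t \<in> H"
    hence "inv h \<otimes> (h \<otimes> t) \<in> H" using H h by (simp add: subgroup.m_closed subgroup.m_inv_closed)
    thus False using t h HC by (simp add: subsetD flip: m_assoc)
  qed
  hence "H \<inter> (\<lambda>h. h \<otimes> t) ` H = {}" by blast
  moreover have "inj_on (\<lambda>h. h \<otimes> t) H" by (rule inj_onI) (use t HC in \<open>simp add: subsetD\<close>)
  ultimately have "card (H \<union> (\<lambda>h. h \<otimes> t) ` H) = order G"
    using fin H(2) by (simp add: card_Un_disjoint card_image)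
  moreover have "H \<union> (\<lambda>h. h \<otimes> t) ` H \<subseteq> carrier G" using HC t by auto
  ultimately have "H \<union> (\<lambda>h. h \<otimes> t) ` H = carrier G"
    using finite_carrier by (simp add: card_subset_eq order_def)
  thus ?thesis using that x by blast
qed

lemma involutions_conjugate:
  assumes N: "subgroup N G" "\<not> 4 dvd card N" and s: "s \<in> N" "s \<noteq> \<one>" "s \<otimes> s = \<one>"
    and t: "t \<in> N" "t \<noteq> \<one>" "t \<otimes> t = \<one>"
  obtains n where "n \<in> N" "conj_by G n s = t"
proof -
  have NC: "N \<subseteq> carrier G" using N subgroup.subset by blast
  have c: "s \<in> carrier G" "t \<in> carrier G" using s t NC by auto
  have sq: "s [^] (2::nat) = \<one>" "t [^] (2::nat) = \<one>" using s t c by (simp_all add: numeral_2_eq_2)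
  obtain n where n: "n \<in> N" "conj_by G n s \<in> powers G t"
    using prime_order_conj_into_powers[OF N(1) two_is_prime_nat _ s(1) sq(1) t(1,2) sq(2)] N(2) by auto
  have nc: "n \<in> carrier G" using n NC by auto
  obtain i :: nat where i: "conj_by G n s = t [^] i" using n(2) by (auto simp: powers_def)
  have ne: "conj_by G n s \<noteq> \<one>"
  proof
    assume "conj_by G n s = \<one>"
    hence "conj_by G (inv n) (conj_by G n s) = \<one>" using nc by simp
    thus False using nc c s by simp
  qed
  have "t [^] i = t [^] (i mod 2)" by (rule pow_cong[OF c(2) sq(2)]) simp
  moreover have "i mod 2 = 0 \<or> i mod 2 = 1" by auto
  ultimately have "conj_by G n s = t" using i ne c by auto
  thus ?thesis using that n by blast
qed

text \<open>Going up the tower, the first level that contains \<open>z\<close> exhibits a factor in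
  which \<open>z\<close> has a nontrivial image.\<close>

lemma torsion_level:
  assumes "squarefree (card C)" "upper_divisor (card C) m" "z \<in> carrier G" "z [^] m = \<one>" "z \<noteq> \<one>"
  shows "\<exists>p d. prime p \<and> upper_divisor (card C) (p * d) \<and> upper_divisor (card C) d \<and>
    p * d dvd m \<and> z [^] (p * d) = \<one> \<and> z [^] d \<noteq> \<one>"
  using assms(1,2,4)
proof (induction m rule: upper_divisor_induct)
  case one
  thus ?case using assms(3,5) by simp
next
  case (step p d)
  show ?case
  proof (cases "z [^] d = \<one>")
    case True
    thus ?thesis using step(4) by (meson dvd_mult)
  next
    case False
    thus ?thesis using step(1-3,5) by (intro exI[of _ p] exI[of _ d]) simp
  qed
qed

end

text \<open>After a step \<open>q\<close> the step \<open>inv q\<close> would lead back to the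
  previous vertex, so a walk that never turns back keeps its direction.\<close>

lemma (in group) monotone_walk:
  assumes y: "\<And>i::nat. y i \<in> carrier G" and r: "r \<in> carrier G"
    and step: "\<And>i. y (Suc i) \<in> {y i \<otimes> r, y i \<otimes> inv r}" and turn: "\<And>i. y (Suc (Suc i)) \<noteq> y i"
  shows "\<exists>q\<in>{r, inv r}. \<forall>i. y i = y 0 \<otimes> q [^] i"
proof -
  obtain q where q: "q \<in> {r, inv r}" "y (Suc 0) = y 0 \<otimes> q" using step[of 0] by blast
  have qc: "q \<in> carrier G" using q r by auto
  have step': "y (Suc i) \<in> {y i \<otimes> q, y i \<otimes> inv q}" for i using step[of i] q(1) r by auto
  have "y (Suc i) = y i \<otimes> q" for i
  proof (induction i)
    case 0 show ?case using q(2) .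
  next
    case (Suc i)
    have "y (Suc i) \<otimes> inv q = y i" using Suc qc y by (simp add: m_assoc)
    thus ?case using step'[of "Suc i"] turn[of i] by auto
  qed
  hence "y i = y 0 \<otimes> q [^] i" for i
    using y qc by (induction i) (simp_all add: m_assoc)
  thus ?thesis using q(1) by blast
qed

context finite_group
begin

text \<open>Conjugation acts on a factor of order \<open>p\<close> of the tower through an abelian group, so all
  involutions act by the same power. An involution inverting \<open>z\<close> and one centralizing \<open>w\<close>
  would force \<open>z\<^sup>2\<close> into the lower level.\<close>

lemma involution_inverts_and_centralizes:
  assumes sf: "squarefree (order G)" "even (order G)"
    and s: "s \<in> carrier G" "s \<noteq> \<one>" "s \<otimes> s = \<one>" and t: "t \<in> carrier G" "t \<noteq> \<one>" "t \<otimes> t = \<one>"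
    and z: "z \<in> carrier G" "z [^] (order G div 2) = \<one>" "conj_by G s z = inv z"
    and w: "w \<in> carrier G" "conj_by G t w = w"
    and zw: "\<And>k::nat. z [^] k = \<one> \<longleftrightarrow> w [^] k = \<one>"
  shows "z = \<one>"
proof (rule ccontr)
  assume z1: "z \<noteq> \<one>"
  let ?C = "carrier G"
  let ?m = "card ?C div 2"
  have C: "subgroup ?C G" by (rule subgroup_self)
  have sf': "squarefree (card ?C)" "even (card ?C)" using sf by (simp_all add: order_def)
  note m = upper_divisor_half[OF sf']
  have zm: "z [^] ?m = \<one>" using z(2) by (simp add: order_def)
  obtain p d where pd: "prime p" "upper_divisor (card ?C) (p * d)" "upper_divisor (card ?C) d"
      "p * d dvd ?m" "z [^] (p * d) = \<one>" "z [^] d \<noteq> \<one>"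
    using torsion_level[OF sf'(1) m(1) z(1) zm z1] by blast
  let ?K = "torsion G ?C d" and ?L = "torsion G ?C (p * d)"
  have norm: "conj_by G g ` torsion G ?C e = torsion G ?C e" if "g \<in> ?C" for g e
    using subgroup_normalizes_torsion[OF C that] .
  obtain j where j: "conj_power_mod G ?K ?L s j"
    using conj_power_mod_exists[OF C sf'(1) pd(1-3) s(1) norm norm] s(1) by blast
  have "\<not> 2 * 2 dvd card ?C" using squarefree_dvd_square[OF sf'(1) two_is_prime_nat] .
  hence "\<not> 4 dvd card ?C" by simp
  then obtain n where n: "n \<in> ?C" "conj_by G n s = t"
    using involutions_conjugate[OF C _ s t] by blast
  have sub: "?K \<subseteq> ?C" "?L \<subseteq> ?C" by (rule torsion_subset)+
  have jt: "conj_power_mod G ?K ?L t j"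
    using conj_power_mod_conj_by[OF sub s(1) j n(1) norm norm] n by simp
  have "z \<in> ?L" "w \<in> ?L" using pd(5) zw z w by (simp_all add: torsion_def)
  hence cz: "inv z \<otimes> inv (z [^] j) \<in> ?K" and cw: "w \<otimes> inv (w [^] j) \<in> ?K"
    using j jt z(3) w(2) by (auto simp: conj_power_mod_def cong_mod_def)
  have wd: "w [^] d \<in> carrier G" "(w [^] j) [^] d \<in> carrier G" "inv (w [^] j) \<in> carrier G" using w by auto
  have comm: "w \<otimes> inv (w [^] j) = inv (w [^] j) \<otimes> w"
  proof -
    have "w [^] j \<otimes> w = w \<otimes> w [^] j" using w nat_pow_comm[of w j 1] by simp
    hence "conj_by G (w [^] j) w = w" using w conj_by_eq_self_iff[of "w [^] j" w] by simp
    hence "conj_by G (inv (w [^] j)) w = w" using w conj_by_inv_cancel(1)[of "w [^] j" w] by simp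
    thus ?thesis using w conj_by_eq_self_iff[of "inv (w [^] j)" w] by simp
  qed
  have "(w \<otimes> inv (w [^] j)) [^] d = w [^] d \<otimes> inv (w [^] j) [^] d"
    using pow_mult_distrib[OF comm] w by simp
  also have "inv (w [^] j) [^] d = inv ((w [^] j) [^] d)" by (rule nat_pow_inv) (use w in simp)
  finally have "w [^] d \<otimes> inv ((w [^] j) [^] d) = \<one>" using cw by (simp add: torsion_def)
  hence "w [^] d = (w [^] j) [^] d" using wd by (metis inv_closed inv_equality inv_inv)
  hence wj: "w [^] d = w [^] (j * d)" using w by (simp add: nat_pow_pow)
  \<comment> \<open>\<open>zw\<close> transfers only equations of the form \<open>x^k = 1\<close>,
    so \<open>w^d = w^(j d)\<close> is first rewritten with \<open>j = Suc k\<close>. The value 0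
    would make \<open>w^d\<close>, and hence \<open>z^d\<close>, trivial.\<close>
  have "j \<noteq> 0" using wj pd(6) zw[of d] by (intro notI) simp
  then obtain k where k: "j = Suc k" by (cases j) auto
  have "w [^] (k * d) = \<one>" using wj w by (simp add: k flip: nat_pow_mult)
  hence "z [^] (k * d) = \<one>" using zw by blast
  hence zj: "z [^] (j * d) = z [^] d" using z by (simp add: k flip: nat_pow_mult)
  have "(inv z \<otimes> inv (z [^] j)) = inv (z [^] Suc j)" using z by (simp add: inv_mult_group)
  hence "inv (z [^] Suc j) [^] d = \<one>" using cz by (simp add: torsion_def del: nat_pow_Suc)
  hence "inv ((z [^] Suc j) [^] d) = \<one>" using nat_pow_inv[of "z [^] Suc j" d] z by (simp del: nat_pow_Suc)
  hence "(z [^] Suc j) [^] d = \<one>" using z inv_eq_1_iff by (simp del: nat_pow_Suc)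
  hence "z [^] (j * d) \<otimes> z [^] d = \<one>" 
    unfolding nat_pow_pow[OF z(1)] using z by (simp add: nat_pow_mult add.commute)
  hence "z [^] (2 * d) = \<one>" using z zj by (simp add: nat_pow_mult mult_2)
  \<comment> \<open>Inversion gave \<open>z^(j d) z^d = 1\<close> and centralizing gave
    \<open>z^(j d) = z^d\<close>, hence \<open>z^(2 d) = 1\<close>; the odd exponent
    \<open>?m\<close> removes the factor 2.\<close>
  hence "z [^] gcd (2 * d) ?m = \<one>" using pow_gcd_eq_one[OF z(1) _ zm] by blast
  moreover have "gcd (2 * d) ?m = d"
  proof -
    obtain c where c: "?m = d * c" using pd(4) by (metis dvd_mult_right dvd_def)
    have "coprime 2 c" using m(2) unfolding c by simp
    thus ?thesis unfolding c by (simp add: gcd_mult_distrib_nat[symmetric] mult.commute[of 2])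
  qed
  ultimately show False using pd(6) by simp
qed

end

section \<open>Colour-preserving permutations\<close>

lemma BijGroup_apply:
  "f \<in> Bij \<Omega> \<Longrightarrow> g \<in> Bij \<Omega> \<Longrightarrow> x \<in> \<Omega> \<Longrightarrow> (f \<otimes>\<^bsub>BijGroup \<Omega>\<^esub> g) x = f (g x)"
  by (simp add: BijGroup_def compose_def)

lemma BijGroup_one_apply: "x \<in> \<Omega> \<Longrightarrow> \<one>\<^bsub>BijGroup \<Omega>\<^esub> x = x"
  by (simp add: BijGroup_def)

lemma carrier_BijGroup: "carrier (BijGroup \<Omega>) = Bij \<Omega>"
  by (simp add: BijGroup_def)

lemma Bij_apply: "f \<in> Bij \<Omega> \<Longrightarrow> x \<in> \<Omega> \<Longrightarrow> f x \<in> \<Omega>"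
  using Bij_imp_funcset by fastforce

lemma Bij_inj: "f \<in> Bij \<Omega> \<Longrightarrow> x \<in> \<Omega> \<Longrightarrow> y \<in> \<Omega> \<Longrightarrow> f x = f y \<Longrightarrow> x = y"
  by (auto simp: Bij_def bij_betw_def dest: inj_onD)

lemma Bij_eqI:
  assumes "f \<in> Bij \<Omega>" "g \<in> Bij \<Omega>" "\<And>x. x \<in> \<Omega> \<Longrightarrow> f x = g x"
  shows "f = g"
  using assms by (intro extensionalityI[of f \<Omega> g]) (auto simp: Bij_imp_extensional)

lemma inv_Bij: "f \<in> Bij \<Omega> \<Longrightarrow> inv\<^bsub>BijGroup \<Omega>\<^esub> f \<in> Bij \<Omega>"
  using group.inv_closed[OF group_BijGroup] by (metis carrier_BijGroup)

lemma inv_BijGroup_apply: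
  assumes "f \<in> Bij \<Omega>" "x \<in> \<Omega>"
  shows "(inv\<^bsub>BijGroup \<Omega>\<^esub> f) (f x) = x" "f ((inv\<^bsub>BijGroup \<Omega>\<^esub> f) x) = x"
proof -
  interpret B: group "BijGroup \<Omega>" by (rule group_BijGroup)
  have f: "f \<in> carrier (BijGroup \<Omega>)" using assms by (simp add: carrier_BijGroup)
  show "(inv\<^bsub>BijGroup \<Omega>\<^esub> f) (f x) = x"
    using BijGroup_apply[OF inv_Bij[OF assms(1)] assms] B.l_inv[OF f] BijGroup_one_apply[OF assms(2)] by simp
  show "f ((inv\<^bsub>BijGroup \<Omega>\<^esub> f) x) = x"
    using BijGroup_apply[OF assms(1) inv_Bij[OF assms(1)] assms(2)] B.r_inv[OF f] BijGroup_one_apply[OF assms(2)] by simp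
qed

lemma finite_Bij: "finite \<Omega> \<Longrightarrow> finite (Bij \<Omega>)"
proof -
  assume "finite \<Omega>"
  hence "finite (\<Omega> \<rightarrow>\<^sub>E \<Omega>)" by (simp add: finite_PiE)
  moreover have "Bij \<Omega> \<subseteq> \<Omega> \<rightarrow>\<^sub>E \<Omega>"
    by (auto simp: PiE_def Bij_imp_extensional Bij_apply)
  ultimately show ?thesis by (rule finite_subset[rotated])
qed

lemma finite_group_BijGroup: "finite \<Omega> \<Longrightarrow> finite_group (BijGroup \<Omega>)"
  by (simp add: finite_group_def finite_group_axioms_def group_BijGroup carrier_BijGroup finite_Bij)

definition left_translation :: "('a, 'b) monoid_scheme \<Rightarrow> 'a \<Rightarrow> 'a \<Rightarrow> 'a" where
  "left_translation G g = (\<lambda>x\<in>carrier G. g \<otimes>\<^bsub>G\<^esub> x)"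

text \<open>With \<pi> the identity this is colour preservation, in general the condition on a
  chromatic isomorphism. Nothing ties \<open>\<pi> (inv s)\<close> to
  \<open>\<pi> s\<close>.\<close>

definition colour_map :: "('a, 'b) monoid_scheme \<Rightarrow> 'a set \<Rightarrow> ('a \<Rightarrow> 'a) \<Rightarrow> ('a \<Rightarrow> 'a) \<Rightarrow> bool" where
  "colour_map G S \<pi> \<phi> \<longleftrightarrow> (\<forall>g\<in>carrier G. \<forall>s\<in>S.
     \<phi> (g \<otimes>\<^bsub>G\<^esub> s) \<in> {\<phi> g \<otimes>\<^bsub>G\<^esub> \<pi> s, \<phi> g \<otimes>\<^bsub>G\<^esub> inv\<^bsub>G\<^esub> (\<pi> s)})"

lemma colour_mapD:
  "colour_map G S \<pi> \<phi> \<Longrightarrow> g \<in> carrier G \<Longrightarrow> s \<in> S \<Longrightarrow>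
    \<phi> (g \<otimes>\<^bsub>G\<^esub> s) \<in> {\<phi> g \<otimes>\<^bsub>G\<^esub> \<pi> s, \<phi> g \<otimes>\<^bsub>G\<^esub> inv\<^bsub>G\<^esub> (\<pi> s)}"
  by (simp add: colour_map_def)

text \<open>The group \<open>A\<close> of the overview, realized by permutations that are
  \<open>undefined\<close> off the carrier. Edges are preserved as well, because the inverse again
  satisfies the colour condition when \<open>S\<close> is symmetric.\<close>

definition colour_perms :: "('a, 'b) monoid_scheme \<Rightarrow> 'a set \<Rightarrow> ('a \<Rightarrow> 'a) set" where
  "colour_perms G S = {a \<in> Bij (carrier G). colour_map G S (\<lambda>s. s) a}"

context group
begin

lemma left_translation_apply: "x \<in> carrier G \<Longrightarrow> left_translation G g x = g \<otimes> x"
  by (simp add: left_translation_def)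

lemma left_translation_Bij:
  assumes "g \<in> carrier G" shows "left_translation G g \<in> Bij (carrier G)"
proof -
  have "bij_betw (left_translation G g) (carrier G) (carrier G)"
    by (rule bij_betw_byWitness[where f' = "left_translation G (inv g)"])
      (use assms in \<open>auto simp: left_translation_def simp flip: m_assoc\<close>)
  thus ?thesis by (simp add: Bij_def left_translation_def)
qed

lemma left_translation_mult:
  assumes "g \<in> carrier G" "h \<in> carrier G"
  shows "left_translation G (g \<otimes> h) = left_translation G g \<otimes>\<^bsub>BijGroup (carrier G)\<^esub> left_translation G h"
proof -
  interpret B: group "BijGroup (carrier G)" by (rule group_BijGroup)
  have closed: "left_translation G g \<otimes>\<^bsub>BijGroup (carrier G)\<^esub> left_translation G h \<in> Bij (carrier G)"
    using B.m_closed left_translation_Bij assms unfolding carrier_BijGroup by blast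
  show ?thesis
  proof (rule Bij_eqI[OF left_translation_Bij closed])
    show "left_translation G (g \<otimes> h) x = (left_translation G g \<otimes>\<^bsub>BijGroup (carrier G)\<^esub> left_translation G h) x"
      if "x \<in> carrier G" for x
      using that assms by (simp add: BijGroup_apply left_translation_Bij left_translation_apply m_assoc)
  qed (use assms in simp)
qed

lemma left_translation_hom: "group_hom G (BijGroup (carrier G)) (left_translation G)"
  by (intro group_hom.intro group_hom_axioms.intro homI)
    (simp_all add: is_group group_BijGroup carrier_BijGroup left_translation_Bij left_translation_mult)

lemma left_translation_inj: "inj_on (left_translation G) (carrier G)"
proof (rule inj_onI)
  fix g h assume "g \<in> carrier G" "h \<in> carrier G" "left_translation G g = left_translation G h"
  thus "g = h" by (metis left_translation_apply one_closed r_one)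
qed

lemma subgroup_left_translations: "subgroup (left_translation G ` carrier G) (BijGroup (carrier G))"
  using group_hom.img_is_subgroup[OF left_translation_hom] .

lemma left_translation_pow:
  assumes "g \<in> carrier G"
  shows "left_translation G (g [^] (n::nat)) = left_translation G g [^]\<^bsub>BijGroup (carrier G)\<^esub> n"
proof -
  interpret group_hom G "BijGroup (carrier G)" "left_translation G" by (rule left_translation_hom)
  show ?thesis using hom_nat_pow[OF assms] .
qed

lemma left_translation_one: "left_translation G \<one> = \<one>\<^bsub>BijGroup (carrier G)\<^esub>"
proof -
  interpret group_hom G "BijGroup (carrier G)" "left_translation G" by (rule left_translation_hom)
  show ?thesis by (rule hom_one)
qed

lemma torsion_left_translations:
  "torsion (BijGroup (carrier G)) (left_translation G ` carrier G) d = left_translation G ` torsion G (carrier G) d"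
proof -
  have "left_translation G g [^]\<^bsub>BijGroup (carrier G)\<^esub> d = \<one>\<^bsub>BijGroup (carrier G)\<^esub> \<longleftrightarrow> g [^] d = \<one>"
    if "g \<in> carrier G" for g
    using inj_onD[OF left_translation_inj, of "g [^] d" \<one>] that
    by (auto simp flip: left_translation_pow left_translation_one)
  thus ?thesis by (auto simp: torsion_def)
qed

text \<open>Both \<open>g s\<close> and \<open>g s^-1\<close> are sent into the target pair, so by
  injectivity they fill it, unless \<open>s\<close> is its own inverse; then the second condition on
  \<pi> collapses the target pair too.\<close>

lemma colour_map_image:
  assumes S: "symmetric_subset G S" and \<phi>: "\<phi> \<in> Bij (carrier G)" "colour_map G S \<pi> \<phi>"
    and \<pi>: "\<pi> s \<in> carrier G" "inv s = s \<Longrightarrow> inv (\<pi> s) = \<pi> s"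
    and g: "g \<in> carrier G" "s \<in> S" and y: "y \<in> {\<phi> g \<otimes> \<pi> s, \<phi> g \<otimes> inv (\<pi> s)}"
  shows "y \<in> {\<phi> (g \<otimes> s), \<phi> (g \<otimes> inv s)}"
proof -
  have s: "s \<in> carrier G" using S g by (auto simp: symmetric_subset_def)
  have c: "\<phi> g \<in> carrier G" "\<phi> (g \<otimes> inv s) \<in> carrier G" using Bij_apply[OF \<phi>(1)] g s by auto
  have 1: "\<phi> (g \<otimes> s) \<in> {\<phi> g \<otimes> \<pi> s, \<phi> g \<otimes> inv (\<pi> s)}" using \<phi>(2) g by (auto simp: colour_map_def)
  \<comment> \<open>Read at the vertex \<open>g \<otimes> inv s\<close> with the generator
    \<open>s\<close>, because the value of \<pi> at \<open>inv s\<close> is not linked to that at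
    \<open>s\<close>.\<close>
  have "\<phi> (g \<otimes> inv s \<otimes> s) \<in> {\<phi> (g \<otimes> inv s) \<otimes> \<pi> s, \<phi> (g \<otimes> inv s) \<otimes> inv (\<pi> s)}"
    using \<phi>(2) g s by (auto simp: colour_map_def)
  hence "\<phi> g \<in> {\<phi> (g \<otimes> inv s) \<otimes> \<pi> s, \<phi> (g \<otimes> inv s) \<otimes> inv (\<pi> s)}" using g s by (simp add: m_assoc)
  hence 2: "\<phi> (g \<otimes> inv s) \<in> {\<phi> g \<otimes> \<pi> s, \<phi> g \<otimes> inv (\<pi> s)}"
    using c \<pi>(1) by (auto simp: m_assoc)
  show ?thesis
  proof (cases "inv s = s")
    case True
    thus ?thesis using 1 \<pi>(2) y by auto
  next
    case False
    have "g \<otimes> s \<noteq> g \<otimes> inv s" using False g s by auto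
    hence "\<phi> (g \<otimes> s) \<noteq> \<phi> (g \<otimes> inv s)" using Bij_inj[OF \<phi>(1), of "g \<otimes> s" "g \<otimes> inv s"] g s by auto
    thus ?thesis using 1 2 y by auto
  qed
qed

text \<open>Used with \<pi> the identity, to close \<open>colour_perms\<close> under inverses, and
  with a chromatic isomorphism, to conjugate translations into \<open>colour_perms\<close>.\<close>

lemma colour_map_inv:
  assumes S: "symmetric_subset G S" and \<phi>: "\<phi> \<in> Bij (carrier G)" "colour_map G S \<pi> \<phi>"
    and \<pi>: "\<pi> s \<in> carrier G" "inv s = s \<Longrightarrow> inv (\<pi> s) = \<pi> s"
    and x: "x \<in> carrier G" "s \<in> S" and y: "y \<in> {x \<otimes> \<pi> s, x \<otimes> inv (\<pi> s)}"
  shows "(inv\<^bsub>BijGroup (carrier G)\<^esub> \<phi>) y \<in>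
    {(inv\<^bsub>BijGroup (carrier G)\<^esub> \<phi>) x \<otimes> s, (inv\<^bsub>BijGroup (carrier G)\<^esub> \<phi>) x \<otimes> inv s}"
proof -
  let ?i = "inv\<^bsub>BijGroup (carrier G)\<^esub> \<phi>"
  have s: "s \<in> carrier G" using S x by (auto simp: symmetric_subset_def)
  have g: "?i x \<in> carrier G" "\<phi> (?i x) = x"
    using Bij_apply[OF inv_Bij[OF \<phi>(1)] x(1)] inv_BijGroup_apply(2)[OF \<phi>(1) x(1)] by auto
  have "y \<in> {\<phi> (?i x \<otimes> s), \<phi> (?i x \<otimes> inv s)}"
    using colour_map_image[OF S \<phi> \<pi> g(1) x(2)] y g(2) by simp
  thus ?thesis using inv_BijGroup_apply(1)[OF \<phi>(1)] g(1) s by auto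
qed

lemma colour_perms_apply:
  assumes S: "symmetric_subset G S" and a: "a \<in> colour_perms G S" and x: "x \<in> carrier G" "s \<in> S"
    and y: "y \<in> {x \<otimes> s, x \<otimes> inv s}"
  shows "a y \<in> {a x \<otimes> s, a x \<otimes> inv s}"
proof -
  have s: "s \<in> carrier G" "inv s \<in> S" using S x by (auto simp: symmetric_subset_def)
  have "a (x \<otimes> s) \<in> {a x \<otimes> s, a x \<otimes> inv s}" "a (x \<otimes> inv s) \<in> {a x \<otimes> inv s, a x \<otimes> inv (inv s)}"
    using colour_mapD[of G S "\<lambda>s. s" a x s] colour_mapD[of G S "\<lambda>s. s" a x "inv s"] a x s
    by (simp_all add: colour_perms_def)
  thus ?thesis using y s by auto
qed

lemma subgroup_colour_perms:
  assumes S: "symmetric_subset G S"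
  shows "subgroup (colour_perms G S) (BijGroup (carrier G))"
proof -
  interpret B: group "BijGroup (carrier G)" by (rule group_BijGroup)
  have SC: "s \<in> carrier G" if "s \<in> S" for s using S that by (auto simp: symmetric_subset_def)
  have bij: "a \<in> Bij (carrier G)" if "a \<in> colour_perms G S" for a using that by (simp add: colour_perms_def)
  show ?thesis
  proof (rule B.subgroupI)
    show "colour_perms G S \<subseteq> carrier (BijGroup (carrier G))" using bij by (auto simp: carrier_BijGroup)
    have "\<one>\<^bsub>BijGroup (carrier G)\<^esub> \<in> colour_perms G S"
      using B.one_closed SC by (auto simp: colour_perms_def colour_map_def carrier_BijGroup BijGroup_one_apply)
    thus "colour_perms G S \<noteq> {}" by blast
    show "inv\<^bsub>BijGroup (carrier G)\<^esub> a \<in> colour_perms G S" if a: "a \<in> colour_perms G S" for a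
      using colour_map_inv[OF S bij[OF a], of "\<lambda>s. s"] a inv_Bij[OF bij[OF a]] SC
      by (fastforce simp: colour_perms_def colour_map_def)
    show "a \<otimes>\<^bsub>BijGroup (carrier G)\<^esub> b \<in> colour_perms G S"
      if a: "a \<in> colour_perms G S" and b: "b \<in> colour_perms G S" for a b
    proof -
      have "a \<otimes>\<^bsub>BijGroup (carrier G)\<^esub> b \<in> Bij (carrier G)"
        using B.m_closed[of a b] bij[OF a] bij[OF b] by (simp add: carrier_BijGroup)
      moreover have "a (b (g \<otimes> s)) \<in> {a (b g) \<otimes> s, a (b g) \<otimes> inv s}" if "g \<in> carrier G" "s \<in> S" for g s
        using colour_perms_apply[OF S a Bij_apply[OF bij[OF b] that(1)] that(2)] b that
        by (auto simp: colour_perms_def colour_map_def)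
      ultimately show ?thesis
        using SC by (auto simp: colour_perms_def colour_map_def BijGroup_apply bij[OF a] bij[OF b])
    qed
  qed
qed

lemma left_translation_colour_perms:
  assumes "symmetric_subset G S" "g \<in> carrier G"
  shows "left_translation G g \<in> colour_perms G S"
proof -
  have "left_translation G g (x \<otimes> s) = left_translation G g x \<otimes> s" if "x \<in> carrier G" "s \<in> S" for x s
  proof -
    have "s \<in> carrier G" using assms that by (auto simp: symmetric_subset_def)
    thus ?thesis using that assms(2) by (simp add: left_translation_apply m_assoc)
  qed
  thus ?thesis using left_translation_Bij[OF assms(2)] by (simp add: colour_perms_def colour_map_def)
qed

text \<open>\<open>a\<close> maps the path \<open>g, g s, g s^2, ...\<close> to a path of steps
  \<open>s\<close> or \<open>inv s\<close> with constant direction, so \<open>a (g s^m)\<close> is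
  \<open>a g\<close> times \<open>s^m\<close> or \<open>s^-m\<close>. These agree because
  \<open>s^m\<close> is its own inverse.\<close>

lemma colour_perms_commute_right_mult:
  assumes S: "symmetric_subset G S" and a: "a \<in> colour_perms G S" and s: "s \<in> S"
    and invol: "s [^] m \<otimes> s [^] m = \<one>" and g: "g \<in> carrier G"
  shows "a (g \<otimes> s [^] (m::nat)) = a g \<otimes> s [^] m"
proof -
  have sc: "s \<in> carrier G" using S s by (auto simp: symmetric_subset_def)
  have ab: "a \<in> Bij (carrier G)" using a by (simp add: colour_perms_def)
  let ?y = "\<lambda>i::nat. a (g \<otimes> s [^] i)"
  have yc: "?y i \<in> carrier G" for i using Bij_apply[OF ab] g sc by simp
  have step: "?y (Suc i) \<in> {?y i \<otimes> s, ?y i \<otimes> inv s}" for i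
    using a g sc colour_mapD[of G S "\<lambda>s. s" a "g \<otimes> s [^] i", OF _ _ s]
    by (simp add: colour_perms_def m_assoc)
  have y0: "?y 0 = a g" using g by simp
  have "\<exists>q\<in>{s, inv s}. \<forall>i. ?y i = ?y 0 \<otimes> q [^] i"
  \<comment> \<open>If \<open>s\<close> squares to the identity, the path turns back at every step,
    but then \<open>s\<close> and \<open>inv s\<close> coincide and there is no choice of
    direction.\<close>
  proof (cases "s \<otimes> s = \<one>")
    case True
    hence i: "inv s = s" using sc inv_equality by blast
    have "?y i = ?y 0 \<otimes> s [^] i" for i
    proof (induction i)
      case 0 thus ?case using yc[of 0] by simp
    next
      case (Suc k)
      have "?y (Suc k) = ?y k \<otimes> s" using step[of k] i by simp
      thus ?case using Suc sc yc[of 0] by (simp add: m_assoc)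
    qed
    thus ?thesis by blast
  next
    case False
    have "?y (Suc (Suc i)) \<noteq> ?y i" for i
    proof
      assume "?y (Suc (Suc i)) = ?y i"
      hence "g \<otimes> s [^] Suc (Suc i) = g \<otimes> s [^] i" using Bij_inj[OF ab] g sc by auto
      hence "s [^] i \<otimes> (s \<otimes> s) = s [^] i" using g sc by (simp add: m_assoc)
      thus False using False sc by (metis l_cancel_one m_closed nat_pow_closed)
    qed
    thus ?thesis using monotone_walk[of ?y s] yc sc step by blast
  qed
  then obtain q where q: "q \<in> {s, inv s}" "?y m = ?y 0 \<otimes> q [^] m" by blast
  have "inv (s [^] m) = s [^] m" using invol sc inv_equality by simp
  hence "q [^] m = s [^] m" using q(1) nat_pow_inv[OF sc] by auto
  thus ?thesis using q(2) y0 by simp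
qed

lemma Cay_connected_induct:
  assumes S: "symmetric_subset G S" and conn: "graph_connected (Cay G S)"
    and v: "v \<in> carrier G" "P v" and step: "\<And>g s. g \<in> carrier G \<Longrightarrow> s \<in> S \<Longrightarrow> P g \<Longrightarrow> P (g \<otimes> s)"
    and x: "x \<in> carrier G"
  shows "P x"
proof -
  have "(v, x) \<in> {(x, y). {x, y} \<in> snd (Cay G S)}\<^sup>*"
    using conn v(1) x by (auto simp: graph_connected_def Cay_def)
  thus ?thesis
  proof (induction rule: rtrancl_induct)
    case base thus ?case by (rule v(2))
  next
    case (step y z)
    then obtain g s where gs: "{y, z} = {g, g \<otimes> s}" "g \<in> carrier G" "s \<in> S" by (auto simp: Cay_def)
    have s: "s \<in> carrier G" "inv s \<in> S" using S gs by (auto simp: symmetric_subset_def)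
    \<comment> \<open>An edge may be traversed against its labelling; symmetry of \<open>S\<close>
      turns that into a step by \<open>inv s\<close>.\<close>
    consider "y = g" "z = g \<otimes> s" | "y = g \<otimes> s" "z = y \<otimes> inv s"
      using gs s by (auto simp: doubleton_eq_iff m_assoc)
    thus ?case
    proof cases
      case 1 thus ?thesis using assms(5) gs step.IH by simp
    next
      case 2 thus ?thesis using assms(5)[of y "inv s"] gs s step.IH by simp
    qed
  qed
qed

text \<open>A permutation preserving colours and fixing \<open>v\<close> swaps \<open>v s\<close> and \<open>v s\<inverse>\<close> at most, so its
  square fixes the neighbours of \<open>v\<close>; for odd order the square generates the same group.\<close>

lemma colour_perm_odd_order_fixing:
  assumes S: "symmetric_subset G S" and conn: "graph_connected (Cay G S)"
    and a: "a \<in> colour_perms G S" "a [^]\<^bsub>BijGroup (carrier G)\<^esub> M = \<one>\<^bsub>BijGroup (carrier G)\<^esub>" "odd (M::nat)"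
    and v: "v \<in> carrier G" "a v = v"
  shows "a = \<one>\<^bsub>BijGroup (carrier G)\<^esub>"
proof -
  interpret B: group "BijGroup (carrier G)" by (rule group_BijGroup)
  have ab: "a \<in> Bij (carrier G)" using a by (simp add: colour_perms_def)
  have pow: "(a [^]\<^bsub>BijGroup (carrier G)\<^esub> k) x = (a ^^ k) x \<and> (a ^^ k) x \<in> carrier G" if x: "x \<in> carrier G" for k x
  proof (induction k)
    case 0 thus ?case using x by (simp add: BijGroup_one_apply)
  next
    case (Suc k)
    have "a [^]\<^bsub>BijGroup (carrier G)\<^esub> Suc k = a \<otimes>\<^bsub>BijGroup (carrier G)\<^esub> a [^]\<^bsub>BijGroup (carrier G)\<^esub> k"
      using B.nat_pow_Suc2[of a k] ab by (simp add: carrier_BijGroup)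
    moreover have "a [^]\<^bsub>BijGroup (carrier G)\<^esub> k \<in> Bij (carrier G)"
      using B.nat_pow_closed[of a k] ab by (simp add: carrier_BijGroup)
    ultimately show ?case using Suc Bij_apply[OF ab] by (simp add: BijGroup_apply[OF ab _ x] del: B.nat_pow_Suc)
  qed
  obtain k where M: "M = 2 * k + 1" using a(3) by (elim oddE)
  have nbr: "a (g \<otimes> s) = g \<otimes> s" if g: "g \<in> carrier G" "a g = g" and s: "s \<in> S" for g s
  proof -
    let ?x = "g \<otimes> s"
    have sc: "s \<in> carrier G" using S s by (auto simp: symmetric_subset_def)
    have xc: "?x \<in> carrier G" using g sc by simp
    have m: "a y \<in> {g \<otimes> s, g \<otimes> inv s}" if "y \<in> {g \<otimes> s, g \<otimes> inv s}" for y
      using colour_perms_apply[OF S a(1) g(1) s that] g(2) by simp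
    have sq: "a (a ?x) = ?x"
    proof (cases "a ?x = ?x")
      case True thus ?thesis by simp
    next
      case False
      hence 1: "a ?x = g \<otimes> inv s" "g \<otimes> inv s \<noteq> ?x" using m[of ?x] by auto
      have "a (a ?x) \<noteq> a ?x" using Bij_inj[OF ab _ xc] Bij_apply[OF ab xc] False by blast
      thus ?thesis using m[of "a ?x"] 1 by auto
    qed
    have "(a ^^ (2 * i)) ?x = ?x" for i by (induction i) (simp_all add: sq)
    moreover have "(a ^^ M) ?x = ?x" using pow[OF xc, of M] a(2) xc by (simp add: BijGroup_one_apply)
    hence "a ((a ^^ (2 * k)) ?x) = ?x" by (simp add: M)
    ultimately show ?thesis by simp
  qed
  have "a x = x" if "x \<in> carrier G" for x
    using S conn v _ that by (rule Cay_connected_induct[where P = "\<lambda>x. a x = x"]) (rule nbr)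
  thus ?thesis using ab B.one_closed
    by (intro Bij_eqI[of _ "carrier G"]) (simp_all add: BijGroup_one_apply carrier_BijGroup)
qed

end

context finite_group
begin

text \<open>The bijection \<open>\<pi>\<close> could glue two involutions \<open>s\<close> and \<open>s'\<close> to one colour \<open>{\<sigma>, \<sigma>\<inverse>}\<close>, as for the
  4-cycle over the Klein group and over the cyclic group. In square-free order this is impossible:
  \<open>s\<close> inverts \<open>s s'\<close>, whereas the involution in the group generated by \<open>\<sigma>\<close> centralizes \<open>\<sigma>\<^sup>2\<close>, and
  \<open>s s'\<close> and \<open>\<sigma>\<^sup>2\<close> have the same order.\<close>

lemma colour_map_involution:
  assumes sf: "squarefree (order G)" and S: "symmetric_subset G S" and T: "symmetric_subset G T"
    and \<phi>: "\<phi> \<in> Bij (carrier G)" "colour_map G S \<pi> \<phi>" and \<pi>: "bij_betw \<pi> S T"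
    and s: "s \<in> S" "inv s = s"
  shows "inv (\<pi> s) = \<pi> s"
proof (rule ccontr)
  assume ne: "inv (\<pi> s) \<noteq> \<pi> s"
  let ?\<sigma> = "\<pi> s"
  have SC: "x \<in> carrier G" if "x \<in> S" for x using S that by (auto simp: symmetric_subset_def)
  have \<sigma>: "?\<sigma> \<in> T" "inv ?\<sigma> \<in> T" "?\<sigma> \<in> carrier G"
    using \<pi> s(1) T by (auto simp: bij_betw_def symmetric_subset_def)
  \<comment> \<open>Every target vertex has two distinct neighbours of this colour, and
    \<open>s\<close> alone accounts for one; surjectivity of \<pi> supplies a second generator of
    the same colour.\<close>
  obtain s' where s': "s' \<in> S" "\<pi> s' = inv ?\<sigma>" using \<pi> \<sigma>(2) by (auto simp: bij_betw_def)
  have c: "s \<in> carrier G" "s' \<in> carrier G" using SC s s' by auto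
  have ss': "s \<noteq> s'" using s' ne by auto
  note inj = Bij_inj[OF \<phi>(1)]
  have stepS: "\<phi> (g \<otimes> s) \<in> {\<phi> g \<otimes> ?\<sigma>, \<phi> g \<otimes> inv ?\<sigma>}" if "g \<in> carrier G" for g
    using colour_mapD[OF \<phi>(2) that s(1)] .
  have stepS': "\<phi> (g \<otimes> s') \<in> {\<phi> g \<otimes> ?\<sigma>, \<phi> g \<otimes> inv ?\<sigma>}" if "g \<in> carrier G" for g
    using colour_mapD[OF \<phi>(2) that s'(1)] s'(2) \<sigma>(3) by auto
  \<comment> \<open>Otherwise the edges of \<open>s'\<close> and \<open>inv s'\<close> would exhaust
    the two neighbours of this colour, leaving none for \<open>s\<close>.\<close>
  have is': "inv s' = s'"
  proof (rule ccontr)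
    assume ne': "inv s' \<noteq> s'"
    have "\<phi> (\<one> \<otimes> s) \<in> {\<phi> \<one> \<otimes> \<pi> s', \<phi> \<one> \<otimes> inv (\<pi> s')}" using stepS[of \<one>] s'(2) \<sigma>(3) by auto
    hence "\<phi> (\<one> \<otimes> s) \<in> {\<phi> (\<one> \<otimes> s'), \<phi> (\<one> \<otimes> inv s')}"
      using colour_map_image[OF S \<phi> _ _ one_closed s'(1)] ne' s'(2) \<sigma>(3) by simp
    hence "s = s' \<or> s = inv s'" using inj[of s s'] inj[of s "inv s'"] c by auto
    hence "s = inv s'" using ss' by simp
    thus False using s(2) c ss' by simp
  qed
  have sq: "s \<otimes> s = \<one>" "s' \<otimes> s' = \<one>" using s(2) is' c r_inv by metis+
  have one: "x \<noteq> \<one>" if "x \<in> {s, s'}" for x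
  proof
    assume "x = \<one>"
    hence "\<phi> \<one> \<in> {\<phi> \<one> \<otimes> ?\<sigma>, \<phi> \<one> \<otimes> inv ?\<sigma>}" using stepS[of \<one>] stepS'[of \<one>] that by auto
    moreover have "\<phi> \<one> \<in> carrier G" using Bij_apply[OF \<phi>(1)] by simp
    ultimately have "?\<sigma> = \<one> \<or> inv ?\<sigma> = \<one>" using \<sigma>(3) by auto
    hence "?\<sigma> = \<one>" using \<sigma>(3) inv_eq_1_iff by blast
    thus False using ne by simp
  qed
  define z where "z = s \<otimes> s'"
  have zc: "z \<in> carrier G" using c by (simp add: z_def)
  \<comment> \<open>The path \<open>1, s, s s', s s' s, ...\<close> in the dihedral group of
    \<open>s\<close> and \<open>s'\<close>; at even times it stands at a power of \<open>z\<close>.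
    Its image has steps of one colour and never turns back, so it runs through
    \<open>\<phi> 1\<close> times the powers of a single \<open>q\<close>.\<close>
  define y where "y = (\<lambda>i::nat. if even i then z [^] (i div 2) else z [^] (i div 2) \<otimes> s)"
  have yc: "y i \<in> carrier G" for i using zc c by (simp add: y_def)
  have ystep: "y (Suc i) = y i \<otimes> (if even i then s else s')" for i
  proof (cases "even i")
    case True thus ?thesis by (simp add: y_def)
  next
    case False
    hence "Suc i div 2 = Suc (i div 2)" by presburger
    thus ?thesis using False zc c by (simp add: y_def z_def m_assoc)
  qed
  have yturn: "y (Suc (Suc i)) \<noteq> y i" for i
  proof
    assume "y (Suc (Suc i)) = y i"
    hence "y i \<otimes> ((if even i then s else s') \<otimes> (if even i then s' else s)) = y i"
      using yc[of i] c ystep[of i] ystep[of "Suc i"] by (simp add: m_assoc split: if_splits)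
    hence "(if even i then s else s') \<otimes> (if even i then s' else s) = \<one>" using yc[of i] c by (simp split: if_splits)
    hence "s \<otimes> s' = \<one> \<or> s' \<otimes> s = \<one>" by (simp split: if_splits)
    thus False using c ss' s(2) is' inv_equality by metis
  qed
  have "\<exists>q\<in>{?\<sigma>, inv ?\<sigma>}. \<forall>i. \<phi> (y i) = \<phi> (y 0) \<otimes> q [^] i"
  proof (rule monotone_walk)
    show "\<phi> (y i) \<in> carrier G" for i using Bij_apply[OF \<phi>(1) yc] .
    show "\<phi> (y (Suc i)) \<in> {\<phi> (y i) \<otimes> ?\<sigma>, \<phi> (y i) \<otimes> inv ?\<sigma>}" for i
      using stepS[OF yc[of i]] stepS'[OF yc[of i]] ystep[of i] by simp
    show "\<phi> (y (Suc (Suc i))) \<noteq> \<phi> (y i)" for i using inj[OF yc yc] yturn by blast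
  qed (rule \<sigma>(3))
  then obtain q where q: "q \<in> {?\<sigma>, inv ?\<sigma>}" "\<And>i. \<phi> (y i) = \<phi> (y 0) \<otimes> q [^] i" by blast
  have qc: "q \<in> carrier G" using q(1) \<sigma>(3) by auto
  \<comment> \<open>By injectivity the path and its image return to the start at the same times; at
    even times this compares the orders of \<open>z\<close> and \<open>q^2\<close>.\<close>
  have qy: "q [^] i = \<one> \<longleftrightarrow> y i = \<one>" for i
  proof -
    have y0: "y 0 = \<one>" "\<phi> (y 0) \<in> carrier G" using Bij_apply[OF \<phi>(1) yc[of 0]] by (simp_all add: y_def)
    have "q [^] i = \<one> \<longleftrightarrow> \<phi> (y i) = \<phi> (y 0)" using q(2)[of i] y0 qc by simp
    thus ?thesis using inj[OF yc yc, of i 0] y0(1) by auto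
  qed
  have zq: "z [^] k = \<one> \<longleftrightarrow> (q [^] (2::nat)) [^] k = \<one>" for k :: nat
    using qy[of "2 * k"] qc by (simp add: y_def nat_pow_pow)
  have C: "subgroup (carrier G) G" by (rule subgroup_self)
  have even: "even (order G)"
  proof -
    have "s [^] (2::nat) = \<one>" using sq c by (simp add: numeral_2_eq_2)
    hence "ord s = 2" using ord_eq_prime[OF c(1) _ one two_is_prime_nat] by simp
    thus ?thesis using ord_dvd_group_order[OF c(1)] by simp
  qed
  let ?m = "order G div 2"
  let ?H = "torsion G (carrier G) ?m"
  have m: "upper_divisor (card (carrier G)) ?m" "odd ?m"
    using upper_divisor_half[OF sf even] by (simp_all add: order_def)
  have sf': "squarefree (card (carrier G))" using sf by (simp add: order_def)
  have H: "subgroup ?H G" "card ?H = ?m"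
    using subgroup_torsion_upper_divisor[OF C sf' m(1)] card_torsion_upper_divisor[OF C sf' m(1)] by auto
  have notH: "x \<notin> ?H" if x: "x \<in> {s, s'}" for x
  proof
    assume "x \<in> ?H"
    hence "x [^] ?m = \<one>" "x \<in> carrier G" by (auto simp: torsion_def)
    moreover have "x [^] (2::nat) = \<one>" using sq x c by (auto simp: numeral_2_eq_2)
    moreover have "coprime 2 ?m" using m(2) by simp
    ultimately show False using pow_coprime_eq_one one[OF x] by blast
  qed
  \<comment> \<open>The product of two elements outside a subgroup of index 2 lies inside; so
    \<open>z\<close> has odd order.\<close>
  have zH: "z \<in> ?H"
  proof -
    have i2: "2 * card ?H = order G" using H(2) even by simp
    obtain h where h: "h \<in> ?H" "s' = h \<otimes> s"
      using subgroup_index_2_cases[OF H(1) i2 c(1) _ c(2)] notH by auto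
    have hc: "h \<in> carrier G" using h by (auto simp: torsion_def)
    have "z = conj_by G s h" using h(2) hc c s(2) by (simp add: z_def conj_by_def m_assoc)
    thus ?thesis using subgroup_normalizes_torsion[OF C c(1), of ?m] h(1) by blast
  qed
  \<comment> \<open>As \<open>?m\<close> is odd, the path stands at time \<open>?m\<close> at a
    power of \<open>z\<close> times \<open>s\<close>, which is outside \<open>?H\<close>; hence
    \<open>?t\<close> is not the identity.\<close>
  let ?t = "q [^] ?m"
  have zm: "z [^] ?m = \<one>" using zH by (simp add: torsion_def)
  have "?t \<otimes> ?t = (q [^] (2::nat)) [^] ?m" using qc by (simp add: nat_pow_mult nat_pow_pow mult_2)
  hence t2: "?t \<otimes> ?t = \<one>" using zq[of ?m] zm by simp
  have t1: "?t \<noteq> \<one>"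
  proof
    assume "?t = \<one>"
    hence "z [^] (?m div 2) \<otimes> s = \<one>" using qy[of ?m] m(2) by (simp add: y_def)
    hence "z [^] (?m div 2) = inv s" using zc c inv_equality by (metis inv_inv nat_pow_closed)
    hence "s \<in> ?H" using subgroup_pow_closed[OF H(1) zH, of "?m div 2"] s(2) by simp
    thus False using notH by blast
  qed
  have "conj_by G s z = inv z"
    using c s(2) is' sq by (simp add: conj_by_def z_def inv_mult_group) (simp flip: m_assoc)
  moreover have "conj_by G ?t (q [^] (2::nat)) = q [^] (2::nat)"
    using conj_by_eq_self_iff[of ?t "q [^] (2::nat)"] qc by (simp add: nat_pow_mult add.commute)
  ultimately have "z = \<one>"
    using involution_inverts_and_centralizes[OF sf even c(1) one sq(1) _ t1 t2 zc zm _ _ _ zq] qc by simp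
  hence "s = s'" using c is' sq(2) inv_equality[of s s'] by (simp add: z_def)
  thus False using ss' by simp
qed

text \<open>\<open>A\<close> is the product of the translations and the stabilizer of the identity.
  The translations contribute \<open>p\<close> at most once, so \<open>p * p\<close> would put an
  element of odd order \<open>p\<close> into the stabilizer.\<close>

lemma prime_square_not_dvd_colour_perms:
  assumes sf: "squarefree (order G)" and S: "symmetric_subset G S" and conn: "graph_connected (Cay G S)"
    and p: "prime p" "odd p"
  shows "\<not> p * p dvd card (colour_perms G S)"
proof
  let ?B = "BijGroup (carrier G)"
  let ?A = "colour_perms G S" and ?L = "left_translation G ` carrier G"
  interpret B: finite_group ?B by (rule finite_group_BijGroup[OF finite_carrier])
  have A: "subgroup ?A ?B" using subgroup_colour_perms[OF S] .
  have L: "subgroup ?L ?B" by (rule subgroup_left_translations)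
  have bij: "a \<in> Bij (carrier G)" if "a \<in> ?A" for a using that by (simp add: colour_perms_def)
  define A1 where "A1 = {a \<in> ?A. a \<one> = \<one>}"
  have A1: "subgroup A1 ?B"
  proof (rule B.subgroupI)
    show "A1 \<subseteq> carrier ?B" using bij by (auto simp: A1_def carrier_BijGroup)
    have "\<one>\<^bsub>?B\<^esub> \<in> A1" using subgroup.one_closed[OF A] by (simp add: A1_def BijGroup_one_apply)
    thus "A1 \<noteq> {}" by blast
    show "inv\<^bsub>?B\<^esub> a \<in> A1" if a: "a \<in> A1" for a
    proof -
      have "inv\<^bsub>?B\<^esub> a \<in> ?A" using a subgroup.m_inv_closed[OF A] by (simp add: A1_def)
      moreover have "(inv\<^bsub>?B\<^esub> a) (a \<one>) = \<one>"
        using a bij by (intro inv_BijGroup_apply(1)) (auto simp: A1_def)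
      ultimately show ?thesis using a by (simp add: A1_def)
    qed
    show "a \<otimes>\<^bsub>?B\<^esub> b \<in> A1" if "a \<in> A1" "b \<in> A1" for a b
      using that subgroup.m_closed[OF A] BijGroup_apply[OF bij bij, of a b \<one>] by (simp add: A1_def)
  qed
  have "?L \<inter> A1 \<subseteq> {\<one>\<^bsub>?B\<^esub>}"
  proof
    fix f assume f: "f \<in> ?L \<inter> A1"
    then obtain g where "g \<in> carrier G" "f = left_translation G g" "f \<one> = \<one>" by (auto simp: A1_def)
    thus "f \<in> {\<one>\<^bsub>?B\<^esub>}" using left_translation_one left_translation_apply[OF one_closed] by simp
  qed
  hence "card (?L <#>\<^bsub>?B\<^esub> A1) = card ?L * card A1" using B.card_set_mult_disjoint[OF L A1] by simp
  moreover have "card ?L = order G" using left_translation_inj by (simp add: card_image order_def)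
  moreover have "?L <#>\<^bsub>?B\<^esub> A1 = ?A"
  proof
    show "?L <#>\<^bsub>?B\<^esub> A1 \<subseteq> ?A"
      using left_translation_colour_perms[OF S] subgroup.m_closed[OF A] by (auto simp: set_mult_def A1_def)
    show "?A \<subseteq> ?L <#>\<^bsub>?B\<^esub> A1"
    proof
      fix a assume a: "a \<in> ?A"
      let ?l = "left_translation G (a \<one>)"
      have a1: "a \<one> \<in> carrier G" using Bij_apply[OF bij[OF a]] by simp
      have lA: "?l \<in> ?A" using left_translation_colour_perms[OF S a1] .
      have l: "?l \<in> Bij (carrier G)" using bij[OF lA] .
      let ?b = "inv\<^bsub>?B\<^esub> ?l \<otimes>\<^bsub>?B\<^esub> a"
      have "?b \<one> = (inv\<^bsub>?B\<^esub> ?l) (a \<one>)" using BijGroup_apply[OF inv_Bij[OF l] bij[OF a] one_closed] .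
      also have "\<dots> = \<one>"
        using inv_BijGroup_apply(1)[OF l one_closed] a1 left_translation_apply[OF one_closed] by simp
      finally have "?b \<in> A1"
        using subgroup.m_closed[OF A subgroup.m_inv_closed[OF A lA] a] by (simp add: A1_def)
      moreover have "?l \<in> carrier ?B" "a \<in> carrier ?B" using l bij[OF a] by (simp_all add: carrier_BijGroup)
      hence "a = ?l \<otimes>\<^bsub>?B\<^esub> ?b" by (simp flip: B.m_assoc)
      ultimately show "a \<in> ?L <#>\<^bsub>?B\<^esub> A1" using a1 by (auto simp: set_mult_def)
    qed
  qed
  ultimately have card: "card ?A = order G * card A1" by simp
  assume pp: "p * p dvd card ?A"
  have "p dvd card A1"
  proof (rule ccontr)
    assume "\<not> p dvd card A1"
    hence "coprime p (card A1)" using p(1) prime_imp_coprime by blast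
    hence "coprime (p * p) (card A1)" by simp
    hence "p * p dvd order G" using pp card coprime_dvd_mult_left_iff by metis
    thus False using squarefree_dvd_square[OF sf p(1)] by simp
  qed
  then obtain a where a: "a \<in> A1" "a \<noteq> \<one>\<^bsub>?B\<^esub>" "a [^]\<^bsub>?B\<^esub> p = \<one>\<^bsub>?B\<^esub>"
    using B.cauchy_subgroup[OF A1 p(1)] by blast
  thus False
    using colour_perm_odd_order_fixing[OF S conn _ a(3) p(2) one_closed] by (simp add: A1_def)
qed

end

text \<open>In even order let \<open>H\<close> be the common odd part. For some \<open>s \<in> S\<close> outside \<open>H\<close> a power \<open>\<tau>\<close> of
  \<open>s\<close> is an involution, and right multiplication by \<open>\<tau>\<close> commutes with all of \<open>A\<close>. Hence the elements
  of the two regular groups that map \<open>1\<close> to \<open>\<tau>\<close> are both involutions. They act alike on the factors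
  of the tower, so an odd power of their product centralizes \<open>H\<close> and fixes \<open>1\<close>, which makes it trivial.\<close>

theorem (in finite_group) translations_conj_in_colour_perms:
  assumes sf: "squarefree (order G)" and S: "symmetric_subset G S" and conn: "graph_connected (Cay G S)"
    and b: "b \<in> Bij (carrier G)"
      "conj_by (BijGroup (carrier G)) b ` left_translation G ` carrier G \<subseteq> colour_perms G S"
  obtains a where "a \<in> colour_perms G S"
    "conj_by (BijGroup (carrier G)) (a \<otimes>\<^bsub>BijGroup (carrier G)\<^esub> b) ` left_translation G ` carrier G =
      left_translation G ` carrier G"
proof -
  let ?B = "BijGroup (carrier G)"
  let ?A = "colour_perms G S" and ?L = "left_translation G ` carrier G"
  interpret B: finite_group ?B by (rule finite_group_BijGroup[OF finite_carrier])
  have A: "subgroup ?A ?B" using subgroup_colour_perms[OF S] .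
  have L: "subgroup ?L ?B" by (rule subgroup_left_translations)
  have LA: "?L \<subseteq> ?A" using left_translation_colour_perms[OF S] by blast
  have bij: "a \<in> Bij (carrier G)" if "a \<in> ?A" for a using that by (simp add: colour_perms_def)
  have cardL: "card ?L = order G" using left_translation_inj by (simp add: card_image order_def)
  have sfL: "squarefree (card ?L)" using sf cardL by simp
  have bc: "b \<in> carrier ?B" using b(1) by (simp add: carrier_BijGroup)
  have LC: "?L \<subseteq> carrier ?B" using subgroup.subset[OF L] .
  have hall: "\<exists>a\<in>?A. conj_by ?B (a \<otimes>\<^bsub>?B\<^esub> b) ` torsion ?B ?L m = torsion ?B ?L m"
    if m: "upper_divisor (card ?L) m" "odd m" for m
  proof -
    have "\<not> p * p dvd card ?A" if p: "prime p" "p dvd m" for p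
    proof -
      have "odd p" using p(2) m(2) dvd_trans by blast
      thus ?thesis by (rule prime_square_not_dvd_colour_perms[OF sf S conn p(1)])
    qed
    thus ?thesis using B.torsion_conj_in_overgroup[OF A L LA sfL bc b(2) m(1)] by metis
  qed
  show ?thesis
  proof (cases "even (order G)")
    case False
    \<comment> \<open>In odd order all of \<open>?L\<close> is a level that the Sylow argument
      reaches.\<close>
    have "torsion ?B ?L (card ?L) = ?L" using B.subgroup_pow_card_eq_one[OF L] by (auto simp: torsion_def)
    moreover have "upper_divisor (card ?L) (card ?L)" "odd (card ?L)"
      using upper_divisor_self[OF B.subgroup_card_pos[OF L]] False cardL by simp_all
    ultimately show ?thesis using hall[of "card ?L"] that by auto
  next
    case True

    \<comment> \<open>The common odd part and the involution \<tau>\<close>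
    let ?m = "order G div 2"
    let ?HL = "torsion ?B ?L ?m" and ?H = "torsion G (carrier G) ?m"
    have mG: "upper_divisor (order G) ?m" "odd ?m" using upper_divisor_half[OF sf True] .
    have m: "upper_divisor (card ?L) ?m" "odd ?m" using mG cardL by simp_all
    have HL: "?HL = left_translation G ` ?H" by (rule torsion_left_translations)
    have C: "subgroup (carrier G) G" by (rule subgroup_self)
    have sfC: "squarefree (card (carrier G))" "upper_divisor (card (carrier G)) ?m"
      using sf mG by (simp_all add: order_def)
    have H: "subgroup ?H G" "card ?H = ?m"
      using subgroup_torsion_upper_divisor[OF C sfC] card_torsion_upper_divisor[OF C sfC] by auto
    have n0: "order G > 0" using sf by (auto intro: gr0I)
    \<comment> \<open>If all generators lay in \<open>?H\<close>, connectedness would confine the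
      whole group to this proper subgroup.\<close>
    have "\<exists>s\<in>S. s [^] ?m \<noteq> \<one>"
    proof (rule ccontr)
      assume none: "\<not> ?thesis"
      have "x \<in> ?H" if x: "x \<in> carrier G" for x
      proof (rule Cay_connected_induct[OF S conn one_closed _ _ x, where P = "\<lambda>x. x \<in> ?H"])
        show "\<one> \<in> ?H" using subgroup.one_closed[OF H(1)] .
        show "g \<otimes> s \<in> ?H" if "g \<in> carrier G" "s \<in> S" "g \<in> ?H" for g s
        proof -
          have "s \<in> ?H" using none that S by (auto simp: torsion_def symmetric_subset_def)
          thus ?thesis using subgroup.m_closed[OF H(1)] that by blast
        qed
      qed
      hence "?H = carrier G" by (auto simp: torsion_def)
      hence "?m = order G" using H(2) by (simp add: order_def)
      thus False using n0 True by presburger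
    qed
    then obtain s where s: "s \<in> S" "s [^] ?m \<noteq> \<one>" by blast
    let ?\<tau> = "s [^] ?m"
    have sc: "s \<in> carrier G" using s S by (auto simp: symmetric_subset_def)
    have \<tau>c: "?\<tau> \<in> carrier G" using sc by simp
    have "?\<tau> \<otimes> ?\<tau> = s [^] order G" using sc True by (simp add: nat_pow_mult flip: mult_2)
    hence \<tau>2: "?\<tau> \<otimes> ?\<tau> = \<one>" using pow_order_eq_1[OF sc] by simp
    have \<tau>H: "?\<tau> \<notin> ?H"
    proof
      assume "?\<tau> \<in> ?H"
      hence "?\<tau> [^] ?m = \<one>" by (simp add: torsion_def)
      moreover have "?\<tau> [^] (2::nat) = \<one>" using \<tau>2 \<tau>c by (simp add: numeral_2_eq_2)
      moreover have "coprime 2 ?m" using m(2) by simp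
      ultimately show False using pow_coprime_eq_one[OF \<tau>c] s(2) by blast
    qed
    have commute: "a (g \<otimes> ?\<tau>) = a g \<otimes> ?\<tau>" if "a \<in> ?A" "g \<in> carrier G" for a g
      using colour_perms_commute_right_mult[OF S that(1) s(1) \<tau>2 that(2)] .
    have cases: "x \<in> ?H \<or> (\<exists>h\<in>?H. x = h \<otimes> ?\<tau>)" if x: "x \<in> carrier G" for x
    proof -
      have "2 * card ?H = order G" using H(2) True by simp
      thus ?thesis using subgroup_index_2_cases[OF H(1) _ \<tau>c \<tau>H x] by metis
    qed
    obtain a where a: "a \<in> ?A" "conj_by ?B (a \<otimes>\<^bsub>?B\<^esub> b) ` ?HL = ?HL" using hall[OF m] by blast
    let ?b = "a \<otimes>\<^bsub>?B\<^esub> b"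
    have ac: "a \<in> carrier ?B" using bij[OF a(1)] by (simp add: carrier_BijGroup)
    have bc': "?b \<in> carrier ?B" using ac bc by simp
    have bb: "?b \<in> Bij (carrier G)" using bc' by (simp add: carrier_BijGroup)
    define L' where "L' = conj_by ?B ?b ` ?L"
    have L': "subgroup L' ?B" unfolding L'_def by (rule B.subgroup_conj_by_subgroup[OF L bc'])
    have L'C: "L' \<subseteq> carrier ?B" using subgroup.subset[OF L'] .
    have "L' = conj_by ?B a ` conj_by ?B b ` ?L" unfolding L'_def by (rule B.conj_by_image_comp[OF ac bc LC])
    hence L'A: "L' \<subseteq> ?A" using b(2) B.subgroup_conj_by[OF A a(1)] by auto
    have cardL': "card L' = card ?L" unfolding L'_def by (rule card_image[OF B.inj_on_conj_by[OF bc' LC]])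
    \<comment> \<open>As \<open>?b\<close> preserves \<open>?HL\<close>, this is also the odd part
      of \<open>L'\<close>.\<close>
    have HLL': "?HL = torsion ?B L' ?m"
      using a(2) B.conj_by_image_torsion[OF bc' LC, of ?m] by (simp add: L'_def)
    have conj_apply: "conj_by ?B ?b (left_translation G g) (?b x) = ?b (g \<otimes> x)"
      if g: "g \<in> carrier G" and x: "x \<in> carrier G" for g x
    proof -
      have l: "left_translation G g \<in> Bij (carrier G)" using left_translation_Bij[OF g] .
      have "?b \<otimes>\<^bsub>?B\<^esub> left_translation G g \<in> Bij (carrier G)"
        using B.m_closed[of ?b "left_translation G g"] bb l by (simp add: carrier_BijGroup)
      hence "conj_by ?B ?b (left_translation G g) (?b x) =
          (?b \<otimes>\<^bsub>?B\<^esub> left_translation G g) ((inv\<^bsub>?B\<^esub> ?b) (?b x))"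
        unfolding conj_by_def using BijGroup_apply[OF _ inv_Bij[OF bb] Bij_apply[OF bb x]] by blast
      thus ?thesis using BijGroup_apply[OF bb l x] inv_BijGroup_apply(1)[OF bb x] x
        by (simp add: left_translation_apply)
    qed
    have free: "l = \<one>\<^bsub>?B\<^esub>" if l: "l \<in> L'" "l x = x" and x: "x \<in> carrier G" for l x
    proof -
      obtain g where g: "g \<in> carrier G" "l = conj_by ?B ?b (left_translation G g)" using l(1) by (auto simp: L'_def)
      define y where "y = (inv\<^bsub>?B\<^esub> ?b) x"
      have y: "y \<in> carrier G" "x = ?b y"
        using Bij_apply[OF inv_Bij[OF bb] x] inv_BijGroup_apply(2)[OF bb x] by (simp_all add: y_def)
      have "?b (g \<otimes> y) = ?b y" using l(2) conj_apply[OF g(1) y(1)] g(2) y(2) by simp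
      hence "g \<otimes> y = y" using Bij_inj[OF bb] g(1) y(1) by blast
      hence "g = \<one>" using g(1) y(1) by simp
      thus ?thesis using g(2) bc' left_translation_one by simp
    qed

    \<comment> \<open>The involutions of the two regular groups over \<tau>\<close>
    obtain g' where g': "g' \<in> L'" "g' \<one> = ?\<tau>"
    proof -
      define y z where "y = (inv\<^bsub>?B\<^esub> ?b) \<one>" and "z = (inv\<^bsub>?B\<^esub> ?b) ?\<tau>"
      have y: "y \<in> carrier G" "?b y = \<one>"
        using Bij_apply[OF inv_Bij[OF bb] one_closed] inv_BijGroup_apply(2)[OF bb one_closed] by (simp_all add: y_def)
      have z: "z \<in> carrier G" "?b z = ?\<tau>"
        using Bij_apply[OF inv_Bij[OF bb] \<tau>c] inv_BijGroup_apply(2)[OF bb \<tau>c] by (simp_all add: z_def)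
      have "conj_by ?B ?b (left_translation G (z \<otimes> inv y)) \<one> = ?\<tau>"
        using conj_apply[of "z \<otimes> inv y" y] y z by (simp add: m_assoc)
      moreover have "conj_by ?B ?b (left_translation G (z \<otimes> inv y)) \<in> L'"
        using y z by (auto simp: L'_def)
      ultimately show ?thesis using that by blast
    qed
    have g'A: "g' \<in> ?A" using g' L'A by blast
    have g'c: "g' \<in> carrier ?B" using g' L'C by blast
    \<comment> \<open>\<open>g' (g' 1) = g' (1 \<tau>) = (g' 1) \<tau> = \<tau> \<tau> = 1\<close>,
      and only the identity of \<open>L'\<close> has a fixed point.\<close>
    have g'2: "g' \<otimes>\<^bsub>?B\<^esub> g' = \<one>\<^bsub>?B\<^esub>"
    proof (rule free[OF _ _ one_closed])
      show "g' \<otimes>\<^bsub>?B\<^esub> g' \<in> L'" using subgroup.m_closed[OF L' g'(1) g'(1)] .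
      have "(g' \<otimes>\<^bsub>?B\<^esub> g') \<one> = g' (\<one> \<otimes> ?\<tau>)"
        using BijGroup_apply[OF bij[OF g'A] bij[OF g'A] one_closed] g'(2) \<tau>c by simp
      also have "\<dots> = \<one>" using commute[OF g'A one_closed] g'(2) \<tau>2 by simp
      finally show "(g' \<otimes>\<^bsub>?B\<^esub> g') \<one> = \<one>" .
    qed
    have g'1: "g' \<noteq> \<one>\<^bsub>?B\<^esub>" using g'(2) s(2) BijGroup_one_apply[OF one_closed] by auto
    let ?t = "left_translation G ?\<tau>"
    have tL: "?t \<in> ?L" using \<tau>c by blast
    have tc: "?t \<in> carrier ?B" using tL LC by blast
    have tA: "?t \<in> ?A" using tL LA by blast
    have t2: "?t \<otimes>\<^bsub>?B\<^esub> ?t = \<one>\<^bsub>?B\<^esub>" using left_translation_mult[OF \<tau>c \<tau>c] \<tau>2 left_translation_one by simp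
    have t1: "?t \<noteq> \<one>\<^bsub>?B\<^esub>"
      using inj_onD[OF left_translation_inj _ \<tau>c one_closed] s(2) left_translation_one by auto
    let ?t' = "conj_by ?B ?b ?t"
    have t'L: "?t' \<in> L'" using tL by (auto simp: L'_def)
    have t'2: "?t' \<otimes>\<^bsub>?B\<^esub> ?t' = \<one>\<^bsub>?B\<^esub>" using t2 tc bc' by (simp flip: B.conj_by_mult)
    have t'1: "?t' \<noteq> \<one>\<^bsub>?B\<^esub>" using B.conj_by_inv_cancel(1)[OF bc' tc] t1 bc' by auto
    \<comment> \<open>Inside \<open>L'\<close> the prime 2 occurs only once, so Sylow conjugacy
      applies there. It makes \<open>g'\<close> the conjugate of \<open>?t\<close> by
      \<open>?h\<close>, which preserves the odd part.\<close>
    have "\<not> 4 dvd card L'" using squarefree_dvd_square[OF sfL two_is_prime_nat] cardL' by simp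
    then obtain n where n: "n \<in> L'" "conj_by ?B n ?t' = g'"
      using B.involutions_conjugate[OF L' _ t'L t'1 t'2 g'(1) g'1 g'2] by blast
    have nc: "n \<in> carrier ?B" using n L'C by blast
    let ?h = "n \<otimes>\<^bsub>?B\<^esub> ?b"
    have hc: "?h \<in> carrier ?B" using nc bc' by simp
    have ht: "conj_by ?B ?h ?t = g'" using n(2) B.conj_by_comp[OF nc bc' tc] by simp
    have HLC: "?HL \<subseteq> carrier ?B" by (rule subset_trans[OF B.torsion_subset LC])
    have normL': "conj_by ?B x ` ?HL = ?HL" if "x \<in> L'" for x
      using B.subgroup_normalizes_torsion[OF L' that] HLL' by simp
    have norm_h: "conj_by ?B ?h ` ?HL = ?HL"
      using B.conj_by_image_comp[OF nc bc' HLC] a(2) normL'[OF n(1)] by simp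
    have norm_t: "conj_by ?B ?t ` ?HL = ?HL" using B.subgroup_normalizes_torsion[OF L tL] .
    have level: "conj_by ?B x ` torsion ?B ?L d = torsion ?B ?L d"
      if "x \<in> carrier ?B" "conj_by ?B x ` ?HL = ?HL" "d dvd ?m" for x d
      using B.conj_by_image_torsion[OF that(1) HLC, of d] that(2) B.torsion_torsion[OF LC that(3)] by simp

    \<comment> \<open>Triviality of the product of the two involutions\<close>
    let ?u = "?t \<otimes>\<^bsub>?B\<^esub> g'"
    have uc: "?u \<in> carrier ?B" using tc g'c by simp
    have uA: "?u \<in> ?A" using subgroup.m_closed[OF A tA g'A] .
    have norm_u: "conj_by ?B ?u ` ?HL = ?HL"
      using B.conj_by_image_comp[OF tc g'c HLC] norm_t normL'[OF g'(1)] by simp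
    have triv: "conj_power_mod ?B (torsion ?B ?L d) (torsion ?B ?L (p * d)) ?u 1"
      if pd: "prime p" "upper_divisor (card ?L) (p * d)" "upper_divisor (card ?L) d" "p * d dvd ?m" for p d
    proof -
      let ?K = "torsion ?B ?L d" and ?M = "torsion ?B ?L (p * d)"
      have dm: "d dvd ?m" using pd(4) dvd_mult_right by blast
      have KM: "?K \<subseteq> carrier ?B" "?M \<subseteq> carrier ?B" by (rule subset_trans[OF B.torsion_subset LC])+
      have K: "subgroup ?K ?B" using B.subgroup_torsion_upper_divisor[OF L sfL pd(3)] .
      obtain j where j: "conj_power_mod ?B ?K ?M ?t j"
        using B.conj_power_mod_exists[OF L sfL pd(1-3) tc level[OF tc norm_t dm] level[OF tc norm_t pd(4)]] .
      have j': "conj_power_mod ?B ?K ?M g' j"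
        using B.conj_power_mod_conj_by[OF KM tc j hc level[OF hc norm_h dm] level[OF hc norm_h pd(4)]] ht by simp
      \<comment> \<open>Both \<open>g'\<close> and \<open>?t\<close> have multiplier
        \<open>j\<close>, so modulo \<open>?K\<close> conjugation by \<open>?t g'\<close> agrees
        with conjugation by \<open>?t ?t\<close>, the identity.\<close>
      have "cong_mod ?B ?K (conj_by ?B ?u z) (z [^]\<^bsub>?B\<^esub> (1::nat))" if z: "z \<in> ?M" for z
      proof -
        have zc: "z \<in> carrier ?B" using z KM by blast
        note conj_t = B.cong_mod_conj_by[OF _ _ tc level[OF tc norm_t dm]]
        have "cong_mod ?B ?K (conj_by ?B ?t (conj_by ?B g' z)) (conj_by ?B ?t (z [^]\<^bsub>?B\<^esub> j))"
          using j' z zc g'c by (intro conj_t) (simp_all add: conj_power_mod_def)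
        hence 1: "cong_mod ?B ?K (conj_by ?B ?u z) (conj_by ?B ?t (z [^]\<^bsub>?B\<^esub> j))"
          using B.conj_by_comp[OF tc g'c zc] by simp
        have "cong_mod ?B ?K (conj_by ?B ?t (conj_by ?B ?t z)) (conj_by ?B ?t (z [^]\<^bsub>?B\<^esub> j))"
          using j z zc tc by (intro conj_t) (simp_all add: conj_power_mod_def)
        hence "cong_mod ?B ?K z (conj_by ?B ?t (z [^]\<^bsub>?B\<^esub> j))"
          using B.conj_by_comp[OF tc tc zc] t2 zc by simp
        hence 2: "cong_mod ?B ?K (conj_by ?B ?t (z [^]\<^bsub>?B\<^esub> j)) z"
          using B.cong_mod_sym[OF K zc] zc tc by simp
        show ?thesis using B.cong_mod_trans[OF K _ _ _ 1 2] zc tc uc by simp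
      qed
      thus ?thesis by (simp add: conj_power_mod_def)
    qed
    obtain M where M: "odd M" "\<And>z. z \<in> ?HL \<Longrightarrow> conj_by ?B (?u [^]\<^bsub>?B\<^esub> (M::nat)) z = z"
      using B.odd_power_centralizes_torsion[OF L sfL m uc level[OF uc norm_u] triv] by blast
    let ?v = "?u [^]\<^bsub>?B\<^esub> M"
    have u1: "?u \<one> = \<one>"
      using BijGroup_apply[OF bij[OF tA] bij[OF g'A] one_closed] g'(2) \<tau>2 \<tau>c by (simp add: left_translation_apply)
    have vA: "?v \<in> ?A" using B.subgroup_pow_closed[OF A uA] .
    have vc: "?v \<in> carrier ?B" using uc by simp
    have v1: "?v \<one> = \<one>"
    proof -
      have "(?u [^]\<^bsub>?B\<^esub> (k::nat)) \<one> = \<one>" for k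
      proof (induction k)
        case 0 thus ?case by (simp add: BijGroup_one_apply)
      next
        case (Suc k)
        have "?u [^]\<^bsub>?B\<^esub> k \<in> Bij (carrier G)" using bij B.subgroup_pow_closed[OF A uA] by blast
        thus ?case using BijGroup_apply[OF _ bij[OF uA] one_closed] u1 Suc by simp
      qed
      thus ?thesis .
    qed
    \<comment> \<open>\<open>?v\<close> fixes 1 and commutes with the translations by
      \<open>?H\<close>, so it fixes \<open>?H\<close> pointwise. The other coset
      \<open>?H \<tau>\<close> follows below because \<open>?v\<close> commutes with right
      multiplication by \<tau>.\<close>
    have vH: "?v h = h" if h: "h \<in> ?H" for h
    proof -
      have hG: "h \<in> carrier G" using h by (simp add: torsion_def)
      let ?l = "left_translation G h"
      have l: "?l \<in> Bij (carrier G)" "?l \<in> carrier ?B"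
        using left_translation_Bij[OF hG] by (simp_all add: carrier_BijGroup)
      have "conj_by ?B ?v ?l = ?l" using M(2) h HL by blast
      hence "?v \<otimes>\<^bsub>?B\<^esub> ?l = ?l \<otimes>\<^bsub>?B\<^esub> ?v" using B.conj_by_eq_self_iff[OF vc l(2)] by simp
      hence "(?v \<otimes>\<^bsub>?B\<^esub> ?l) \<one> = (?l \<otimes>\<^bsub>?B\<^esub> ?v) \<one>" by simp
      hence "?v (?l \<one>) = ?l (?v \<one>)" using BijGroup_apply[OF bij[OF vA] l(1) one_closed]
        BijGroup_apply[OF l(1) bij[OF vA] one_closed] by simp
      thus ?thesis using v1 hG by (simp add: left_translation_apply)
    qed
    have "?v = \<one>\<^bsub>?B\<^esub>"
    proof (rule Bij_eqI[OF bij[OF vA]])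
      show "\<one>\<^bsub>?B\<^esub> \<in> Bij (carrier G)" using B.one_closed by (simp add: carrier_BijGroup)
      show "?v x = \<one>\<^bsub>?B\<^esub> x" if x: "x \<in> carrier G" for x
      proof -
        have "?v x = x"
          using cases[OF x]
        proof
          assume "\<exists>h\<in>?H. x = h \<otimes> ?\<tau>"
          then obtain h where h: "h \<in> ?H" "x = h \<otimes> ?\<tau>" by blast
          have "h \<in> carrier G" using h by (simp add: torsion_def)
          thus ?thesis using commute[OF vA, of h] vH[OF h(1)] h(2) by simp
        qed (rule vH)
        thus ?thesis using x by (simp add: BijGroup_one_apply)
      qed
    qed
    \<comment> \<open>The odd number \<open>M\<close> now annihilates \<open>?u\<close>, so the
      rigidity of odd-order elements fixing a vertex applies to \<open>?u\<close> itself.\<close>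
    hence "?u = \<one>\<^bsub>?B\<^esub>" using colour_perm_odd_order_fixing[OF S conn uA _ M(1) one_closed u1] by simp
    hence "?t \<otimes>\<^bsub>?B\<^esub> g' = ?t \<otimes>\<^bsub>?B\<^esub> ?t" using t2 by simp
    hence "g' = ?t" using tc g'c by simp
    hence tL': "?t \<in> L'" using g'(1) by simp
    have HL': "?HL \<subseteq> L'" unfolding HLL' by (rule B.torsion_subset)
    have "?L \<subseteq> L'"
    proof (rule image_subsetI)
      fix x assume x: "x \<in> carrier G"
      show "left_translation G x \<in> L'"
        using cases[OF x]
      proof
        assume "x \<in> ?H" thus ?thesis using HL HL' by blast
      next
        assume "\<exists>h\<in>?H. x = h \<otimes> ?\<tau>"
        then obtain h where h: "h \<in> ?H" "x = h \<otimes> ?\<tau>" by blast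
        have hG: "h \<in> carrier G" using h by (simp add: torsion_def)
        have "left_translation G h \<in> L'" using h HL HL' by blast
        thus ?thesis using left_translation_mult[OF hG \<tau>c] h(2) subgroup.m_closed[OF L' _ tL'] by simp
      qed
    qed
    hence "?L = L'" using card_subset_eq[OF B.finite_subgroup[OF L']] cardL' by simp
    thus ?thesis using that[OF a(1)] by (simp add: L'_def)
  qed
qed

text \<open>The colour condition carries edges to edges; non-edges are handled by applying it to the
  inverse permutation, which lies in the same group.\<close>

lemma (in group) colour_perms_colour_preserving_automorphism:
  assumes S: "symmetric_subset G S" and a: "a \<in> colour_perms G S"
  shows "colour_preserving_automorphism G S a"
proof -
  have bij: "b \<in> Bij (carrier G)" if "b \<in> colour_perms G S" for b using that by (simp add: colour_perms_def)
  have SC: "s \<in> carrier G" "inv s \<in> S" if "s \<in> S" for s using S that by (auto simp: symmetric_subset_def)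
  have edge: "{b u, b v} \<in> snd (Cay G S)"
    if b: "b \<in> colour_perms G S" and uv: "{u, v} \<in> snd (Cay G S)" for b u v
  proof -
    obtain g s where gs: "{u, v} = {g, g \<otimes> s}" "g \<in> carrier G" "s \<in> S" using uv by (auto simp: Cay_def)
    have "{b u, b v} = b ` {u, v}" by simp
    also have "\<dots> = {b g, b (g \<otimes> s)}" by (simp add: gs(1))
    finally have "{b u, b v} = {b g, b (g \<otimes> s)}" .
    moreover have "b (g \<otimes> s) \<in> {b g \<otimes> s, b g \<otimes> inv s}"
      using colour_perms_apply[OF S b gs(2,3)] by simp
    ultimately have "\<exists>r\<in>S. {b u, b v} = {b g, b g \<otimes> r}" using gs(3) SC by auto
    thus ?thesis using Bij_apply[OF bij[OF b] gs(2)] unfolding Cay_def by auto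
  qed
  let ?i = "inv\<^bsub>BijGroup (carrier G)\<^esub> a"
  have i: "?i \<in> colour_perms G S" using subgroup.m_inv_closed[OF subgroup_colour_perms[OF S] a] .
  have "{u, v} \<in> snd (Cay G S) \<longleftrightarrow> {a u, a v} \<in> snd (Cay G S)" if "u \<in> carrier G" "v \<in> carrier G" for u v
    using edge[OF a, of u v] edge[OF i, of "a u" "a v"] inv_BijGroup_apply(1)[OF bij[OF a]] that by auto
  moreover have "bij_betw a (carrier G) (carrier G)" using bij[OF a] by (simp add: Bij_def)
  moreover have "fst (Cay G S) = carrier G" by (simp add: Cay_def)
  moreover have "\<forall>g\<in>carrier G. \<forall>s\<in>S. a (g \<otimes> s) \<in> {a g \<otimes> s, a g \<otimes> inv s}"
    using a by (simp add: colour_perms_def colour_map_def)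
  ultimately show ?thesis by (simp add: colour_preserving_automorphism_def graph_isomorphism_def)
qed

text \<open>The normalizer of the translations is the holomorph, in which automorphisms are the
  elements fixing the identity: if \<open>f\<close> conjugates the translation by \<open>g\<close>
  to that by \<open>k\<close>, evaluating at the identity gives \<open>k = f g\<close>.\<close>

lemma (in group) normalizer_left_translations_iso:
  assumes f: "f \<in> Bij (carrier G)" "f \<one> = \<one>"
    and norm: "conj_by (BijGroup (carrier G)) f ` left_translation G ` carrier G = left_translation G ` carrier G"
  shows "f \<in> iso G G"
proof -
  let ?B = "BijGroup (carrier G)"
  interpret B: group ?B by (rule group_BijGroup)
  have fc: "f \<in> carrier ?B" using f(1) by (simp add: carrier_BijGroup)
  have "f (g \<otimes> x) = f g \<otimes> f x" if g: "g \<in> carrier G" and x: "x \<in> carrier G" for g x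
  proof -
    let ?l = "left_translation G g"
    have l: "?l \<in> Bij (carrier G)" "?l \<in> carrier ?B"
      using left_translation_Bij[OF g] by (simp_all add: carrier_BijGroup)
    obtain k where k: "k \<in> carrier G" "conj_by ?B f ?l = left_translation G k" using norm g by blast
    have "f \<otimes>\<^bsub>?B\<^esub> ?l = conj_by ?B f ?l \<otimes>\<^bsub>?B\<^esub> f" using fc l by (simp add: conj_by_def B.m_assoc)
    hence eq: "f \<otimes>\<^bsub>?B\<^esub> ?l = left_translation G k \<otimes>\<^bsub>?B\<^esub> f" using k by simp
    have ev: "f (g \<otimes> y) = k \<otimes> f y" if y: "y \<in> carrier G" for y
      using fun_cong[OF eq, of y] BijGroup_apply[OF f(1) l(1) y]
        BijGroup_apply[OF left_translation_Bij[OF k(1)] f(1) y] Bij_apply[OF f(1) y] y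
      by (simp add: left_translation_apply)
    have "f g = k" using ev[OF one_closed] f(2) g k by simp
    thus ?thesis using ev[OF x] by simp
  qed
  thus ?thesis using f(1) Bij_apply[OF f(1)] by (auto simp: iso_def hom_def Bij_def)
qed

theorem theorem1p6:
  fixes G :: "('a, 'm) monoid_scheme" and S1 S2 :: "'a set" and \<phi> :: "'a \<Rightarrow> 'a"
  assumes "group G"
    and "finite (carrier G)"
    and "squarefree (order G)"
    and "symmetric_subset G S1"
    and "symmetric_subset G S2"
    and "graph_connected (Cay G S1)"
    and "graph_connected (Cay G S2)"
    and "chromatic_isomorphism G S1 G S2 \<phi>"
  shows "\<exists>\<psi> \<alpha>. colour_preserving_automorphism G S1 \<psi> \<and> \<alpha> \<in> iso G G \<and>
    (\<forall>g\<in>carrier G. \<phi> g = (\<alpha> \<circ> \<psi>) g)"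
proof -
  interpret finite_group G using assms(1,2) by (simp add: finite_group_def finite_group_axioms_def)
  note sf = assms(3) and S1 = assms(4) and S2 = assms(5)
  let ?B = "BijGroup (carrier G)"
  let ?A = "colour_perms G S1" and ?L = "left_translation G ` carrier G"
  interpret B: finite_group ?B by (rule finite_group_BijGroup[OF finite_carrier])
  have A: "subgroup ?A ?B" using subgroup_colour_perms[OF S1] .
  have L: "subgroup ?L ?B" by (rule subgroup_left_translations)
  have LA: "?L \<subseteq> ?A" using left_translation_colour_perms[OF S1] by blast
  have AC: "?A \<subseteq> carrier ?B" and LC: "?L \<subseteq> carrier ?B" using subgroup.subset[OF A] subgroup.subset[OF L] .
  have S1C: "s \<in> carrier G" "inv\<^bsub>G\<^esub> s \<in> S1" if "s \<in> S1" for s using S1 that by (auto simp: symmetric_subset_def)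
  obtain \<pi> where \<pi>: "bij_betw \<pi> S1 S2" "colour_map G S1 \<pi> \<phi>"
    using assms(8) by (auto simp: chromatic_isomorphism_def colour_map_def)
  have \<pi>C: "\<pi> s \<in> carrier G" if "s \<in> S1" for s
    using \<pi>(1) S2 that by (auto simp: symmetric_subset_def bij_betw_def)
  \<comment> \<open>Elements of \<open>BijGroup\<close> are \<open>undefined\<close> off the
    carrier, where \<phi> is arbitrary.\<close>
  define \<Phi> where "\<Phi> = restrict \<phi> (carrier G)"
  have bij\<phi>: "bij_betw \<phi> (carrier G) (carrier G)"
    using assms(8) by (simp add: chromatic_isomorphism_def graph_isomorphism_def Cay_def)
  have \<Phi>: "\<Phi> \<in> Bij (carrier G)"
    using bij\<phi> bij_betw_cong[of "carrier G" \<Phi> \<phi> "carrier G"] by (simp add: Bij_def \<Phi>_def)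
  have \<Phi>m: "colour_map G S1 \<pi> \<Phi>" using \<pi>(2) S1C by (simp add: colour_map_def \<Phi>_def)
  have \<Phi>c: "\<Phi> \<in> carrier ?B" using \<Phi> by (simp add: carrier_BijGroup)
  let ?b = "inv\<^bsub>?B\<^esub> \<Phi>"
  have b: "?b \<in> Bij (carrier G)" using inv_Bij[OF \<Phi>] .
  have bc: "?b \<in> carrier ?B" using \<Phi>c by simp
  \<comment> \<open>\<Phi> changes colours by \<pi>, a left translation keeps them, and the inverse
    of \<Phi> changes them back.\<close>
  have "conj_by ?B ?b (left_translation G g) \<in> ?A" if g: "g \<in> carrier G" for g
  proof -
    let ?f = "conj_by ?B ?b (left_translation G g)"
    have l: "left_translation G g \<in> Bij (carrier G)" using left_translation_Bij[OF g] .
    have f: "?f \<in> Bij (carrier G)"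
      using B.conj_by_closed[OF bc, of "left_translation G g"] l by (simp add: carrier_BijGroup)
    have eval: "?f x = ?b (g \<otimes>\<^bsub>G\<^esub> \<Phi> x)" if x: "x \<in> carrier G" for x
    proof -
      have "?b \<otimes>\<^bsub>?B\<^esub> left_translation G g \<in> Bij (carrier G)"
        using B.m_closed[of ?b "left_translation G g"] b l by (simp add: carrier_BijGroup)
      thus ?thesis
        using BijGroup_apply[OF _ \<Phi> x, of "?b \<otimes>\<^bsub>?B\<^esub> left_translation G g"]
          BijGroup_apply[OF b l Bij_apply[OF \<Phi> x]] Bij_apply[OF \<Phi> x] \<Phi>c
        by (simp add: conj_by_def left_translation_apply)
    qed
    have "?f (x \<otimes>\<^bsub>G\<^esub> s) \<in> {?f x \<otimes>\<^bsub>G\<^esub> s, ?f x \<otimes>\<^bsub>G\<^esub> inv\<^bsub>G\<^esub> s}" if x: "x \<in> carrier G" "s \<in> S1" for x s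
    proof -
      have c: "\<Phi> x \<in> carrier G" "g \<otimes>\<^bsub>G\<^esub> \<Phi> x \<in> carrier G" "\<pi> s \<in> carrier G"
        using Bij_apply[OF \<Phi> x(1)] g \<pi>C[OF x(2)] by auto
      \<comment> \<open>Guards the way back: a colour pair of two elements coming from one
        involution could not be pulled back to a single colour.\<close>
      have inv: "inv\<^bsub>G\<^esub> (\<pi> s) = \<pi> s" if "inv\<^bsub>G\<^esub> s = s"
        using colour_map_involution[OF sf S1 S2 \<Phi> \<Phi>m \<pi>(1) x(2) that] .
      have "\<Phi> (x \<otimes>\<^bsub>G\<^esub> s) \<in> {\<Phi> x \<otimes>\<^bsub>G\<^esub> \<pi> s, \<Phi> x \<otimes>\<^bsub>G\<^esub> inv\<^bsub>G\<^esub> (\<pi> s)}" using colour_mapD[OF \<Phi>m x] .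
      hence "g \<otimes>\<^bsub>G\<^esub> \<Phi> (x \<otimes>\<^bsub>G\<^esub> s) \<in> {g \<otimes>\<^bsub>G\<^esub> \<Phi> x \<otimes>\<^bsub>G\<^esub> \<pi> s, g \<otimes>\<^bsub>G\<^esub> \<Phi> x \<otimes>\<^bsub>G\<^esub> inv\<^bsub>G\<^esub> (\<pi> s)}"
        using c g by (auto simp: m_assoc)
      hence "?b (g \<otimes>\<^bsub>G\<^esub> \<Phi> (x \<otimes>\<^bsub>G\<^esub> s)) \<in>
          {?b (g \<otimes>\<^bsub>G\<^esub> \<Phi> x) \<otimes>\<^bsub>G\<^esub> s, ?b (g \<otimes>\<^bsub>G\<^esub> \<Phi> x) \<otimes>\<^bsub>G\<^esub> inv\<^bsub>G\<^esub> s}"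
        using colour_map_inv[OF S1 \<Phi> \<Phi>m c(3) inv c(2) x(2)] by blast
      thus ?thesis using eval[OF x(1)] eval[of "x \<otimes>\<^bsub>G\<^esub> s"] x S1C by simp
    qed
    thus ?thesis using f by (simp add: colour_perms_def colour_map_def)
  qed
  hence "conj_by ?B ?b ` ?L \<subseteq> ?A" by blast
  then obtain a where a: "a \<in> ?A" "conj_by ?B (a \<otimes>\<^bsub>?B\<^esub> ?b) ` ?L = ?L"
    using translations_conj_in_colour_perms[OF sf S1 assms(6) b] by blast
  have ac: "a \<in> carrier ?B" using a(1) AC by blast
  let ?f0 = "\<Phi> \<otimes>\<^bsub>?B\<^esub> inv\<^bsub>?B\<^esub> a"
  have f0c: "?f0 \<in> carrier ?B" using \<Phi>c ac by simp
  have "inv\<^bsub>?B\<^esub> (a \<otimes>\<^bsub>?B\<^esub> ?b) = ?f0" using ac \<Phi>c by (simp add: B.inv_mult_group)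
  hence norm0: "conj_by ?B ?f0 ` ?L = ?L"
    using B.conj_by_image_inv[OF _ LC a(2)] ac bc by simp
  have f0: "?f0 \<in> Bij (carrier G)" using f0c by (simp add: carrier_BijGroup)
  \<comment> \<open>\<open>?f0\<close> normalizes the translations but may move the identity;
    \<open>l\<close> corrects this.\<close>
  define l where "l = left_translation G (?f0 \<one>\<^bsub>G\<^esub>)"
  have o: "?f0 \<one>\<^bsub>G\<^esub> \<in> carrier G" using Bij_apply[OF f0 one_closed] .
  have lL: "l \<in> ?L" using o by (simp add: l_def)
  have lc: "l \<in> carrier ?B" using lL LC by blast
  have lb: "l \<in> Bij (carrier G)" using lc by (simp add: carrier_BijGroup)
  define \<alpha> where "\<alpha> = inv\<^bsub>?B\<^esub> l \<otimes>\<^bsub>?B\<^esub> ?f0"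
  have \<alpha>c: "\<alpha> \<in> carrier ?B" using lc f0c by (simp add: \<alpha>_def)
  have \<alpha>b: "\<alpha> \<in> Bij (carrier G)" using \<alpha>c by (simp add: carrier_BijGroup)
  have "l \<one>\<^bsub>G\<^esub> = ?f0 \<one>\<^bsub>G\<^esub>" using o by (simp add: l_def left_translation_apply)
  hence \<alpha>1: "\<alpha> \<one>\<^bsub>G\<^esub> = \<one>\<^bsub>G\<^esub>"
    using BijGroup_apply[OF inv_Bij[OF lb] f0 one_closed] inv_BijGroup_apply(1)[OF lb one_closed] by (simp add: \<alpha>_def)
  have "conj_by ?B (inv\<^bsub>?B\<^esub> l) ` ?L = ?L" using B.subgroup_conj_by_image[OF L subgroup.m_inv_closed[OF L lL]] .
  hence norm: "conj_by ?B \<alpha> ` ?L = ?L"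
    unfolding \<alpha>_def using B.conj_by_image_comp[OF _ f0c LC, of "inv\<^bsub>?B\<^esub> l"] lc norm0 by simp
  have iso: "\<alpha> \<in> iso G G" using normalizer_left_translations_iso[OF \<alpha>b \<alpha>1 norm] .
  \<comment> \<open>In \<open>\<Phi> = l \<alpha> a\<close> the translation is pulled past \<alpha>:
    \<open>\<Phi> = \<alpha> (\<alpha>^-1 l \<alpha>) a\<close>, where the bracket is again a
    translation.\<close>
  define \<psi> where "\<psi> = conj_by ?B (inv\<^bsub>?B\<^esub> \<alpha>) l \<otimes>\<^bsub>?B\<^esub> a"
  have "conj_by ?B (inv\<^bsub>?B\<^esub> \<alpha>) l \<in> ?L" using B.conj_by_image_inv[OF \<alpha>c LC norm] lL by blast
  hence \<psi>A: "\<psi> \<in> ?A" using LA a(1) subgroup.m_closed[OF A] by (auto simp: \<psi>_def)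
  have "\<alpha> \<otimes>\<^bsub>?B\<^esub> \<psi> = l \<otimes>\<^bsub>?B\<^esub> \<alpha> \<otimes>\<^bsub>?B\<^esub> a"
    using \<alpha>c lc ac by (simp add: \<psi>_def conj_by_def B.m_assoc) (simp flip: B.m_assoc)
  also have "l \<otimes>\<^bsub>?B\<^esub> \<alpha> = ?f0" using lc f0c by (simp add: \<alpha>_def flip: B.m_assoc)
  also have "?f0 \<otimes>\<^bsub>?B\<^esub> a = \<Phi>" using \<Phi>c ac by (simp add: B.m_assoc)
  finally have eq: "\<alpha> \<otimes>\<^bsub>?B\<^esub> \<psi> = \<Phi>" .
  have \<psi>b: "\<psi> \<in> Bij (carrier G)" using \<psi>A by (simp add: colour_perms_def)
  have "\<phi> g = (\<alpha> \<circ> \<psi>) g" if g: "g \<in> carrier G" for g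
    using BijGroup_apply[OF \<alpha>b \<psi>b g] g by (simp add: eq \<Phi>_def)
  thus ?thesis using iso colour_perms_colour_preserving_automorphism[OF S1 \<psi>A] by blast
qed

end
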